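(* Let $\varphi$ be an Orlicz $N$-function and let $w=(w(k))_{k=1}^\infty$ be a weight sequence such that $W(\infty)=\infty$. If $\varphi$ satisfies the $\Delta_2^0$ condition, then the Orlicz-Lorentz sequence space $\lambda_{\varphi,w}$ is a separable dual space. Consequently $\lambda_{\varphi,w}$ has the Radon-Nikodým property, and there exist nonempty relatively weakly open subsets of the unit ball $B_{\lambda_{\varphi,w}}$ with arbitrarily small diameter.
   Context: Decreasing means non-increasing. A weight sequence is a decreasing sequence $w=(w(k))_{k=1}^\infty$ of positive reals; $W(\infty)=\sum_{k=1}^\infty w(k)$. For a real sequence $x=(x(k))_{k=1}^\infty$, let $d_x(\lambda)$ be the number of $k$ with $|x(k)|>\lambda$, and let $x^*(k)=\inf\{\lambda>0:d_x(\lambda)<k\}$, $k\in\mathbb{N}$, be its decreasing rearrangement (values in $[0,\infty]$, $\inf\emptyset=\infty$). An Orlicz function is a convex $\varphi:[0,\infty)\to[0,\infty)$ with $\varphi(0)=0$ and $\varphi(u)>0$ for $u>0$ (and $\varphi(\infty)=\infty$). It is an Orlicz $N$-function if moreover $\lim_{u\to 0^+}\varphi(u)/u=0$ and $\lim_{u\to\infty}\varphi(u)/u=\infty$. $\varphi$ satisfies $\Delta_2^0$ if there are $K>0$, $u_0>0$ with $\varphi(2u)\le K\varphi(u)$ for all $0\le u\le u_0$. Let $\alpha(x)=\sum_{k=1}^\infty\varphi(x^*(k))w(k)$. The Orlicz-Lorentz sequence space is $\lambda_{\varphi,w}=\{x:\alpha(\lambda x)<\infty\text{ for some }\lambda>0\}$,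 a real Banach space with the Luxemburg norm $\|x\|=\inf\{\epsilon>0:\alpha(x/\epsilon)\le 1\}$. $B_{\lambda_{\varphi,w}}$ is its closed unit ball; a relatively weakly open subset of it is its intersection with a weakly open subset of the space. A dual space is a Banach space isometrically isomorphic to $X^*$ for some Banach space $X$. *)

theory Defs
  imports "HOL-Analysis.Analysis" "HOL-Library.Function_Algebras"
begin

section \<open>Real functions as a vector space\<close>

instantiation "fun" :: (type, scaleR) scaleR
begin
definition scaleR_fun_def: "c *\<^sub>R f = (\<lambda>a. c *\<^sub>R f a)"
instance ..
end

instance "fun" :: (type, real_vector) real_vector
  by standard (simp_all add: scaleR_fun_def plus_fun_def fun_eq_iff scaleR_add_right scaleR_add_left)

section \<open>Normed spaces with an explicit carrier\<close>

text \<open>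
  The space in question depends on the parameters \<open>\<phi>\<close> and \<open>w\<close>, and a predual has to be quantified
  existentially, so neither can be a type. A normed space is therefore a pair of a linear subspace
  \<open>V\<close> of some ambient real vector space and a function \<open>N\<close> whose restriction to \<open>V\<close> is a norm; the
  values of \<open>N\<close> outside \<open>V\<close> are irrelevant. This is no restriction on \<open>V\<close>, since the ambient type
  is arbitrary.
\<close>

definition normed_space_on :: "'v::real_vector set \<Rightarrow> ('v \<Rightarrow> real) \<Rightarrow> bool" where
  "normed_space_on V N \<longleftrightarrow> subspace V \<and>
     (\<forall>x\<in>V. 0 \<le> N x \<and> (N x = 0 \<longleftrightarrow> x = 0)) \<and>
     (\<forall>x\<in>V. \<forall>c. N (c *\<^sub>R x) = \<bar>c\<bar> * N x) \<and>
     (\<forall>x\<in>V. \<forall>y\<in>V. N (x + y) \<le> N x + N y)"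

text \<open>The locale \<open>Metric_space\<close> wants a symmetric nonnegative distance also off the carrier.\<close>

definition norm_dist :: "'v::real_vector set \<Rightarrow> ('v \<Rightarrow> real) \<Rightarrow> 'v \<Rightarrow> 'v \<Rightarrow> real" where
  "norm_dist V N x y = (if x \<in> V \<and> y \<in> V then N (x - y) else 0)"

lemma Metric_space_norm_dist:
  assumes "normed_space_on V N"
  shows "Metric_space V (norm_dist V N)"
proof -
  have diff: "x - y \<in> V" if "x \<in> V" "y \<in> V" for x y
    using assms that by (simp add: normed_space_on_def subspace_diff)
  have nonneg: "0 \<le> N x" and eq0: "N x = 0 \<longleftrightarrow> x = 0"
    and scale: "N (c *\<^sub>R x) = \<bar>c\<bar> * N x" if "x \<in> V" for x c
    using assms that by (simp_all add: normed_space_on_def)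
  have tri: "N (x + y) \<le> N x + N y" if "x \<in> V" "y \<in> V" for x y
    using assms that by (simp add: normed_space_on_def)
  have sym: "N (y - x) = N (x - y)" if "x \<in> V" "y \<in> V" for x y
    using scale[OF diff[OF that], of "- 1"] by simp
  show ?thesis
  proof (rule Metric_space.intro)
    show "0 \<le> norm_dist V N x y" for x y
      by (simp add: norm_dist_def nonneg diff)
    show "norm_dist V N x y = norm_dist V N y x" for x y
      by (simp add: norm_dist_def sym)
    show "norm_dist V N x y = 0 \<longleftrightarrow> x = y" if "x \<in> V" "y \<in> V" for x y
      using that by (simp add: norm_dist_def eq0 diff)
    show "norm_dist V N x z \<le> norm_dist V N x y + norm_dist V N y z"
      if "x \<in> V" "y \<in> V" "z \<in> V" for x y z
      using that tri[OF diff[of x y] diff[of y z]] by (simp add: norm_dist_def)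
  qed
qed

definition banach_space_on :: "'v::real_vector set \<Rightarrow> ('v \<Rightarrow> real) \<Rightarrow> bool" where
  "banach_space_on V N \<longleftrightarrow>
     normed_space_on V N \<and> Metric_space.mcomplete V (norm_dist V N)"

definition separable_on :: "'v::real_vector set \<Rightarrow> ('v \<Rightarrow> real) \<Rightarrow> bool" where
  "separable_on V N \<longleftrightarrow> separable_space (Metric_space.mtopology V (norm_dist V N))"

definition unit_ball :: "'v set \<Rightarrow> ('v \<Rightarrow> real) \<Rightarrow> 'v set" where
  "unit_ball V N = {x\<in>V. N x \<le> 1}"

definition linear_map_on ::
    "'v::real_vector set \<Rightarrow> ('v \<Rightarrow> 'u::real_vector) \<Rightarrow> bool" where
  "linear_map_on V T \<longleftrightarrow>
     (\<forall>x\<in>V. \<forall>y\<in>V. T (x + y) = T x + T y) \<and> (\<forall>x\<in>V. \<forall>c. T (c *\<^sub>R x) = c *\<^sub>R T x)"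

text \<open>
  A bounded functional is represented by the function that extends it by 0 outside \<open>V\<close>, so that
  different elements of the dual are different functions.
\<close>

definition dual_carrier ::
    "'v::real_vector set \<Rightarrow> ('v \<Rightarrow> real) \<Rightarrow> ('v \<Rightarrow> real) set" where
  "dual_carrier V N = {f. linear_map_on V f \<and> (\<exists>C. \<forall>x\<in>V. \<bar>f x\<bar> \<le> C * N x) \<and> (\<forall>x. x \<notin> V \<longrightarrow> f x = 0)}"

definition dual_norm ::
    "'v::real_vector set \<Rightarrow> ('v \<Rightarrow> real) \<Rightarrow> ('v \<Rightarrow> real) \<Rightarrow> real" where
  "dual_norm V N f = (SUP x\<in>unit_ball V N. \<bar>f x\<bar>)"

definition isometrically_isomorphic ::
    "'v::real_vector set \<Rightarrow> ('v \<Rightarrow> real) \<Rightarrow> 'u::real_vector set \<Rightarrow> ('u \<Rightarrow> real) \<Rightarrow> bool" where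
  "isometrically_isomorphic V N V' N' \<longleftrightarrow>
     (\<exists>T. linear_map_on V T \<and> bij_betw T V V' \<and> (\<forall>x\<in>V. N' (T x) = N x))"

text \<open>
  Taking the predual \<open>X\<close> inside the same ambient type loses nothing: the Hamel dimension of a normed
  space is at most that of its dual, so if \<open>V\<close> is isomorphic to the dual of a Banach space, then
  that Banach space embeds linearly into \<open>'v\<close>.
\<close>

definition dual_space :: "'v::real_vector set \<Rightarrow> ('v \<Rightarrow> real) \<Rightarrow> bool" where
  "dual_space V N \<longleftrightarrow> banach_space_on V N \<and>
     (\<exists>(X :: 'v set) NX. banach_space_on X NX \<and>
        isometrically_isomorphic V N (dual_carrier X NX) (dual_norm X NX))"

definition weak_topology_on :: "'v::real_vector set \<Rightarrow> ('v \<Rightarrow> real) \<Rightarrow> 'v topology" where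
  "weak_topology_on V N =
     topology_generated_by {{x\<in>V. f x \<in> S} | f S. f \<in> dual_carrier V N \<and> open S}"

definition norm_diameter :: "('v::real_vector \<Rightarrow> real) \<Rightarrow> 'v set \<Rightarrow> real" where
  "norm_diameter N U = (SUP (x, y)\<in>U \<times> U. N (x - y))"

section \<open>Bochner integral and Radon-Nikodym property\<close>

text \<open>
  The library's Bochner integral needs a Banach space that is a type; the following definitions
  repeat it for a carrier. (The notions for simple functions are available for every real vector
  space.)
\<close>

definition simple_function_into :: "'m measure \<Rightarrow> 'v::real_vector set \<Rightarrow> ('m \<Rightarrow> 'v) \<Rightarrow> bool" where
  "simple_function_into M V s \<longleftrightarrow> Bochner_Integration.simple_bochner_integrable M s \<and> s ` space M \<subseteq> V"

definition strongly_measurable_on ::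
    "'m measure \<Rightarrow> 'v::real_vector set \<Rightarrow> ('v \<Rightarrow> real) \<Rightarrow> ('m \<Rightarrow> 'v) \<Rightarrow> bool" where
  "strongly_measurable_on M V N f \<longleftrightarrow> f ` space M \<subseteq> V \<and>
     (\<exists>s. (\<forall>i::nat. simple_function_into M V (s i)) \<and>
          (AE \<omega> in M. (\<lambda>i. N (s i \<omega> - f \<omega>)) \<longlonglongrightarrow> 0))"

definition has_bochner_integral_on ::
    "'m measure \<Rightarrow> 'v::real_vector set \<Rightarrow> ('v \<Rightarrow> real) \<Rightarrow> ('m \<Rightarrow> 'v) \<Rightarrow> 'v \<Rightarrow> bool" where
  "has_bochner_integral_on M V N f I \<longleftrightarrow> strongly_measurable_on M V N f \<and> I \<in> V \<and>
     (\<exists>s. (\<forall>i::nat. simple_function_into M V (s i)) \<and>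
          (\<lambda>i. \<integral>\<^sup>+\<omega>. ennreal (N (f \<omega> - s i \<omega>)) \<partial>M) \<longlonglongrightarrow> 0 \<and>
          (\<lambda>i. N (Bochner_Integration.simple_bochner_integral M (s i) - I)) \<longlonglongrightarrow> 0)"

definition vector_measure_on ::
    "'m measure \<Rightarrow> 'v::real_vector set \<Rightarrow> ('v \<Rightarrow> real) \<Rightarrow> ('m set \<Rightarrow> 'v) \<Rightarrow> bool" where
  "vector_measure_on M V N G \<longleftrightarrow> (\<forall>A\<in>sets M. G A \<in> V) \<and>
     (\<forall>A :: nat \<Rightarrow> 'm set. range A \<subseteq> sets M \<longrightarrow> disjoint_family A \<longrightarrow>
        (\<lambda>n. N ((\<Sum>i<n. G (A i)) - G (\<Union>i. A i))) \<longlonglongrightarrow> 0)"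

definition bounded_variation_on ::
    "'m measure \<Rightarrow> ('v \<Rightarrow> real) \<Rightarrow> ('m set \<Rightarrow> 'v) \<Rightarrow> bool" where
  "bounded_variation_on M N G \<longleftrightarrow>
     (\<exists>C. \<forall>P. finite P \<and> P \<subseteq> sets M \<and> partition_on (space M) P \<longrightarrow> (\<Sum>A\<in>P. N (G A)) \<le> C)"

text \<open>
  The type argument fixes the type of the points of the underlying finite measure spaces; the
  Radon-Nikodym property proper is this statement for all types \<open>'m\<close>.
\<close>

definition radon_nikodym_property ::
    "'m itself \<Rightarrow> 'v::real_vector set \<Rightarrow> ('v \<Rightarrow> real) \<Rightarrow> bool" where
  "radon_nikodym_property TYPE('m) V N \<longleftrightarrow>
     (\<forall>(M :: 'm measure) G. finite_measure M \<longrightarrow> vector_measure_on M V N G \<longrightarrow>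
        bounded_variation_on M N G \<longrightarrow> (\<forall>A\<in>null_sets M. G A = 0) \<longrightarrow>
        (\<exists>g. \<forall>A\<in>sets M. has_bochner_integral_on M V N (\<lambda>\<omega>. indicator A \<omega> *\<^sub>R g \<omega>) (G A)))"

section \<open>Orlicz-Lorentz sequence spaces\<close>

text \<open>Only the values of \<open>\<phi>\<close> on \<open>{0..}\<close> matter.\<close>

definition orlicz_function :: "(real \<Rightarrow> real) \<Rightarrow> bool" where
  "orlicz_function \<phi> \<longleftrightarrow> convex_on {0..} \<phi> \<and> \<phi> 0 = 0 \<and> (\<forall>u>0. \<phi> u > 0)"

definition orlicz_N_function :: "(real \<Rightarrow> real) \<Rightarrow> bool" where
  "orlicz_N_function \<phi> \<longleftrightarrow> orlicz_function \<phi> \<and>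
     ((\<lambda>u. \<phi> u / u) \<longlongrightarrow> 0) (at_right 0) \<and> filterlim (\<lambda>u. \<phi> u / u) at_top at_top"

definition Delta2_0 :: "(real \<Rightarrow> real) \<Rightarrow> bool" where
  "Delta2_0 \<phi> \<longleftrightarrow> (\<exists>K>0. \<exists>u0>0. \<forall>u. 0 \<le> u \<and> u \<le> u0 \<longrightarrow> \<phi> (2 * u) \<le> K * \<phi> u)"

text \<open>Sequences are indexed from 0: \<open>x k\<close> stands for the term with number \<open>k + 1\<close>.\<close>

definition weight_sequence :: "(nat \<Rightarrow> real) \<Rightarrow> bool" where
  "weight_sequence w \<longleftrightarrow> decseq w \<and> (\<forall>k. w k > 0)"

definition W_infinity :: "(nat \<Rightarrow> real) \<Rightarrow> ennreal" where
  "W_infinity w = (\<Sum>k. ennreal (w k))"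

definition distr_fun :: "(nat \<Rightarrow> real) \<Rightarrow> real \<Rightarrow> ennreal" where
  "distr_fun x l = emeasure (count_space UNIV) {k. \<bar>x k\<bar> > l}"

definition rearrangement :: "(nat \<Rightarrow> real) \<Rightarrow> nat \<Rightarrow> ennreal" where
  "rearrangement x k = (INF l\<in>{l. 0 < l \<and> distr_fun x l < of_nat (Suc k)}. ennreal l)"

definition extend_infinity :: "(real \<Rightarrow> real) \<Rightarrow> ennreal \<Rightarrow> ennreal" where
  "extend_infinity \<phi> t = (if t = \<infinity> then \<infinity> else ennreal (\<phi> (enn2real t)))"

definition OL_modular :: "(real \<Rightarrow> real) \<Rightarrow> (nat \<Rightarrow> real) \<Rightarrow> (nat \<Rightarrow> real) \<Rightarrow> ennreal" where
  "OL_modular \<phi> w x = (\<Sum>k. extend_infinity \<phi> (rearrangement x k) * ennreal (w k))"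

definition OL_space :: "(real \<Rightarrow> real) \<Rightarrow> (nat \<Rightarrow> real) \<Rightarrow> (nat \<Rightarrow> real) set" where
  "OL_space \<phi> w = {x. \<exists>l>0. OL_modular \<phi> w (l *\<^sub>R x) < \<infinity>}"

definition OL_norm :: "(real \<Rightarrow> real) \<Rightarrow> (nat \<Rightarrow> real) \<Rightarrow> (nat \<Rightarrow> real) \<Rightarrow> real" where
  "OL_norm \<phi> w x = Inf {e. 0 < e \<and> OL_modular \<phi> w (inverse e *\<^sub>R x) \<le> 1}"

end

theory Submission
  imports Defs
begin

text \<open>
  The space is treated as a solid space of real sequences whose norm has the Fatou property; it is
  the dual of the closure of the finitely supported sequences in its Koethe dual, because the unit ball is
  compact in the product topology and so the bipolar theorem reduces to separation in finitely many
  coordinates. The condition \<open>\<Delta>\<^sub>2\<^sup>0\<close> makes the norm order continuous, which gives separability.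
  Then countably many finitely supported functionals are norming, and integrating the maximum of
  finitely many of them shows that the coordinatewise Radon-Nikodym derivatives of a vector measure
  form a Bochner integrable density. Finally, by Baire's theorem on the compact ball, one of
  countably many small norm balls covering it has interior in the product topology.
\<close>

section \<open>Sequence spaces with the Fatou property\<close>

text \<open>The decreasing rearrangement is not linear, and a single term of it depends on
  infinitely many coordinates. The modular is therefore replaced by \<open>OL_bound\<close>, a
  family of inequalities for finite sums over injective index maps. Each inequality is convex,
  monotone in the absolute values and concerned with finitely many coordinates, so the triangle
  inequality, solidity and the Fatou property can be checked term by term. That W is infinite forces
  members to tend to 0; the doubling condition, which speaks of small arguments, then misses only
  finitely many coordinates. On bounded sets coordinatewise convergence plays the role of weak*
  convergence. This is why duality is expressed by the partial sums
  \<open>\<Sum>k<n. x k * y k\<close>: they need no summability, are continuous in the product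
  topology, and are pairings with truncations, hence with elements of the predual. In the
  Radon-Nikodym part the obstacle is membership: scalar densities of the coordinates always exist,
  but that they form an element of the space at almost every point has to come from a bound on the
  norms of their truncations.\<close>

definition unit_seq :: "nat \<Rightarrow> nat \<Rightarrow> real" where
  "unit_seq k = (\<lambda>i. if i = k then 1 else 0)"

definition trunc :: "nat \<Rightarrow> (nat \<Rightarrow> real) \<Rightarrow> nat \<Rightarrow> real" where
  "trunc n x = (\<lambda>k. if k < n then x k else 0)"

lemma trunc_add: "trunc n (x + y) = trunc n x + trunc n y"
  by (auto simp: trunc_def fun_eq_iff)

lemma trunc_diff: "trunc n (x - y) = trunc n x - trunc n y"
  by (auto simp: trunc_def fun_eq_iff)

lemma trunc_scaleR: "trunc n (c *\<^sub>R x) = c *\<^sub>R trunc n x"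
  by (auto simp: trunc_def fun_eq_iff scaleR_fun_def)

lemma trunc_trunc: "trunc m (trunc n x) = trunc (min m n) x"
  by (auto simp: trunc_def)

lemma tendsto_trunc: "(\<lambda>n. trunc n x k) \<longlonglongrightarrow> x k"
  by (rule tendsto_eventually)
     (auto simp: trunc_def eventually_sequentially intro!: exI[of _ "Suc k"])

lemma trunc_eq_sum: "trunc n x = (\<Sum>k<n. x k *\<^sub>R unit_seq k)"
proof (induction n)
  case 0
  then show ?case by (simp add: trunc_def zero_fun_def)
next
  case (Suc n)
  have "trunc (Suc n) x = trunc n x + x n *\<^sub>R unit_seq n"
    by (auto simp: trunc_def unit_seq_def scaleR_fun_def fun_eq_iff less_Suc_eq)
  then show ?case using Suc by simp
qed

lemma banach_space_onI:
  assumes "normed_space_on V N"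
    and "\<And>s. \<lbrakk>\<And>n. s n \<in> V; \<And>e. 0 < e \<Longrightarrow> \<exists>M. \<forall>n\<ge>M. \<forall>m\<ge>M. N (s n - s m) < e\<rbrakk>
      \<Longrightarrow> \<exists>x\<in>V. (\<lambda>n. N (s n - x)) \<longlonglongrightarrow> 0"
  shows "banach_space_on V N"
proof -
  interpret Metric_space V "norm_dist V N"
    by (rule Metric_space_norm_dist[OF assms(1)])
  have "\<exists>x. limitin mtopology s x sequentially" if "MCauchy s" for s
  proof -
    have s: "s n \<in> V" for n using that by (auto simp: MCauchy_def)
    have "\<exists>M. \<forall>n\<ge>M. \<forall>m\<ge>M. N (s n - s m) < e" if "0 < e" for e
      using \<open>MCauchy s\<close> that s unfolding MCauchy_def norm_dist_def by (fastforce)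
    then obtain x where x: "x \<in> V" "(\<lambda>n. N (s n - x)) \<longlonglongrightarrow> 0"
      using assms(2)[of s] s by blast
    have "limitin mtopology s x sequentially"
      unfolding limitin_metric_dist_null using x s by (simp add: norm_dist_def)
    then show ?thesis ..
  qed
  then show ?thesis
    using assms(1) by (simp add: banach_space_on_def mcomplete_def)
qed

text \<open>The axiom \<open>fatou\<close> serves for completeness, for closedness of balls in the
  product topology and, through truncations, as a test for membership in \<open>V\<close>. For the
  last use the limit must not be assumed to lie in \<open>V\<close> beforehand.\<close>

locale fatou_space =
  fixes V :: "(nat \<Rightarrow> real) set" and N :: "(nat \<Rightarrow> real) \<Rightarrow> real"
  assumes normed: "normed_space_on V N"
    and unit_seq_mem: "unit_seq k \<in> V"
    and solid: "\<lbrakk>x \<in> V; \<And>k. \<bar>y k\<bar> \<le> \<bar>x k\<bar>\<rbrakk> \<Longrightarrow> y \<in> V \<and> N y \<le> N x"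
    and fatou: "\<lbrakk>\<And>n. X n \<in> V; \<And>n. N (X n) \<le> C; \<And>k. (\<lambda>n. X n k) \<longlonglongrightarrow> x k\<rbrakk> \<Longrightarrow> x \<in> V \<and> N x \<le> C"
begin

lemma subspace: "subspace V"
  using normed by (simp add: normed_space_on_def)

lemma zero_mem: "0 \<in> V"
  using subspace by (rule subspace_0)

lemma add_mem: "x \<in> V \<Longrightarrow> y \<in> V \<Longrightarrow> x + y \<in> V"
  using subspace by (rule subspace_add)

lemma diff_mem: "x \<in> V \<Longrightarrow> y \<in> V \<Longrightarrow> x - y \<in> V"
  using subspace by (rule subspace_diff)

lemma scale_mem: "x \<in> V \<Longrightarrow> c *\<^sub>R x \<in> V"
  using subspace by (rule subspace_scale)

lemma norm_nonneg: "x \<in> V \<Longrightarrow> 0 \<le> N x"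
  using normed by (simp add: normed_space_on_def)

lemma norm_eq_0: "x \<in> V \<Longrightarrow> N x = 0 \<longleftrightarrow> x = 0"
  using normed by (simp add: normed_space_on_def)

lemma norm_scale: "x \<in> V \<Longrightarrow> N (c *\<^sub>R x) = \<bar>c\<bar> * N x"
  using normed by (simp add: normed_space_on_def)

lemma norm_add: "x \<in> V \<Longrightarrow> y \<in> V \<Longrightarrow> N (x + y) \<le> N x + N y"
  using normed by (simp add: normed_space_on_def)

lemma norm_zero: "N 0 = 0"
  using norm_eq_0[OF zero_mem] by simp

lemma norm_minus_commute: "x \<in> V \<Longrightarrow> y \<in> V \<Longrightarrow> N (x - y) = N (y - x)"
  using norm_scale[OF diff_mem[of y x], of "- 1"] by simp

lemma norm_diff_triangle:
  assumes "x \<in> V" "y \<in> V" "z \<in> V"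
  shows "N (x - z) \<le> N (x - y) + N (y - z)"
  using norm_add[OF diff_mem[of x y] diff_mem[of y z]] assms by simp

lemma norm_sum:
  assumes "finite I" "\<And>i. i \<in> I \<Longrightarrow> x i \<in> V"
  shows "(\<Sum>i\<in>I. x i) \<in> V \<and> N (\<Sum>i\<in>I. x i) \<le> (\<Sum>i\<in>I. N (x i))"
  using assms
proof (induction I)
  case empty
  then show ?case by (simp only: sum.empty zero_mem norm_zero order_refl simp_thms)
next
  case (insert i I)
  then have IH: "(\<Sum>i\<in>I. x i) \<in> V" "N (\<Sum>i\<in>I. x i) \<le> (\<Sum>i\<in>I. N (x i))" and i: "x i \<in> V"
    by blast+
  show ?case
    unfolding sum.insert[OF insert.hyps]
    using norm_add[OF i IH(1)] IH(2) add_mem[OF i IH(1)] by linarith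
qed

lemma norm_unit_pos: "0 < N (unit_seq k)"
proof -
  have "unit_seq k \<noteq> 0" by (auto simp: unit_seq_def fun_eq_iff)
  then show ?thesis
    using norm_nonneg[OF unit_seq_mem, of k] norm_eq_0[OF unit_seq_mem, of k] by linarith
qed

lemma coordinate_le: "x \<in> V \<Longrightarrow> \<bar>x k\<bar> * N (unit_seq k) \<le> N x"
  using solid[of x "x k *\<^sub>R unit_seq k"] norm_scale[OF unit_seq_mem, of "x k" k]
  by (auto simp: scaleR_fun_def unit_seq_def)

lemma trunc_mem: "trunc n x \<in> V"
  unfolding trunc_eq_sum using norm_sum[of "{..<n}" "\<lambda>k. x k *\<^sub>R unit_seq k"]
  by (simp add: scale_mem unit_seq_mem)

lemma norm_trunc_le: "x \<in> V \<Longrightarrow> N (trunc n x) \<le> N x"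
  using solid[of x "trunc n x"] by (auto simp: trunc_def)

lemma norm_trunc_mono: "m \<le> n \<Longrightarrow> N (trunc m x) \<le> N (trunc n x)"
  using norm_trunc_le[OF trunc_mem[of n x], of m] by (simp add: trunc_trunc min_absorb1)

lemma norm_tail_le: "x \<in> V \<Longrightarrow> N (x - trunc n x) \<le> N x"
  using solid[of x "x - trunc n x"] by (auto simp: trunc_def)

lemma norm_trunc_sum_le: "N (trunc n x) \<le> (\<Sum>k<n. \<bar>x k\<bar> * N (unit_seq k))"
  unfolding trunc_eq_sum using norm_sum[of "{..<n}" "\<lambda>k. x k *\<^sub>R unit_seq k"]
  by (simp add: scale_mem unit_seq_mem norm_scale)

lemma trunc_bounded:
  assumes "\<And>n. N (trunc n x) \<le> C"
  shows "x \<in> V \<and> N x \<le> C"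
  by (rule fatou[of "\<lambda>n. trunc n x"]) (use assms trunc_mem tendsto_trunc in auto)

lemma tendsto_coordinate:
  assumes "\<And>n. s n \<in> V" "x \<in> V" "(\<lambda>n. N (s n - x)) \<longlonglongrightarrow> 0"
  shows "(\<lambda>n. s n k) \<longlonglongrightarrow> x k"
proof (rule LIM_zero_cancel, rule Lim_null_comparison)
  show "\<forall>\<^sub>F n in sequentially. norm (s n k - x k) \<le> N (s n - x) / N (unit_seq k)"
    using coordinate_le[OF diff_mem[OF assms(1,2)], of _ k] norm_unit_pos[of k]
    by (intro always_eventually allI) (simp add: field_simps)
  show "(\<lambda>n. N (s n - x) / N (unit_seq k)) \<longlonglongrightarrow> 0"
    using tendsto_divide[OF assms(3) tendsto_const, of "N (unit_seq k)"] norm_unit_pos[of k] by simp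
qed

text \<open>The coordinates are Cauchy by \<open>coordinate_le\<close>, which yields a candidate for
  the limit. Fatou then carries the estimate of \<open>s n - s m\<close> over to the limit in
  \<open>m\<close>.\<close>

lemma Cauchy_limit:
  assumes s: "\<And>n. s n \<in> V"
    and C: "\<And>e. 0 < e \<Longrightarrow> \<exists>M. \<forall>n\<ge>M. \<forall>m\<ge>M. N (s n - s m) < e"
  shows "\<exists>x\<in>V. (\<lambda>n. N (s n - x)) \<longlonglongrightarrow> 0"
proof -
  have "Cauchy (\<lambda>n. s n k)" for k
  proof (rule metric_CauchyI)
    fix e :: real assume "0 < e"
    with C[of "e * N (unit_seq k)"] norm_unit_pos[of k] obtain M
      where M: "\<And>n m. M \<le> n \<Longrightarrow> M \<le> m \<Longrightarrow> N (s n - s m) < e * N (unit_seq k)" by auto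
    have "dist (s n k) (s m k) < e" if "M \<le> n" "M \<le> m" for n m
    proof -
      have "\<bar>s n k - s m k\<bar> * N (unit_seq k) < e * N (unit_seq k)"
        using coordinate_le[OF diff_mem[OF s s], of n m k] M[OF that] by simp
      then show ?thesis using norm_unit_pos[of k] by (simp add: dist_real_def)
    qed
    then show "\<exists>M. \<forall>m\<ge>M. \<forall>n\<ge>M. dist (s m k) (s n k) < e" by blast
  qed
  then obtain x where x: "\<And>k. (\<lambda>n. s n k) \<longlonglongrightarrow> x k"
    unfolding Cauchy_convergent_iff convergent_def by metis
  have tail: "\<exists>M. \<forall>n\<ge>M. s n - x \<in> V \<and> N (s n - x) \<le> e" if e: "0 < e" for e
  proof -
    obtain M where M: "\<And>n m. M \<le> n \<Longrightarrow> M \<le> m \<Longrightarrow> N (s n - s m) < e"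
      using C[OF e] by blast
    \<comment> \<open>The shift by \<open>M\<close> makes the Cauchy bound hold for every member of
      the sequence, as \<open>fatou\<close> demands.\<close>
    have "s n - x \<in> V \<and> N (s n - x) \<le> e" if "M \<le> n" for n
    proof (rule fatou[of "\<lambda>m. s n - s (m + M)"])
      show "N (s n - s (m + M)) \<le> e" for m using M[of n "m + M"] that by simp
      show "(\<lambda>m. (s n - s (m + M)) k) \<longlonglongrightarrow> (s n - x) k" for k
        using tendsto_diff[OF tendsto_const LIMSEQ_ignore_initial_segment[OF x[of k], of M]] by simp
    qed (simp add: s diff_mem)
    then show ?thesis by blast
  qed
  then obtain n where "s n - x \<in> V" using zero_less_one by blast
  then have "x \<in> V" using diff_mem[OF s[of n], of "s n - x"] by simp
  moreover have "(\<lambda>n. N (s n - x)) \<longlonglongrightarrow> 0"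
  proof (rule LIMSEQ_I)
    fix e :: real assume "0 < e"
    then obtain M where "\<And>n. M \<le> n \<Longrightarrow> N (s n - x) \<le> e / 2" using tail[of "e/2"] by auto
    then show "\<exists>M. \<forall>n\<ge>M. norm (N (s n - x) - 0) < e"
      using \<open>0 < e\<close> norm_nonneg[OF diff_mem[OF s \<open>x \<in> V\<close>]]
      by (intro exI[of _ M]) (force intro: le_less_trans)
  qed
  ultimately show ?thesis by blast
qed

text \<open>The order continuous part of the space, that is, the norm closure of the finitely
  supported sequences. Taken in the Koethe dual it will be the predual.\<close>

definition regular_part :: "(nat \<Rightarrow> real) set" where
  "regular_part = {x\<in>V. (\<lambda>n. N (x - trunc n x)) \<longlonglongrightarrow> 0}"

lemma regular_part_subset: "regular_part \<subseteq> V"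
  by (auto simp: regular_part_def)

lemma trunc_mem_regular_part: "trunc n x \<in> regular_part"
  unfolding regular_part_def
  by (auto simp: trunc_mem trunc_trunc min_absorb2 norm_zero
      intro!: tendsto_eventually eventually_sequentiallyI[of n])

lemma regular_part_closed:
  assumes s: "\<And>j. s j \<in> regular_part" and x: "x \<in> V" and lim: "(\<lambda>j. N (s j - x)) \<longlonglongrightarrow> 0"
  shows "x \<in> regular_part"
proof -
  have sV: "s j \<in> V" for j using s by (auto simp: regular_part_def)
  have "(\<lambda>n. N (x - trunc n x)) \<longlonglongrightarrow> 0"
  proof (rule LIMSEQ_I)
    fix e :: real assume "0 < e"
    then obtain j where j: "N (s j - x) < e / 2"
      using order_tendstoD(2)[OF lim, of "e/2"] by (auto simp: eventually_sequentially)
    obtain M where M: "\<And>n. M \<le> n \<Longrightarrow> N (s j - trunc n (s j)) < e / 2"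
      using order_tendstoD(2)[of _ 0 sequentially "e/2"] s[of j] \<open>0 < e\<close>
      unfolding regular_part_def by (auto simp: eventually_sequentially)
    have "norm (N (x - trunc n x) - 0) < e" if "M \<le> n" for n
    proof -
      \<comment> \<open>Cutting off the first \<open>n\<close> coordinates does not increase the
        norm, so the tail of \<open>x - s j\<close> costs at most \<open>N (x - s j)\<close>,
        uniformly in \<open>n\<close>.\<close>
      have "x - trunc n x = (x - s j) - trunc n (x - s j) + (s j - trunc n (s j))"
        unfolding trunc_diff by simp
      then have "N (x - trunc n x) \<le> N ((x - s j) - trunc n (x - s j)) + N (s j - trunc n (s j))"
        using norm_add[of "(x - s j) - trunc n (x - s j)" "s j - trunc n (s j)"]
        by (metis diff_mem trunc_mem x sV)
      also have "\<dots> < e / 2 + e / 2"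
        using norm_tail_le[OF diff_mem[OF x sV], of j n] j M[OF that]
          norm_minus_commute[OF x sV, of j] by linarith
      finally show ?thesis using norm_nonneg[OF diff_mem[OF x trunc_mem]] by simp
    qed
    then show "\<exists>M. \<forall>n\<ge>M. norm (N (x - trunc n x) - 0) < e" by blast
  qed
  then show ?thesis using x by (simp add: regular_part_def)
qed

lemma subspace_regular_part: "Real_Vector_Spaces.subspace regular_part"
proof (rule subspaceI)
  show "0 \<in> regular_part" using trunc_mem_regular_part[of 0 0] by (simp add: trunc_def zero_fun_def)
next
  fix x y assume xy: "x \<in> regular_part" "y \<in> regular_part"
  then have V: "x \<in> V" "y \<in> V" by (auto simp: regular_part_def)
  have "(\<lambda>n. N ((x + y) - trunc n (x + y))) \<longlonglongrightarrow> 0"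
  proof (rule Lim_null_comparison)
    show "(\<lambda>n. N (x - trunc n x) + N (y - trunc n y)) \<longlonglongrightarrow> 0"
      using xy tendsto_add[of _ 0 sequentially _ 0] by (fastforce simp: regular_part_def)
    have "(x + y) - trunc n (x + y) = (x - trunc n x) + (y - trunc n y)" for n
      by (simp add: trunc_add)
    then have "N ((x + y) - trunc n (x + y)) \<le> N (x - trunc n x) + N (y - trunc n y)" for n
      using norm_add V diff_mem trunc_mem by metis
    then show "\<forall>\<^sub>F n in sequentially. norm (N ((x + y) - trunc n (x + y)))
        \<le> N (x - trunc n x) + N (y - trunc n y)"
      using norm_nonneg[OF diff_mem[OF add_mem[OF V] trunc_mem]] by simp
  qed
  then show "x + y \<in> regular_part" using V by (simp add: regular_part_def add_mem)
next
  fix c x assume "x \<in> regular_part"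
  then have "x \<in> V" "(\<lambda>n. \<bar>c\<bar> * N (x - trunc n x)) \<longlonglongrightarrow> \<bar>c\<bar> * 0"
    using tendsto_mult_left[of "\<lambda>n. N (x - trunc n x)" 0] by (auto simp: regular_part_def)
  then show "c *\<^sub>R x \<in> regular_part"
    by (simp add: regular_part_def scale_mem trunc_scaleR norm_scale diff_mem trunc_mem
        flip: scaleR_diff_right)
qed

lemma normed_regular_part: "normed_space_on regular_part N"
  using normed subspace_regular_part regular_part_subset
  unfolding normed_space_on_def by (simp add: subset_iff)

lemma banach_regular_part: "banach_space_on regular_part N"
proof (rule banach_space_onI[OF normed_regular_part])
  fix s :: "nat \<Rightarrow> nat \<Rightarrow> real"
  assume s: "\<And>n. s n \<in> regular_part"
    and C: "\<And>e. 0 < e \<Longrightarrow> \<exists>M. \<forall>n\<ge>M. \<forall>m\<ge>M. N (s n - s m) < e"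
  then obtain x where "x \<in> V" "(\<lambda>n. N (s n - x)) \<longlonglongrightarrow> 0"
    using Cauchy_limit[of s] regular_part_subset by blast
  then show "\<exists>x\<in>regular_part. (\<lambda>n. N (s n - x)) \<longlonglongrightarrow> 0"
    using regular_part_closed[of s] s by blast
qed

lemma countable_dense:
  obtains D where "countable D" "D \<subseteq> regular_part"
    "\<And>x e. x \<in> regular_part \<Longrightarrow> 0 < e \<Longrightarrow> \<exists>y\<in>D. N (x - y) < e"
proof
  \<comment> \<open>A list of rationals stands for a finitely supported rational sequence, and there
    are countably many such lists.\<close>
  define D where "D = range (\<lambda>q. trunc (length q) (\<lambda>k. real_of_rat (q ! k)))"
  show "countable D" unfolding D_def by (rule countable_image) simp
  show "D \<subseteq> regular_part" by (auto simp: D_def trunc_mem_regular_part)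
  fix x e assume x: "x \<in> regular_part" and e: "(0::real) < e"
  then have xV: "x \<in> V" by (auto simp: regular_part_def)
  obtain n where n: "N (x - trunc n x) < e / 2"
    using order_tendstoD(2)[of "\<lambda>n. N (x - trunc n x)" 0 sequentially "e/2"] x e
    by (auto simp: regular_part_def eventually_sequentially)
  \<comment> \<open>The factor \<open>N (unit_seq k)\<close> cancels against the one in
    \<open>norm_trunc_sum_le\<close>; \<open>Suc n\<close> keeps the quotient meaningful for
    \<open>n = 0\<close>.\<close>
  have pos: "0 < e / 2 / (real (Suc n) * N (unit_seq k))" for k
    using e norm_unit_pos[of k] by simp
  have "\<exists>q. \<bar>x k - real_of_rat q\<bar> < e / 2 / (real (Suc n) * N (unit_seq k))" for k
  proof -
    obtain q where "x k - e / 2 / (real (Suc n) * N (unit_seq k)) < real_of_rat q" "real_of_rat q < x k"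
      using of_rat_dense[of "x k - e / 2 / (real (Suc n) * N (unit_seq k))" "x k"] pos[of k]
      by auto
    then show ?thesis by (intro exI[of _ q]) linarith
  qed
  then obtain q where q: "\<And>k. \<bar>x k - real_of_rat (q k)\<bar> < e / 2 / (real (Suc n) * N (unit_seq k))"
    by metis
  define y where "y = trunc n (\<lambda>k. real_of_rat (q k))"
  have "y = trunc (length (map q [0..<n])) (\<lambda>k. real_of_rat (map q [0..<n] ! k))"
    by (auto simp: y_def trunc_def)
  then have "y \<in> D" unfolding D_def by blast
  moreover have "N (x - y) < e"
  proof -
    have "N (trunc n x - y) = N (trunc n (\<lambda>k. x k - real_of_rat (q k)))"
      unfolding y_def trunc_diff[symmetric] by (simp add: fun_diff_def)
    also have "\<dots> \<le> (\<Sum>k<n. \<bar>x k - real_of_rat (q k)\<bar> * N (unit_seq k))"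
      by (rule norm_trunc_sum_le)
    also have "\<dots> \<le> (\<Sum>k<n. e / 2 / real (Suc n))"
    proof (rule sum_mono)
      fix k
      show "\<bar>x k - real_of_rat (q k)\<bar> * N (unit_seq k) \<le> e / 2 / real (Suc n)"
        using mult_right_mono[OF less_imp_le[OF q[of k]] less_imp_le[OF norm_unit_pos[of k]]]
          norm_unit_pos[of k] by simp
    qed
    also have "\<dots> \<le> e / 2" using e by (simp add: field_simps)
    finally show ?thesis
      using norm_diff_triangle[OF xV trunc_mem[of n x] trunc_mem[of n "\<lambda>k. real_of_rat (q k)"]] n
      unfolding y_def by linarith
  qed
  ultimately show "\<exists>y\<in>D. N (x - y) < e" by blast
qed

end

section \<open>The Koethe dual and the predual\<close>

context fatou_space
begin

lemma banach: "banach_space_on V N"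
  by (rule banach_space_onI[OF normed]) (rule Cauchy_limit)

lemma sum_trunc_commute: "(\<Sum>k<m. trunc n x k * y k) = (\<Sum>k<n. trunc m x k * y k)"
proof -
  have "(\<Sum>k<m. trunc n x k * y k) = (\<Sum>k\<in>{..<m} \<inter> {..<n}. x k * y k)" for m n
    by (rule sum.mono_neutral_cong_right) (auto simp: trunc_def)
  then show ?thesis by (metis inf_commute)
qed

text \<open>One-sided bounds on partial sums suffice: by solidity the ball admits changes of sign,
  so they already bound the sums of \<open>\<bar>x k * y k\<bar>\<close>, see
  \<open>kothe_upper_abs\<close>.\<close>

definition kothe_dual :: "(nat \<Rightarrow> real) set" where
  "kothe_dual = {y. \<exists>C. \<forall>n. \<forall>x\<in>unit_ball V N. (\<Sum>k<n. x k * y k) \<le> C}"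

definition kothe_norm :: "(nat \<Rightarrow> real) \<Rightarrow> real" where
  "kothe_norm y = (SUP (n, x)\<in>UNIV \<times> unit_ball V N. \<Sum>k<n. x k * y k)"

lemma zero_in_ball: "0 \<in> unit_ball V N"
  by (simp add: unit_ball_def zero_mem norm_zero)

lemma kothe_least:
  assumes "\<And>n x. x \<in> V \<Longrightarrow> N x \<le> 1 \<Longrightarrow> (\<Sum>k<n. x k * y k) \<le> C"
  shows "y \<in> kothe_dual" "kothe_norm y \<le> C"
proof -
  show "y \<in> kothe_dual" using assms by (auto simp: kothe_dual_def unit_ball_def)
  show "kothe_norm y \<le> C" unfolding kothe_norm_def
    by (rule cSUP_least) (use zero_in_ball assms in \<open>auto simp: unit_ball_def\<close>)
qed

lemma kothe_upper_ball:
  assumes "y \<in> kothe_dual" "x \<in> V" "N x \<le> 1"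
  shows "(\<Sum>k<n. x k * y k) \<le> kothe_norm y"
proof -
  have "bdd_above ((\<lambda>(n, x). \<Sum>k<n. x k * y k) ` (UNIV \<times> unit_ball V N))"
    using assms(1) by (force simp: kothe_dual_def bdd_above_def)
  then show ?thesis unfolding kothe_norm_def
    by (rule cSUP_upper2[where x="(n, x)"]) (use assms in \<open>auto simp: unit_ball_def\<close>)
qed

lemma kothe_norm_nonneg: "y \<in> kothe_dual \<Longrightarrow> 0 \<le> kothe_norm y"
  using kothe_upper_ball[of y 0 0] zero_mem norm_zero by simp

lemma kothe_upper_abs:
  assumes y: "y \<in> kothe_dual" and x: "x \<in> V"
  shows "(\<Sum>k<n. \<bar>x k * y k\<bar>) \<le> N x * kothe_norm y"
proof (cases "N x = 0")
  case True
  then have "x = 0" using norm_eq_0 x by simp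
  then show ?thesis by (simp add: norm_zero[unfolded zero_fun_def] zero_fun_def)
next
  case False
  then have pos: "0 < N x" using norm_nonneg[OF x] by simp
  \<comment> \<open>Solidity permits giving \<open>\<bar>x k\<bar>\<close> the sign of
    \<open>y k\<close>, which turns every term of the pairing into its absolute value; division by
    \<open>N x\<close> brings the sequence into the ball.\<close>
  define u where "u = (\<lambda>k. sgn (y k) * \<bar>x k\<bar> / N x)"
  have "u \<in> V \<and> N u \<le> N (inverse (N x) *\<^sub>R x)"
    using pos by (intro solid scale_mem x)
      (auto simp: u_def scaleR_fun_def abs_mult abs_sgn_eq divide_inverse)
  also have "N (inverse (N x) *\<^sub>R x) = 1" using norm_scale[OF x] pos by simp
  finally have "(\<Sum>k<n. u k * y k) \<le> kothe_norm y" using kothe_upper_ball y by blast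
  moreover have "(\<Sum>k<n. u k * y k) = (\<Sum>k<n. \<bar>x k * y k\<bar>) / N x"
    unfolding sum_divide_distrib
    by (intro sum.cong refl) (simp add: u_def abs_mult sgn_if)
  ultimately show ?thesis using pos by (simp add: field_simps)
qed

lemma kothe_upper:
  assumes "y \<in> kothe_dual" "x \<in> V"
  shows "\<bar>\<Sum>k<n. x k * y k\<bar> \<le> N x * kothe_norm y"
  using sum_abs[of "\<lambda>k. x k * y k" "{..<n}"] kothe_upper_abs[OF assms, of n] by linarith

text \<open>\<open>kothe_norm\<close> is a supremum of functionals of finitely many coordinates,
  hence lower semicontinuous under coordinatewise limits. The gain is reuse: truncation, regular
  part and completeness become available in the dual.\<close>

lemma fatou_space_kothe: "fatou_space kothe_dual kothe_norm"
proof
  \<comment> \<open>The factor \<open>c\<close> lets one estimate serve both solidity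
    (\<open>c = 1\<close>) and scaling.\<close>
  have mono: "z \<in> kothe_dual \<and> kothe_norm z \<le> c * kothe_norm y"
    if y: "y \<in> kothe_dual" and z: "\<And>k. \<bar>z k\<bar> \<le> c * \<bar>y k\<bar>" and c: "0 \<le> c" for y z c
  proof -
    have "(\<Sum>k<n. x k * z k) \<le> c * kothe_norm y" if x: "x \<in> V" "N x \<le> 1" for n x
    proof -
      have "(\<Sum>k<n. x k * z k) \<le> (\<Sum>k<n. c * \<bar>x k * y k\<bar>)"
      proof (rule sum_mono)
        fix k
        have "x k * z k \<le> \<bar>x k\<bar> * \<bar>z k\<bar>" by (metis abs_ge_self abs_mult)
        also have "\<dots> \<le> \<bar>x k\<bar> * (c * \<bar>y k\<bar>)" by (intro mult_left_mono z) simp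
        finally show "x k * z k \<le> c * \<bar>x k * y k\<bar>" by (simp add: abs_mult mult_ac)
      qed
      also have "\<dots> \<le> c * (N x * kothe_norm y)"
        unfolding sum_distrib_left[symmetric] by (intro mult_left_mono kothe_upper_abs y x c)
      also have "\<dots> \<le> c * (1 * kothe_norm y)"
        by (intro mult_left_mono mult_right_mono x c kothe_norm_nonneg y)
      finally show ?thesis by simp
    qed
    then show ?thesis using kothe_least[of z] by blast
  qed
  have add: "y + z \<in> kothe_dual \<and> kothe_norm (y + z) \<le> kothe_norm y + kothe_norm z"
    if y: "y \<in> kothe_dual" and z: "z \<in> kothe_dual" for y z
  proof -
    have "(\<Sum>k<n. x k * (y + z) k) \<le> kothe_norm y + kothe_norm z" if "x \<in> V" "N x \<le> 1" for n x
      using kothe_upper_ball[OF y that, of n] kothe_upper_ball[OF z that, of n]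
      by (simp add: distrib_left sum.distrib)
    then show ?thesis using kothe_least[of "y + z"] by blast
  qed
  have scale: "c *\<^sub>R y \<in> kothe_dual \<and> kothe_norm (c *\<^sub>R y) \<le> \<bar>c\<bar> * kothe_norm y"
    if "y \<in> kothe_dual" for c y
    using that by (intro mono) (auto simp: scaleR_fun_def abs_mult)
  have zero: "0 \<in> kothe_dual" "kothe_norm 0 \<le> 0"
    using kothe_least[of 0 0] by auto
  have eq0: "y = 0" if y: "y \<in> kothe_dual" and "kothe_norm y = 0" for y
  proof
    fix k
    have "(\<Sum>j<Suc k. \<bar>unit_seq k j * y j\<bar>) \<le> 0"
      using kothe_upper_abs[OF y unit_seq_mem, of k "Suc k"] that by simp
    moreover have "\<bar>unit_seq k k * y k\<bar> \<le> (\<Sum>j<Suc k. \<bar>unit_seq k j * y j\<bar>)"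
      by (rule member_le_sum) auto
    ultimately show "y k = 0 k" by (simp add: unit_seq_def)
  qed
  show "normed_space_on kothe_dual kothe_norm"
    unfolding normed_space_on_def
  proof (intro conjI ballI allI)
    show "Real_Vector_Spaces.subspace kothe_dual"
      using zero add scale by (intro subspaceI) auto
    show "0 \<le> kothe_norm y" if "y \<in> kothe_dual" for y using that by (rule kothe_norm_nonneg)
    show "kothe_norm y = 0 \<longleftrightarrow> y = 0" if "y \<in> kothe_dual" for y
      using eq0[OF that] zero kothe_norm_nonneg[OF zero(1)] by force
    show "kothe_norm (y + z) \<le> kothe_norm y + kothe_norm z"
      if "y \<in> kothe_dual" "z \<in> kothe_dual" for y z using add that by blast
    show "kothe_norm (c *\<^sub>R y) = \<bar>c\<bar> * kothe_norm y" if y: "y \<in> kothe_dual" for c y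
    proof (cases "c = 0")
      case True
      then have "c *\<^sub>R y = 0" by (simp only: scaleR_zero_left)
      moreover have "kothe_norm 0 = 0" by (rule antisym[OF zero(2) kothe_norm_nonneg[OF zero(1)]])
      ultimately show ?thesis using True by simp
    next
      case False
      have "inverse c *\<^sub>R (c *\<^sub>R y) = y" using False by simp
      then have "kothe_norm y \<le> \<bar>inverse c\<bar> * kothe_norm (c *\<^sub>R y)"
        using scale[of "c *\<^sub>R y" "inverse c"] scale[OF y, of c] by metis
      then have "\<bar>c\<bar> * kothe_norm y \<le> kothe_norm (c *\<^sub>R y)"
        using False by (simp add: field_simps abs_inverse)
      then show ?thesis using scale[OF y, of c] by simp
    qed
  qed
  show "unit_seq k \<in> kothe_dual" for k
  proof (rule kothe_least(1))
    fix n x assume x: "x \<in> V" "N x \<le> 1"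
    have "(\<Sum>j<n. x j * unit_seq k j) \<le> \<bar>x k\<bar>"
      by (simp add: unit_seq_def if_distrib abs_ge_self cong: if_cong)
    also have "\<dots> \<le> 1 / N (unit_seq k)"
      using coordinate_le[OF x(1), of k] x(2) norm_unit_pos[of k] by (simp add: field_simps)
    finally show "(\<Sum>j<n. x j * unit_seq k j) \<le> 1 / N (unit_seq k)" .
  qed
  show "z \<in> kothe_dual \<and> kothe_norm z \<le> kothe_norm y"
    if "y \<in> kothe_dual" "\<And>k. \<bar>z k\<bar> \<le> \<bar>y k\<bar>" for y z
    using mono[of y z 1] that by simp
  show "y \<in> kothe_dual \<and> kothe_norm y \<le> C"
    if Y: "\<And>n. Y n \<in> kothe_dual" "\<And>n. kothe_norm (Y n) \<le> C"
      and lim: "\<And>k. (\<lambda>n. Y n k) \<longlonglongrightarrow> y k" for Y y C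
  proof -
    have "(\<Sum>k<n. x k * y k) \<le> C" if "x \<in> V" "N x \<le> 1" for n x
    proof (rule LIMSEQ_le_const2)
      show "(\<lambda>m. \<Sum>k<n. x k * Y m k) \<longlonglongrightarrow> (\<Sum>k<n. x k * y k)"
        by (intro tendsto_intros lim)
      show "\<exists>M. \<forall>m\<ge>M. (\<Sum>k<n. x k * Y m k) \<le> C"
        using kothe_upper_ball[OF Y(1) that] Y(2) order_trans by blast
    qed
    then show ?thesis using kothe_least[of y] by blast
  qed
qed

section \<open>Compactness of balls and the bipolar theorem\<close>

interpretation dual: fatou_space kothe_dual kothe_norm
  by (rule fatou_space_kothe)

text \<open>\<open>closed\<close> refers to the product topology of
  \<open>nat \<Rightarrow> real\<close>, where sequences decide closedness because the index set is
  countable; \<open>fatou\<close> supplies the sequential statement.\<close>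

lemma closed_cball:
  assumes d: "d \<in> V"
  shows "closed {x\<in>V. N (x - d) \<le> c}"
  unfolding closed_sequential_limits
proof (intro allI impI)
  fix X x assume X: "(\<forall>n. X n \<in> {x\<in>V. N (x - d) \<le> c}) \<and> X \<longlonglongrightarrow> x"
  have "(\<lambda>n. X n k) \<longlonglongrightarrow> x k" for k
    using X continuous_on_product_coordinates[of k, where ?'b=real]
    by (intro continuous_on_tendsto_compose[of UNIV "\<lambda>x. x k" X x sequentially]) auto
  then have "(\<lambda>n. (X n - d) k) \<longlonglongrightarrow> (x - d) k" for k
    by (auto intro: tendsto_diff)
  then have "x - d \<in> V" "N (x - d) \<le> c"
    using fatou[of "\<lambda>n. X n - d" c "x - d"] X d by (auto simp: diff_mem)
  then show "x \<in> {x\<in>V. N (x - d) \<le> c}" using add_mem[OF _ d, of "x - d"] by simp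
qed

text \<open>Banach-Alaoglu in coordinates: \<open>coordinate_le\<close> puts the ball inside a
  product of compact intervals, and the ball is closed.\<close>

lemma compact_ball: "compact {x\<in>V. N x \<le> c}"
proof -
  have "closed {x\<in>V. N x \<le> c}" using closed_cball[OF zero_mem] by simp
  moreover have "compact (PiE UNIV (\<lambda>k. {- (c / N (unit_seq k)) .. c / N (unit_seq k)}))"
    using compactin_PiE[of "\<lambda>_::nat. euclideanreal" UNIV
        "\<lambda>k. {- (c / N (unit_seq k)) .. c / N (unit_seq k)}"]
    by (simp add: euclidean_product_topology)
  moreover have sub: "{x\<in>V. N x \<le> c} \<subseteq> PiE UNIV (\<lambda>k. {- (c / N (unit_seq k)) .. c / N (unit_seq k)})"
  proof
    fix x assume x: "x \<in> {x\<in>V. N x \<le> c}"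
    have "\<bar>x k\<bar> \<le> c / N (unit_seq k)" for k
      using coordinate_le[of x k] norm_unit_pos[of k] x by (simp add: field_simps)
    then show "x \<in> PiE UNIV (\<lambda>k. {- (c / N (unit_seq k)) .. c / N (unit_seq k)})"
      by (auto simp: abs_le_iff minus_le_iff)
  qed
  ultimately show ?thesis
    using compact_Int_closed[of "PiE UNIV (\<lambda>k. {- (c / N (unit_seq k)) .. c / N (unit_seq k)})"
        "{x\<in>V. N x \<le> c}"]
    by (simp only: Int_absorb1[OF sub])
qed

text \<open>
  The functional that separates the first \<open>n\<close> coordinates of \<open>x\<close> from the ball points to \<open>x\<close> from the
  nearest point of the ball, which exists because the ball is compact in the product topology.
\<close>

lemma norming_pos:
  assumes c: "0 < c" and H: "\<And>n y. y \<in> kothe_dual \<Longrightarrow> kothe_norm y \<le> 1 \<Longrightarrow> (\<Sum>k<n. x k * y k) \<le> c"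
  shows "N (trunc n x) \<le> c"
proof (rule ccontr)
  assume big: "\<not> N (trunc n x) \<le> c"
  \<comment> \<open>\<open>f\<close> sees only the first \<open>n\<close> coordinates. Requiring the
    support to lie there makes the minimiser its own truncation, so that \<open>y = 0\<close> would
    force \<open>trunc n x = p\<close>.\<close>
  define K where "K = {u\<in>V. N u \<le> c} \<inter> {u. \<forall>k. n \<le> k \<longrightarrow> u k = 0}"
  define f where "f = (\<lambda>u. \<Sum>k<n. (x k - u k)\<^sup>2)"
  have cont: "continuous_on S (\<lambda>u::nat \<Rightarrow> real. u k)" for S k
    by (rule continuous_on_subset[OF continuous_on_product_coordinates]) simp
  have "closed {u::nat \<Rightarrow> real. \<forall>k. n \<le> k \<longrightarrow> u k = 0}"
    by (intro closed_Collect_all closed_Collect_imp open_Collect_const closed_Collect_eq cont continuous_on_const)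
  then have "compact K" unfolding K_def by (intro compact_Int_closed compact_ball)
  moreover have "0 \<in> K" using c by (simp add: K_def zero_mem norm_zero)
  moreover have "continuous_on K f" unfolding f_def by (intro continuous_intros cont)
  ultimately obtain p where p: "p \<in> K" "\<And>u. u \<in> K \<Longrightarrow> f p \<le> f u"
    using continuous_attains_inf[of K f] by blast
  define y where "y = trunc n (x - p)"
  define s where "s = (\<Sum>k<n. p k * y k)"
  have yk: "y k = x k - p k" if "k < n" for k using that by (simp add: y_def trunc_def)
  have var: "(\<Sum>k<n. u k * y k) \<le> s" if u: "u \<in> K" for u
  proof -
    define a where "a = (\<Sum>k<n. y k * (u k - p k))"
    define b where "b = (\<Sum>k<n. (u k - p k)\<^sup>2)"
    \<comment> \<open>Move from \<open>p\<close> towards \<open>u\<close> by the fraction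
      \<open>t\<close>: minimality of \<open>p\<close> gives this after division by
      \<open>t\<close>, and letting \<open>t\<close> tend to 0 leaves
      \<open>a \<le> 0\<close>.\<close>
    have "2 * a \<le> t * b" if t: "0 < t" "t \<le> 1" for t
    proof -
      define q where "q = (1 - t) *\<^sub>R p + t *\<^sub>R u"
      have pu: "p \<in> V" "u \<in> V" "N p \<le> c" "N u \<le> c" using p(1) u by (auto simp: K_def)
      have "N q \<le> (1 - t) * N p + t * N u"
        using norm_add[OF scale_mem[OF pu(1)] scale_mem[OF pu(2)], of "1 - t" t] t pu
        by (simp add: q_def norm_scale)
      also have "\<dots> \<le> (1 - t) * c + t * c" using t pu by (intro add_mono mult_left_mono) auto
      finally have "N q \<le> c" by (simp add: algebra_simps)
      then have "q \<in> K" using p(1) u pu add_mem scale_mem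
        by (auto simp: K_def q_def scaleR_fun_def)
      then have "f p \<le> f q" by (rule p(2))
      also have "f q = (\<Sum>k<n. (x k - p k)\<^sup>2 - 2 * t * (y k * (u k - p k)) + t\<^sup>2 * (u k - p k)\<^sup>2)"
        unfolding f_def
        by (intro sum.cong refl)
           (auto simp: yk q_def scaleR_fun_def power2_eq_square algebra_simps)
      also have "\<dots> = f p - 2 * t * a + t\<^sup>2 * b"
        by (simp add: f_def a_def b_def sum.distrib sum_subtractf sum_distrib_left)
      finally have "t * (2 * a) \<le> t * (t * b)" by (simp add: power2_eq_square algebra_simps)
      then show ?thesis using t by simp
    qed
    moreover have "((\<lambda>t. t * b) \<longlongrightarrow> 0 * b) (at_right 0)"
      by (intro tendsto_mult tendsto_const tendsto_ident_at)
    moreover have "eventually (\<lambda>t::real. 0 < t \<and> t \<le> 1) (at_right 0)"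
      unfolding eventually_at_right_field by (intro exI[of _ 1]) auto
    ultimately have "2 * a \<le> 0 * b"
      by (intro tendsto_lowerbound[of "\<lambda>t. t * b" _ "at_right 0"])
         (auto elim: eventually_mono simp: trivial_limit_at_right_real)
    then show ?thesis
      by (simp add: a_def s_def algebra_simps sum_subtractf)
  qed
  \<comment> \<open>The multiple of \<open>v\<close> by \<open>c\<close>, cut down to the first
    \<open>min m n\<close> coordinates, lies in \<open>K\<close>. The variational inequality thus
    bounds every partial sum, and with it \<open>kothe_norm y\<close>, by
    \<open>s / c\<close>.\<close>
  have ball: "(\<Sum>k<m. v k * y k) \<le> s / c" if v: "v \<in> V" "N v \<le> 1" for v m
  proof -
    have "N (trunc n (trunc m (c *\<^sub>R v))) \<le> c * N v"
      using norm_trunc_le[OF trunc_mem, of n m "c *\<^sub>R v"] norm_trunc_le[OF scale_mem[OF v(1)], of m c]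
        norm_scale[OF v(1), of c] c by simp
    also have "\<dots> \<le> c" using c v(2) by simp
    finally have "trunc n (trunc m (c *\<^sub>R v)) \<in> K"
      using trunc_mem[of n "trunc m (c *\<^sub>R v)"] by (simp add: K_def) (simp add: trunc_def)
    then have "(\<Sum>k<n. trunc n (trunc m (c *\<^sub>R v)) k * y k) \<le> s" by (rule var)
    also have "(\<Sum>k<n. trunc n (trunc m (c *\<^sub>R v)) k * y k) = (\<Sum>k<n. trunc m (c *\<^sub>R v) k * y k)"
      by (intro sum.cong refl) (simp add: trunc_def)
    also have "\<dots> = (\<Sum>k<m. trunc n (c *\<^sub>R v) k * y k)" by (rule sum_trunc_commute)
    also have "\<dots> = c * (\<Sum>k<m. v k * y k)"
      unfolding sum_distrib_left
      by (intro sum.cong refl) (auto simp: trunc_def y_def scaleR_fun_def)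
    finally show ?thesis using c by (simp add: field_simps)
  qed
  have yd: "y \<in> kothe_dual" "kothe_norm y \<le> s / c" using kothe_least[of y "s / c"] ball by blast+
  have "y \<noteq> 0"
  proof
    assume "y = 0"
    then have "trunc n x = p"
      using p(1) yk by (auto simp: K_def fun_eq_iff trunc_def)
    then show False using big p(1) by (simp add: K_def)
  qed
  then have pos: "0 < kothe_norm y"
    using dual.norm_eq_0[OF yd(1)] kothe_norm_nonneg[OF yd(1)] by simp
  \<comment> \<open>For the normalised \<open>y\<close> the hypothesis leads to
    \<open>(\<Sum>k<n. x k * y k) \<le> c * kothe_norm y \<le> s\<close>. But \<open>x\<close> is
    \<open>p + y\<close> on the first \<open>n\<close> coordinates, so the same sum is
    \<open>s\<close> plus a positive sum of squares.\<close>
  have "(\<Sum>k<n. x k * (inverse (kothe_norm y) *\<^sub>R y) k) \<le> c"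
    using pos yd by (intro H dual.scale_mem) (auto simp: dual.norm_scale)
  moreover have "(\<Sum>k<n. x k * (inverse (kothe_norm y) *\<^sub>R y) k) = (\<Sum>k<n. x k * y k) / kothe_norm y"
    unfolding sum_divide_distrib
    by (intro sum.cong refl) (simp add: scaleR_fun_def divide_inverse)
  ultimately have "(\<Sum>k<n. x k * y k) / kothe_norm y \<le> c" by simp
  then have "(\<Sum>k<n. x k * y k) \<le> c * kothe_norm y" using pos by (simp add: pos_divide_le_eq)
  also have "\<dots> \<le> s" using yd(2) c by (simp add: field_simps)
  finally have "(\<Sum>k<n. x k * y k) \<le> s" .
  moreover have "(\<Sum>k<n. x k * y k) = s + (\<Sum>k<n. (y k)\<^sup>2)"
    unfolding s_def sum.distrib[symmetric]
    by (intro sum.cong refl) (simp add: yk power2_eq_square algebra_simps)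
  moreover have "0 < (\<Sum>k<n. (y k)\<^sup>2)"
  proof -
    obtain k where "y k \<noteq> 0" using \<open>y \<noteq> 0\<close> by (auto simp: fun_eq_iff)
    moreover from this have "k < n" by (auto simp: y_def trunc_def split: if_splits)
    ultimately show ?thesis by (intro sum_pos2[of _ k]) auto
  qed
  ultimately show False by simp
qed

text \<open>\<open>norming_pos\<close> divides by \<open>c\<close>, so it is applied to
  \<open>c + e\<close>. As \<open>x\<close> is not assumed to lie in \<open>V\<close>, this is also
  the tool that places sequences built from functionals or integrals in \<open>V\<close>.\<close>

lemma norming:
  assumes H: "\<And>n y. y \<in> kothe_dual \<Longrightarrow> kothe_norm y \<le> 1 \<Longrightarrow> (\<Sum>k<n. x k * y k) \<le> c"
  shows "x \<in> V" "N x \<le> c"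
proof -
  have c: "0 \<le> c" using H[OF dual.zero_mem, of 0] dual.norm_zero by simp
  have "N (trunc n x) \<le> c + e" if "0 < e" for n e
    by (rule norming_pos) (use H c that in \<open>auto intro: add_increasing2 order_trans\<close>)
  then have "N (trunc n x) \<le> c" for n by (rule field_le_epsilon)
  then show "x \<in> V" "N x \<le> c" using trunc_bounded[of x c] by auto
qed

section \<open>The pairing of the space with its predual\<close>

lemma pairing_summable:
  assumes "y \<in> kothe_dual" "x \<in> V"
  shows "summable (\<lambda>k. x k * y k)" "\<bar>\<Sum>k. x k * y k\<bar> \<le> N x * kothe_norm y"
proof -
  have *: "summable (\<lambda>k. \<bar>x k * y k\<bar>)"
    by (rule summableI_nonneg_bounded[of _ "N x * kothe_norm y"])
       (use kothe_upper_abs[OF assms] in auto)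
  then show "summable (\<lambda>k. x k * y k)" by (rule summable_rabs_cancel)
  have "\<bar>\<Sum>k. x k * y k\<bar> \<le> (\<Sum>k. \<bar>x k * y k\<bar>)" by (rule summable_rabs[OF *])
  also have "\<dots> \<le> N x * kothe_norm y"
    by (rule suminf_le_const[OF *]) (use kothe_upper_abs[OF assms] in auto)
  finally show "\<bar>\<Sum>k. x k * y k\<bar> \<le> N x * kothe_norm y" .
qed

text \<open>The value 0 off the regular part follows the convention of
  \<open>dual_carrier\<close>.\<close>

definition predual_pairing :: "(nat \<Rightarrow> real) \<Rightarrow> (nat \<Rightarrow> real) \<Rightarrow> real" where
  "predual_pairing x y = (if y \<in> dual.regular_part then \<Sum>k. x k * y k else 0)"

lemma predual_pairing_trunc: "predual_pairing x (trunc n y) = (\<Sum>k<n. x k * y k)"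
proof -
  have "(\<Sum>k. x k * trunc n y k) = (\<Sum>k<n. x k * trunc n y k)"
    by (rule suminf_finite) (auto simp: trunc_def)
  also have "\<dots> = (\<Sum>k<n. x k * y k)" by (intro sum.cong refl) (simp add: trunc_def)
  finally show ?thesis by (simp add: predual_pairing_def dual.trunc_mem_regular_part)
qed

lemma predual_pairing_mem:
  assumes x: "x \<in> V"
  shows "predual_pairing x \<in> dual_carrier dual.regular_part kothe_norm"
  unfolding dual_carrier_def linear_map_on_def
proof (intro CollectI conjI ballI allI impI exI[of _ "N x"])
  fix y assume y: "y \<in> dual.regular_part"
  note y' = subsetD[OF dual.regular_part_subset y]
  show "\<bar>predual_pairing x y\<bar> \<le> N x * kothe_norm y"
    using pairing_summable(2)[OF y' x] y by (simp add: predual_pairing_def)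
  show "predual_pairing x (c *\<^sub>R y) = c *\<^sub>R predual_pairing x y" for c
    using subspace_scale[OF dual.subspace_regular_part y] y
      suminf_mult[OF pairing_summable(1)[OF y' x], of c]
    by (simp add: predual_pairing_def scaleR_fun_def mult_ac)
  fix z assume z: "z \<in> dual.regular_part"
  note z' = subsetD[OF dual.regular_part_subset z]
  show "predual_pairing x (y + z) = predual_pairing x y + predual_pairing x z"
    using subspace_add[OF dual.subspace_regular_part y z] y z
      suminf_add[OF pairing_summable(1)[OF y' x] pairing_summable(1)[OF z' x]]
    by (simp add: predual_pairing_def distrib_left)
qed (simp add: predual_pairing_def)

text \<open>No norm is lost by testing on the regular part alone: each partial sum in
  \<open>norming\<close> is the pairing with a truncation, which belongs to the regular part and has
  no larger norm.\<close>

lemma dual_norm_predual_pairing: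
  assumes x: "x \<in> V"
  shows "dual_norm dual.regular_part kothe_norm (predual_pairing x) = N x"
proof -
  have le: "\<bar>predual_pairing x y\<bar> \<le> N x" if "y \<in> unit_ball dual.regular_part kothe_norm" for y
  proof -
    have y: "y \<in> kothe_dual" "kothe_norm y \<le> 1" "y \<in> dual.regular_part"
      using that dual.regular_part_subset by (auto simp: unit_ball_def)
    then show ?thesis
      using pairing_summable(2)[OF y(1) x] mult_left_mono[OF y(2) norm_nonneg[OF x]]
      by (simp add: predual_pairing_def)
  qed
  have zero: "0 \<in> unit_ball dual.regular_part kothe_norm"
    using subspace_0[OF dual.subspace_regular_part] dual.norm_zero by (simp add: unit_ball_def)
  have bdd: "bdd_above ((\<lambda>y. \<bar>predual_pairing x y\<bar>) ` unit_ball dual.regular_part kothe_norm)"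
    using le by (auto simp: bdd_above_def)
  show ?thesis unfolding dual_norm_def
  proof (rule antisym)
    show "(SUP y\<in>unit_ball dual.regular_part kothe_norm. \<bar>predual_pairing x y\<bar>) \<le> N x"
      using zero le by (intro cSUP_least) auto
    show "N x \<le> (SUP y\<in>unit_ball dual.regular_part kothe_norm. \<bar>predual_pairing x y\<bar>)"
    proof (rule norming(2))
      fix n y assume y: "y \<in> kothe_dual" "kothe_norm y \<le> 1"
      have "trunc n y \<in> unit_ball dual.regular_part kothe_norm"
        using dual.norm_trunc_le[OF y(1), of n] y(2)
        by (simp add: unit_ball_def dual.trunc_mem_regular_part)
      then show "(\<Sum>k<n. x k * y k)
          \<le> (SUP y\<in>unit_ball dual.regular_part kothe_norm. \<bar>predual_pairing x y\<bar>)"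
        by (rule cSUP_upper2[OF bdd]) (simp add: predual_pairing_trunc)
    qed
  qed
qed

text \<open>Finitely supported sequences are dense in the regular part, so a bounded functional is
  determined by its values at \<open>unit_seq k\<close>. These values form the representing
  sequence, and \<open>norming\<close> places it in \<open>V\<close>.\<close>

lemma predual_pairing_surj:
  assumes f: "f \<in> dual_carrier dual.regular_part kothe_norm"
  shows "\<exists>x\<in>V. predual_pairing x = f"
proof -
  have add: "f (y + z) = f y + f z" if "y \<in> dual.regular_part" "z \<in> dual.regular_part" for y z
    using f that by (simp add: dual_carrier_def linear_map_on_def)
  have scale: "f (c *\<^sub>R y) = c * f y" if "y \<in> dual.regular_part" for y c
    using f that by (simp add: dual_carrier_def linear_map_on_def)
  have off: "f y = 0" if "y \<notin> dual.regular_part" for y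
    using f that by (simp add: dual_carrier_def)
  obtain C where C: "\<And>y. y \<in> dual.regular_part \<Longrightarrow> \<bar>f y\<bar> \<le> C * kothe_norm y"
    using f by (auto simp: dual_carrier_def)
  have unit: "unit_seq k \<in> dual.regular_part" for k
    using dual.trunc_mem_regular_part[of "Suc k" "unit_seq k"]
    by (metis (no_types, lifting) ext lessI trunc_def unit_seq_def)
  define x where "x = (\<lambda>k. f (unit_seq k))"
  have f_trunc: "f (trunc n y) = (\<Sum>k<n. x k * y k)" for n y
  proof (induction n)
    case 0
    have "trunc 0 y = 0 *\<^sub>R unit_seq 0" by (auto simp: trunc_def scaleR_fun_def)
    then have "f (trunc 0 y) = 0" using scale[OF unit, of 0 0] by simp
    then show ?case by simp
  next
    case (Suc n)
    have "trunc (Suc n) y = trunc n y + y n *\<^sub>R unit_seq n"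
      by (simp only: trunc_eq_sum sum.lessThan_Suc)
    then have "f (trunc (Suc n) y) = f (trunc n y) + y n * x n"
      by (simp add: add scale unit dual.trunc_mem_regular_part
          subspace_scale[OF dual.subspace_regular_part] x_def del: plus_fun_apply)
    then show ?case using Suc by simp
  qed
  have xV: "x \<in> V"
  proof (rule norming(1))
    fix n y assume y: "y \<in> kothe_dual" "kothe_norm y \<le> 1"
    have "\<bar>f (trunc n y)\<bar> \<le> C * kothe_norm (trunc n y)"
      by (rule C[OF dual.trunc_mem_regular_part])
    \<comment> \<open>The sign of \<open>C\<close> is not given, and the norm next to it is about to
      be enlarged to 1.\<close>
    also have "\<dots> \<le> \<bar>C\<bar> * kothe_norm (trunc n y)"
      by (intro mult_right_mono kothe_norm_nonneg dual.trunc_mem) simp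
    also have "\<dots> \<le> \<bar>C\<bar> * 1"
      using dual.norm_trunc_le[OF y(1), of n] y(2) by (intro mult_left_mono) auto
    finally show "(\<Sum>k<n. x k * y k) \<le> \<bar>C\<bar>" by (simp add: f_trunc)
  qed
  have "predual_pairing x y = f y" for y
  proof (cases "y \<in> dual.regular_part")
    case True
    then have y': "y \<in> kothe_dual" and lim: "(\<lambda>n. kothe_norm (y - trunc n y)) \<longlonglongrightarrow> 0"
      by (auto simp: dual.regular_part_def)
    have "(\<lambda>n. f y - f (trunc n y)) \<longlonglongrightarrow> 0"
    proof (rule Lim_null_comparison)
      show "(\<lambda>n. C * kothe_norm (y - trunc n y)) \<longlonglongrightarrow> 0"
        using tendsto_mult_left[OF lim, of C] by simp
      have "f y - f (trunc n y) = f (y - trunc n y)" for n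
        using add[OF subspace_diff[OF dual.subspace_regular_part True dual.trunc_mem_regular_part]
            dual.trunc_mem_regular_part, of n y n y] by (simp del: plus_fun_apply)
      then have "norm (f y - f (trunc n y)) \<le> C * kothe_norm (y - trunc n y)" for n
        using C[OF subspace_diff[OF dual.subspace_regular_part True dual.trunc_mem_regular_part],
            of n y] by simp
      then show "\<forall>\<^sub>F n in sequentially. norm (f y - f (trunc n y)) \<le> C * kothe_norm (y - trunc n y)"
        by simp
    qed
    from tendsto_diff[OF tendsto_const this, of "f y"]
    have "(\<lambda>n. \<Sum>k<n. x k * y k) \<longlonglongrightarrow> f y" by (simp add: f_trunc)
    moreover have "(\<lambda>n. \<Sum>k<n. x k * y k) \<longlonglongrightarrow> (\<Sum>k. x k * y k)"
      using summable_LIMSEQ[OF pairing_summable(1)[OF y' xV]] .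
    ultimately show ?thesis using True LIMSEQ_unique by (simp add: predual_pairing_def)
  qed (simp add: off predual_pairing_def)
  then show ?thesis using xV by blast
qed

lemma predual_pairing_linear: "linear_map_on V predual_pairing"
  unfolding linear_map_on_def
proof (intro conjI ballI allI ext)
  fix x c y assume x: "x \<in> V"
  show "predual_pairing (c *\<^sub>R x) y = (c *\<^sub>R predual_pairing x) y"
    using suminf_mult[OF pairing_summable(1)[OF _ x, of y], of c] dual.regular_part_subset
    by (auto simp: predual_pairing_def scaleR_fun_def mult_ac)
  fix z assume z: "z \<in> V"
  show "predual_pairing (x + z) y = (predual_pairing x + predual_pairing z) y"
    using suminf_add[OF pairing_summable(1)[OF _ x, of y] pairing_summable(1)[OF _ z, of y]]
      dual.regular_part_subset
    by (auto simp: predual_pairing_def distrib_right)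
qed

theorem dual_space: "dual_space V N"
proof -
  have "inj_on predual_pairing V"
  proof (rule inj_onI, rule ext)
    fix x z k assume "predual_pairing x = predual_pairing z"
    from fun_cong[OF this, of "trunc (Suc k) (unit_seq k)"] show "x k = z k"
      unfolding predual_pairing_trunc by (simp add: unit_seq_def)
  qed
  then have "bij_betw predual_pairing V (dual_carrier dual.regular_part kothe_norm)"
    using predual_pairing_mem predual_pairing_surj by (fastforce simp: bij_betw_def)
  then have "isometrically_isomorphic V N (dual_carrier dual.regular_part kothe_norm)
      (dual_norm dual.regular_part kothe_norm)"
    unfolding isometrically_isomorphic_def
    using predual_pairing_linear dual_norm_predual_pairing by blast
  then show ?thesis
    unfolding dual_space_def using banach dual.banach_regular_part by blast
qed

end

section \<open>Separability and weakly open sets of small diameter\<close>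

text \<open>Order continuity of the norm, the form in which \<open>Delta2_0\<close> will enter: the
  finitely supported sequences are dense.\<close>

locale regular_fatou_space = fatou_space +
  assumes regular: "x \<in> V \<Longrightarrow> (\<lambda>n. N (x - trunc n x)) \<longlonglongrightarrow> 0"
begin

lemma regular_part_eq: "regular_part = V"
  using regular by (auto simp: regular_part_def)

theorem separable: "separable_on V N"
proof -
  interpret Metric_space V "norm_dist V N"
    by (rule Metric_space_norm_dist[OF normed])
  obtain D where D: "countable D" "D \<subseteq> V" "\<And>x e. x \<in> V \<Longrightarrow> 0 < e \<Longrightarrow> \<exists>y\<in>D. N (x - y) < e"
    using countable_dense unfolding regular_part_eq by blast
  have "mtopology closure_of D = V"
    unfolding metric_closure_of using D(2,3) by (auto simp: norm_dist_def subset_iff)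
  then show ?thesis
    unfolding separable_on_def separable_space_def using D by auto
qed

end

section \<open>The weak topology compared with the product topology\<close>

context fatou_space
begin

lemma topspace_weak: "topspace (weak_topology_on V N) = V"
proof -
  have "(\<lambda>_. 0) \<in> dual_carrier V N"
    by (auto simp: dual_carrier_def linear_map_on_def intro!: exI[of _ 0])
  then have "V \<in> {{x\<in>V. f x \<in> S} |f S. f \<in> dual_carrier V N \<and> open S}"
    by (auto intro!: exI[of _ "\<lambda>_. 0"] exI[of _ UNIV])
  then show ?thesis unfolding weak_topology_on_def by (auto simp: topology_generated_by_topspace)
qed

lemma coordinate_mem_dual: "(\<lambda>x. if x \<in> V then x k else 0) \<in> dual_carrier V N"
proof -
  have bound: "\<bar>x k\<bar> \<le> 1 / N (unit_seq k) * N x" if "x \<in> V" for x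
    using coordinate_le[OF that, of k] norm_unit_pos[of k] by (simp add: field_simps)
  have "linear_map_on V (\<lambda>x. if x \<in> V then x k else 0)"
    unfolding linear_map_on_def
  proof (intro conjI ballI allI)
    fix x y c assume "x \<in> V" "y \<in> V"
    then show "(if x + y \<in> V then (x + y) k else 0) = (if x \<in> V then x k else 0) + (if y \<in> V then y k else 0)"
      by (simp only: add_mem if_True plus_fun_apply)
  next
    fix x c assume "x \<in> V"
    then show "(if c *\<^sub>R x \<in> V then (c *\<^sub>R x) k else 0) = c *\<^sub>R (if x \<in> V then x k else 0)"
      by (simp only: scale_mem if_True) (simp only: scaleR_fun_def)
  qed
  moreover have "\<exists>C. \<forall>x\<in>V. \<bar>if x \<in> V then x k else 0\<bar> \<le> C * N x"
    using bound by (intro exI[of _ "1 / N (unit_seq k)"]) simp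
  ultimately show ?thesis by (simp add: dual_carrier_def)
qed

text \<open>Each coordinate is a bounded functional, so the identity is continuous from the weak to
  the product topology. Open sets found by compactness in the latter are therefore weakly
  open.\<close>

lemma openin_weak:
  assumes "open W"
  shows "openin (weak_topology_on V N) (W \<inter> V)"
proof -
  have "continuous_map (weak_topology_on V N) (product_topology (\<lambda>_. euclideanreal) UNIV) (\<lambda>x. x)"
    unfolding continuous_map_componentwise_UNIV
  proof
    fix k
    show "continuous_map (weak_topology_on V N) euclideanreal (\<lambda>x. x k)"
      unfolding continuous_map_def
    proof (intro conjI allI impI)
      fix S :: "real set" assume "openin euclideanreal S"
      then have "open S" by (simp only: open_openin)
      have "{x\<in>V. (if x \<in> V then x k else 0) \<in> S}
          \<in> {{x\<in>V. f x \<in> S} |f S. f \<in> dual_carrier V N \<and> open S}"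
        by (intro CollectI exI[of _ "\<lambda>x. if x \<in> V then x k else 0"] exI[of _ S] conjI refl
            coordinate_mem_dual \<open>open S\<close>)
      then have "openin (weak_topology_on V N) {x\<in>V. (if x \<in> V then x k else 0) \<in> S}"
        unfolding weak_topology_on_def by (rule topology_generated_by_Basis)
      then show "openin (weak_topology_on V N) {x \<in> topspace (weak_topology_on V N). x k \<in> S}"
        unfolding topspace_weak by (simp cong: conj_cong)
    qed simp
  qed
  then have "continuous_map (weak_topology_on V N) euclidean (\<lambda>x. x)"
    unfolding euclidean_product_topology .
  moreover have "openin euclidean W" using assms by (simp only: open_openin)
  ultimately have "openin (weak_topology_on V N) {x \<in> topspace (weak_topology_on V N). x \<in> W}"
    by (rule openin_continuous_map_preimage)
  moreover have "{x \<in> V. x \<in> W} = W \<inter> V" by blast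
  ultimately show ?thesis unfolding topspace_weak by (simp only:)
qed

end

section \<open>Small weakly open sets by Baire category\<close>

context regular_fatou_space
begin

theorem small_weakly_open_set:
  assumes "0 < \<epsilon>"
  shows "\<exists>U. openin (subtopology (weak_topology_on V N) (unit_ball V N)) U \<and> U \<noteq> {}
    \<and> norm_diameter N U < \<epsilon>"
proof -
  define B where "B = unit_ball V N"
  \<comment> \<open>A third of \<open>\<epsilon>\<close> as radius bounds the diameter by
    \<open>2 * (\<epsilon> / 3)\<close>, which is strictly below \<open>\<epsilon>\<close> although
    a supremum yields only a weak inequality.\<close>
  define F where "F = (\<lambda>d. B \<inter> {x\<in>V. N (x - d) \<le> \<epsilon> / 3})"
  obtain D where D: "countable D" "D \<subseteq> V" "\<And>x e. x \<in> V \<Longrightarrow> 0 < e \<Longrightarrow> \<exists>y\<in>D. N (x - y) < e"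
    using countable_dense unfolding regular_part_eq by blast
  have "compact B" unfolding B_def unit_ball_def by (rule compact_ball)
  have "\<Union>(F ` D) = B"
  proof
    show "B \<subseteq> \<Union>(F ` D)"
    proof
      fix x assume x: "x \<in> B"
      then have "x \<in> V" by (simp add: B_def unit_ball_def)
      then obtain d where "d \<in> D" "N (x - d) < \<epsilon> / 3" using D(3)[of x "\<epsilon>/3"] assms by auto
      then show "x \<in> \<Union>(F ` D)" using x \<open>x \<in> V\<close> unfolding F_def by fastforce
    qed
  qed (auto simp: F_def)
  then have int: "top_of_set B interior_of \<Union>(F ` D) = B"
    using interior_of_topspace[of "top_of_set B"] by simp
  have cl: "closedin (top_of_set B) (F d)" if "d \<in> D" for d
    unfolding F_def using D(2) that
    by (intro closed_subset closed_Int closed_cball compact_imp_closed[OF \<open>compact B\<close>]) auto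
  \<comment> \<open>Baire's theorem is applied to \<open>B\<close> itself, compact and Hausdorff in
    the product topology. The interior it provides is relative to \<open>B\<close>, which suits a
    relatively weakly open set.\<close>
  have lc: "locally_compact_space (top_of_set B) \<and> regular_space (top_of_set B)"
    using \<open>compact B\<close>
    by (simp add: compact_space_subtopology compact_imp_locally_compact_space
        compact_Hausdorff_imp_regular_space Hausdorff_space_subtopology)
  have "\<exists>d\<in>D. top_of_set B interior_of F d \<noteq> {}"
  proof (rule ccontr)
    assume "\<not> ?thesis"
    then have none: "closedin (top_of_set B) T \<and> top_of_set B interior_of T = {}" if "T \<in> F ` D" for T
      using cl that by blast
    have "top_of_set B interior_of \<Union>(F ` D) = {}"
      by (rule Baire_category_alt[OF disjI2[OF lc] countable_image[OF D(1)] none])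
    then show False using int zero_in_ball by (auto simp: B_def)
  qed
  then obtain d where d: "d \<in> D" "top_of_set B interior_of F d \<noteq> {}" by blast
  define U where "U = top_of_set B interior_of F d"
  have "U \<noteq> {}" using d by (simp add: U_def)
  have "U \<subseteq> F d" unfolding U_def by (rule interior_of_subset)
  have "openin (top_of_set B) U" unfolding U_def by (rule openin_interior_of)
  then obtain W where W: "open W" "U = B \<inter> W" by (auto simp: openin_open)
  have "B \<inter> W = (W \<inter> V) \<inter> B" by (auto simp: B_def unit_ball_def)
  then have "openin (subtopology (weak_topology_on V N) B) U"
    using openin_weak[OF W(1)] unfolding W(2) openin_subtopology by blast
  moreover have "norm_diameter N U \<le> 2 * (\<epsilon> / 3)"
    unfolding norm_diameter_def
  proof (rule cSUP_least)
    show "U \<times> U \<noteq> {}" using \<open>U \<noteq> {}\<close> by simp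
    fix p assume "p \<in> U \<times> U"
    then obtain x y where p: "p = (x, y)" "x \<in> F d" "y \<in> F d" using \<open>U \<subseteq> F d\<close> by auto
    have mem: "x \<in> V" "y \<in> V" "d \<in> V" and le: "N (x - d) \<le> \<epsilon> / 3" "N (y - d) \<le> \<epsilon> / 3"
      using p d(1) D(2) by (auto simp: F_def)
    have "N (x - y) \<le> 2 * (\<epsilon> / 3)"
      using norm_diff_triangle[OF mem(1,3,2)] norm_minus_commute[OF mem(3,2)] le by linarith
    then show "(case p of (x, y) \<Rightarrow> N (x - y)) \<le> 2 * (\<epsilon> / 3)"
      unfolding p by (simp only: prod.case)
  qed
  ultimately show ?thesis using \<open>U \<noteq> {}\<close> assms unfolding B_def by (intro exI[of _ U]) auto
qed

end

section \<open>Radon-Nikodym theorem for bounded signed measures\<close>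

definition pos_variation :: "'a measure \<Rightarrow> ('a set \<Rightarrow> real) \<Rightarrow> 'a set \<Rightarrow> real" where
  "pos_variation M \<nu> A = (SUP B\<in>{B\<in>sets M. B \<subseteq> A}. \<nu> B)"

text \<open>Tailored to one coordinate of a vector measure: additivity is convergence of partial
  sums, \<open>charge_null\<close> supplies absolute continuity, and \<open>charge_bounded\<close>
  keeps the positive variation finite.\<close>

locale bounded_charge = finite_measure M for M :: "'a measure" +
  fixes \<nu> :: "'a set \<Rightarrow> real" and C :: real
  assumes charge_sums: "\<lbrakk>range A \<subseteq> sets M; disjoint_family A\<rbrakk>
      \<Longrightarrow> (\<lambda>n::nat. \<Sum>i<n. \<nu> (A i)) \<longlonglongrightarrow> \<nu> (\<Union>i. A i)"
    and charge_bounded: "B \<in> sets M \<Longrightarrow> \<bar>\<nu> B\<bar> \<le> C"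
    and charge_null: "B \<in> null_sets M \<Longrightarrow> \<nu> B = 0"
begin

lemma charge_empty: "\<nu> {} = 0"
  by (rule charge_null) simp

lemma charge_Un:
  assumes "A \<in> sets M" "B \<in> sets M" "A \<inter> B = {}"
  shows "\<nu> (A \<union> B) = \<nu> A + \<nu> B"
proof -
  \<comment> \<open>Finite additivity is the countable one for a sequence padded with empty
    sets.\<close>
  define D where "D = (\<lambda>i::nat. if i = 0 then A else if i = 1 then B else {})"
  have "range D \<subseteq> sets M" "disjoint_family D"
    using assms by (auto simp: D_def disjoint_family_on_def)
  then have lim: "(\<lambda>n. \<Sum>i<n. \<nu> (D i)) \<longlonglongrightarrow> \<nu> (\<Union>i. D i)" by (rule charge_sums)
  have union: "(\<Union>i. D i) = A \<union> B"
  proof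
    show "A \<union> B \<subseteq> (\<Union>i. D i)" using UN_upper[of 0 UNIV D] UN_upper[of 1 UNIV D] by (simp add: D_def)
  qed (auto simp: D_def split: if_splits)
  have "(\<Sum>i<n. \<nu> (D i)) = \<nu> A + \<nu> B" if "2 \<le> n" for n
  proof -
    have "(\<Sum>i<n. \<nu> (D i)) = (\<Sum>i\<in>{0, 1}. \<nu> (D i))"
      using that by (intro sum.mono_neutral_right) (auto simp: D_def charge_empty)
    then show ?thesis by (simp add: D_def)
  qed
  then have "(\<lambda>n. \<Sum>i<n. \<nu> (D i)) \<longlonglongrightarrow> \<nu> A + \<nu> B"
    by (intro tendsto_eventually) (auto simp: eventually_sequentially)
  then show ?thesis using LIMSEQ_unique[OF lim] union by simp
qed

lemma charge_Diff:
  assumes "A \<in> sets M" "B \<in> sets M" "B \<subseteq> A"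
  shows "\<nu> A = \<nu> B + \<nu> (A - B)"
proof -
  have "A = B \<union> (A - B)" using assms(3) by blast
  then show ?thesis using charge_Un[of B "A - B"] assms by auto
qed

lemma pos_variation_upper: "B \<in> sets M \<Longrightarrow> B \<subseteq> A \<Longrightarrow> \<nu> B \<le> pos_variation M \<nu> A"
  unfolding pos_variation_def
  by (rule cSUP_upper) (auto intro!: bdd_aboveI2[of _ _ C] dest: charge_bounded)

lemma pos_variation_least:
  "(\<And>B. B \<in> sets M \<Longrightarrow> B \<subseteq> A \<Longrightarrow> \<nu> B \<le> c) \<Longrightarrow> pos_variation M \<nu> A \<le> c"
  unfolding pos_variation_def by (rule cSUP_least) auto

lemma pos_variation_nonneg: "0 \<le> pos_variation M \<nu> A"
  using pos_variation_upper[of "{}" A] by (simp add: charge_empty)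

lemma pos_variation_mono: "A \<subseteq> B \<Longrightarrow> pos_variation M \<nu> A \<le> pos_variation M \<nu> B"
  by (rule pos_variation_least) (rule pos_variation_upper, auto)

text \<open>Subsets of \<open>A\<close> and of \<open>B\<close> are chosen independently, and their
  union competes on \<open>A \<union> B\<close>.\<close>

lemma pos_variation_superadditive:
  assumes "A \<inter> B = {}"
  shows "pos_variation M \<nu> A + pos_variation M \<nu> B \<le> pos_variation M \<nu> (A \<union> B)"
proof -
  have "pos_variation M \<nu> A \<le> pos_variation M \<nu> (A \<union> B) - pos_variation M \<nu> B"
  proof (rule pos_variation_least)
    fix A' assume A': "A' \<in> sets M" "A' \<subseteq> A"
    have "pos_variation M \<nu> B \<le> pos_variation M \<nu> (A \<union> B) - \<nu> A'"
    proof (rule pos_variation_least)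
      fix B' assume B': "B' \<in> sets M" "B' \<subseteq> B"
      then have "\<nu> (A' \<union> B') = \<nu> A' + \<nu> B'" using A' assms by (intro charge_Un) auto
      moreover have "\<nu> (A' \<union> B') \<le> pos_variation M \<nu> (A \<union> B)"
        using A' B' by (intro pos_variation_upper) auto
      ultimately show "\<nu> B' \<le> pos_variation M \<nu> (A \<union> B) - \<nu> A'" by simp
    qed
    then show "\<nu> A' \<le> pos_variation M \<nu> (A \<union> B) - pos_variation M \<nu> B" by simp
  qed
  then show ?thesis by simp
qed

text \<open>Superadditivity and monotonicity bound the partial sums from above. For the converse, a
  competitor \<open>B\<close> inside the union is split into the pieces
  \<open>B \<inter> A i\<close>.\<close>

lemma pos_variation_sums:
  assumes A: "range A \<subseteq> sets M" "disjoint_family A"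
  shows "(\<lambda>i. pos_variation M \<nu> (A i)) sums pos_variation M \<nu> (\<Union>i. A i)"
proof -
  have fin: "(\<Sum>i<n. pos_variation M \<nu> (A i)) \<le> pos_variation M \<nu> (\<Union>i<n. A i)" for n
  proof (induction n)
    case (Suc n)
    have "(\<Union>i<n. A i) \<inter> A n = {}"
    proof -
      have "A i \<inter> A n = {}" if "i < n" for i
        using A(2) that by (simp add: disjoint_family_on_def)
      then show ?thesis by blast
    qed
    then have "pos_variation M \<nu> (\<Union>i<n. A i) + pos_variation M \<nu> (A n)
        \<le> pos_variation M \<nu> ((\<Union>i<n. A i) \<union> A n)"
      by (rule pos_variation_superadditive)
    moreover have "(\<Union>i<Suc n. A i) = (\<Union>i<n. A i) \<union> A n" by (auto simp: less_Suc_eq)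
    ultimately show ?case using Suc by simp
  qed (simp add: pos_variation_nonneg)
  have le: "(\<Sum>i<n. pos_variation M \<nu> (A i)) \<le> pos_variation M \<nu> (\<Union>i. A i)" for n
    using fin[of n] pos_variation_mono[of "\<Union>i<n. A i" "\<Union>i. A i"] by (auto intro: order_trans)
  have summ: "summable (\<lambda>i. pos_variation M \<nu> (A i))"
    using le pos_variation_nonneg by (rule summableI_nonneg_bounded[rotated])
  moreover have "(\<Sum>i. pos_variation M \<nu> (A i)) = pos_variation M \<nu> (\<Union>i. A i)"
  proof (rule antisym)
    show "(\<Sum>i. pos_variation M \<nu> (A i)) \<le> pos_variation M \<nu> (\<Union>i. A i)"
      by (rule suminf_le_const[OF summ le])
    show "pos_variation M \<nu> (\<Union>i. A i) \<le> (\<Sum>i. pos_variation M \<nu> (A i))"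
    proof (rule pos_variation_least)
      fix B assume B: "B \<in> sets M" "B \<subseteq> (\<Union>i. A i)"
      have "(\<lambda>n. \<Sum>i<n. \<nu> (B \<inter> A i)) \<longlonglongrightarrow> \<nu> (\<Union>i. B \<inter> A i)"
        using A B(1) by (intro charge_sums) (auto simp: disjoint_family_on_def)
      moreover have "(\<Union>i. B \<inter> A i) = B" using B(2) by auto
      ultimately have lim: "(\<lambda>n. \<Sum>i<n. \<nu> (B \<inter> A i)) \<longlonglongrightarrow> \<nu> B" by simp
      have "(\<Sum>i<n. \<nu> (B \<inter> A i)) \<le> (\<Sum>i. pos_variation M \<nu> (A i))" for n
      proof -
        have "(\<Sum>i<n. \<nu> (B \<inter> A i)) \<le> (\<Sum>i<n. pos_variation M \<nu> (A i))"
          using A(1) B(1) by (intro sum_mono pos_variation_upper) auto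
        also have "\<dots> \<le> (\<Sum>i. pos_variation M \<nu> (A i))"
          using summ by (rule sum_le_suminf) (auto simp: pos_variation_nonneg)
        finally show ?thesis .
      qed
      then show "\<nu> B \<le> (\<Sum>i. pos_variation M \<nu> (A i))"
        by (intro LIMSEQ_le_const2[OF lim]) blast
    qed
  qed
  ultimately show ?thesis by (simp add: sums_iff)
qed

lemma pos_variation_density:
  obtains f where "integrable M f" "\<And>A. A \<in> sets M \<Longrightarrow> (\<integral>x. indicator A x * f x \<partial>M) = pos_variation M \<nu> A"
proof -
  define K where "K = measure_of (space M) (sets M) (\<lambda>A. ennreal (pos_variation M \<nu> A))"
  have em: "emeasure K A = ennreal (pos_variation M \<nu> A)" if A: "A \<in> sets M" for A
    unfolding K_def
  proof (rule emeasure_measure_of_sigma[OF _ _ _ A])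
    show "sigma_algebra (space M) (sets M)" by (rule sets.sigma_algebra_axioms)
    show "positive (sets M) (\<lambda>A. ennreal (pos_variation M \<nu> A))"
      using pos_variation_least[of "{}" 0] pos_variation_nonneg[of "{}"] charge_empty
      by (simp add: positive_def)
    show "countably_additive (sets M) (\<lambda>A. ennreal (pos_variation M \<nu> A))"
      using pos_variation_sums suminf_ennreal_eq[OF pos_variation_nonneg]
      by (auto simp: countably_additive_def)
  qed
  have sets_K: "sets K = sets M" by (simp add: K_def)
  have "absolutely_continuous M K"
    unfolding absolutely_continuous_def
  proof
    fix A assume A: "A \<in> null_sets M"
    then have sA: "A \<in> sets M" by auto
    have "pos_variation M \<nu> A \<le> 0"
    proof (rule pos_variation_least)
      fix B assume "B \<in> sets M" "B \<subseteq> A"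
      then show "\<nu> B \<le> 0" using charge_null[OF null_sets_subset[OF A]] by simp
    qed
    then show "A \<in> null_sets K" using em[OF sA] sA sets_K by (auto simp: null_sets_def ennreal_neg)
  qed
  then obtain f where f: "f \<in> borel_measurable M" "density M f = K"
    using Radon_Nikodym sets_K by blast
  have int_f: "(\<integral>\<^sup>+x. f x * indicator A x \<partial>M) = ennreal (pos_variation M \<nu> A)" if "A \<in> sets M" for A
    using emeasure_density[OF f(1) that] em[OF that] f(2) by simp
  have "(\<integral>\<^sup>+x. f x \<partial>M) = (\<integral>\<^sup>+x. f x * indicator (space M) x \<partial>M)"
    by (intro nn_integral_cong) simp
  then have "(\<integral>\<^sup>+x. f x \<partial>M) \<noteq> \<infinity>" using int_f[of "space M"] by simp
  then have AE_fin: "AE x in M. f x \<noteq> \<infinity>" by (rule nn_integral_PInf_AE[OF f(1)])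
  \<comment> \<open>The density has finite integral and is finite almost everywhere, so
    \<open>enn2real\<close> changes no integral.\<close>
  define h where "h = (\<lambda>x. enn2real (f x))"
  have h[measurable]: "h \<in> borel_measurable M" using f(1) by (simp add: h_def)
  have ind: "has_bochner_integral M (\<lambda>x. indicator A x * h x) (pos_variation M \<nu> A)"
    if A[measurable]: "A \<in> sets M" for A
  proof (rule has_bochner_integral_nn_integral)
    have "(\<integral>\<^sup>+x. ennreal (indicator A x * h x) \<partial>M) = (\<integral>\<^sup>+x. f x * indicator A x \<partial>M)"
    proof (rule nn_integral_cong_AE, use AE_fin in eventually_elim)
      case (elim x)
      then show ?case by (cases "x \<in> A") (auto simp: h_def less_top)
    qed
    then show "(\<integral>\<^sup>+x. ennreal (indicator A x * h x) \<partial>M) = ennreal (pos_variation M \<nu> A)"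
      using int_f[OF A] by simp
    show "(\<lambda>x. indicator A x * h x) \<in> borel_measurable M" by measurable
    show "AE x in M. 0 \<le> indicator A x * h x" by (simp add: h_def)
  qed (rule pos_variation_nonneg)
  show thesis
  proof (rule that)
    have "integrable M (\<lambda>x. indicator (space M) x * h x)" using ind[of "space M"] by (auto simp: has_bochner_integral_iff)
    then show "integrable M h" by (rule Bochner_Integration.integrable_cong[THEN iffD1, rotated 2]) auto
  qed (use ind in \<open>auto simp: has_bochner_integral_iff\<close>)
qed

lemma bounded_charge_uminus: "bounded_charge M (\<lambda>A. - \<nu> A) C"
proof
  fix A :: "nat \<Rightarrow> 'a set" assume "range A \<subseteq> sets M" "disjoint_family A"
  from tendsto_minus[OF charge_sums[OF this]]
  show "(\<lambda>n. \<Sum>i<n. - \<nu> (A i)) \<longlonglongrightarrow> - \<nu> (\<Union>i. A i)" by (simp add: sum_negf)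
qed (use charge_bounded charge_null in auto)

text \<open>Passing from \<open>B\<close> to \<open>A - B\<close> replaces \<open>\<nu> B\<close> by
  \<open>\<nu> A - \<nu> B\<close>. Suprema taken in both directions give the two
  inequalities.\<close>

lemma jordan_decomposition:
  assumes A: "A \<in> sets M"
  shows "\<nu> A = pos_variation M \<nu> A - pos_variation M (\<lambda>A. - \<nu> A) A"
proof -
  interpret minus: bounded_charge M "\<lambda>A. - \<nu> A" C by (rule bounded_charge_uminus)
  have "pos_variation M \<nu> A \<le> \<nu> A + pos_variation M (\<lambda>A. - \<nu> A) A"
  proof (rule pos_variation_least)
    fix B assume B: "B \<in> sets M" "B \<subseteq> A"
    then show "\<nu> B \<le> \<nu> A + pos_variation M (\<lambda>A. - \<nu> A) A"
      using charge_Diff[OF A B] minus.pos_variation_upper[of "A - B" A] A by auto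
  qed
  moreover have "pos_variation M (\<lambda>A. - \<nu> A) A \<le> pos_variation M \<nu> A - \<nu> A"
  proof (rule minus.pos_variation_least)
    fix B assume B: "B \<in> sets M" "B \<subseteq> A"
    then show "- \<nu> B \<le> pos_variation M \<nu> A - \<nu> A"
      using charge_Diff[OF A B] pos_variation_upper[of "A - B" A] A by auto
  qed
  ultimately show ?thesis by simp
qed

theorem charge_density:
  obtains f where "integrable M f" "\<And>A. A \<in> sets M \<Longrightarrow> (\<integral>x. indicator A x * f x \<partial>M) = \<nu> A"
proof -
  interpret minus: bounded_charge M "\<lambda>A. - \<nu> A" C by (rule bounded_charge_uminus)
  obtain f where f: "integrable M f" "\<And>A. A \<in> sets M \<Longrightarrow> (\<integral>x. indicator A x * f x \<partial>M) = pos_variation M \<nu> A"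
    using pos_variation_density by blast
  obtain g where g: "integrable M g"
    "\<And>A. A \<in> sets M \<Longrightarrow> (\<integral>x. indicator A x * g x \<partial>M) = pos_variation M (\<lambda>A. - \<nu> A) A"
    using minus.pos_variation_density by blast
  show thesis
  proof (rule that)
    show "integrable M (\<lambda>x. f x - g x)" using f g by simp
    fix A assume A: "A \<in> sets M"
    have "integrable M (\<lambda>x. indicator A x * f x)" "integrable M (\<lambda>x. indicator A x * g x)"
      using integrable_mult_indicator[OF A f(1)] integrable_mult_indicator[OF A g(1)] by simp_all
    then show "(\<integral>x. indicator A x * (f x - g x) \<partial>M) = \<nu> A"
      using f(2)[OF A] g(2)[OF A] jordan_decomposition[OF A] by (simp add: right_diff_distrib)
  qed
qed

end

section \<open>The Radon-Nikodym property\<close>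

lemma sum_fun_apply: "(\<Sum>i\<in>I. f i) k = (\<Sum>i\<in>I. f i k :: 'b::comm_monoid_add)"
  by (induction I rule: infinite_finite_induct) auto

lemma simple_bochner_integrable_finite_measure:
  "finite_measure M \<Longrightarrow> simple_function M f \<Longrightarrow> Bochner_Integration.simple_bochner_integrable M f"
  by (rule simple_bochner_integrable.intros) (simp_all add: finite_measure.emeasure_finite)

text \<open>Evaluation at \<open>k\<close> is linear and so commutes with the integral of simple
  functions; vector integrals are thereby reduced to scalar ones.\<close>

lemma simple_bochner_integral_apply:
  assumes "Bochner_Integration.simple_bochner_integrable M (s :: 'm \<Rightarrow> nat \<Rightarrow> real)"
  shows "Bochner_Integration.simple_bochner_integrable M (\<lambda>\<omega>. s \<omega> k)"
    and "Bochner_Integration.simple_bochner_integral M s k = (\<integral>\<omega>. s \<omega> k \<partial>M)"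
proof -
  show *: "Bochner_Integration.simple_bochner_integrable M (\<lambda>\<omega>. s \<omega> k)"
    using simple_bochner_integrable_compose2[of "\<lambda>x _. x k", OF _ assms assms] by simp
  have "linear (\<lambda>x::nat \<Rightarrow> real. x k)"
    by (rule linearI) (simp_all add: scaleR_fun_def)
  from simple_bochner_integral_linear[OF this assms]
  show "Bochner_Integration.simple_bochner_integral M s k = (\<integral>\<omega>. s \<omega> k \<partial>M)"
    using simple_bochner_integrable_eq_integral[OF *] by simp
qed

section \<open>Countably many norming functionals and measurability of the norm\<close>

context regular_fatou_space
begin

text \<open>For each point of a dense sequence and each \<open>m\<close>, some partial sum against a
  member of the dual ball attains the norm up to \<open>1 / (m + 1)\<close>. Such functionals are
  1-Lipschitz, so norming on a dense set is norming everywhere.\<close>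

lemma norming_sequence:
  obtains n y where "\<And>j::nat. y j \<in> kothe_dual" "\<And>j. kothe_norm (y j) \<le> 1" "y 0 = 0"
    "\<And>x c. \<lbrakk>x \<in> V; \<And>j. (\<Sum>k<n j. x k * y j k) \<le> c\<rbrakk> \<Longrightarrow> N x \<le> c"
proof -
  interpret dual: fatou_space kothe_dual kothe_norm by (rule fatou_space_kothe)
  obtain D where D: "countable D" "D \<subseteq> V" "\<And>x e. x \<in> V \<Longrightarrow> 0 < e \<Longrightarrow> \<exists>y\<in>D. N (x - y) < e"
    using countable_dense unfolding regular_part_eq by blast
  then have "D \<noteq> {}" using zero_mem zero_less_one by blast
  define d where "d = from_nat_into D"
  have dD: "d i \<in> D" for i using from_nat_into[OF \<open>D \<noteq> {}\<close>] by (simp add: d_def)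
  have "\<exists>n y. y \<in> kothe_dual \<and> kothe_norm y \<le> 1 \<and> N (d i) - inverse (real (Suc m)) < (\<Sum>k<n. d i k * y k)" for i m
  proof (rule ccontr)
    assume "\<not> ?thesis"
    then have "(\<Sum>k<n. d i k * y k) \<le> N (d i) - inverse (real (Suc m))"
      if "y \<in> kothe_dual" "kothe_norm y \<le> 1" for n y using that by (meson not_le)
    then have "N (d i) \<le> N (d i) - inverse (real (Suc m))" by (rule norming(2))
    moreover have "0 < inverse (real (Suc m))" by simp
    ultimately show False by linarith
  qed
  then obtain n0 y0 where y0: "\<And>i m. y0 i m \<in> kothe_dual" "\<And>i m. kothe_norm (y0 i m) \<le> 1"
    "\<And>i m. N (d i) - inverse (real (Suc m)) < (\<Sum>k<n0 i m. d i k * y0 i m k)" by metis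
  \<comment> \<open>Index 0 is kept for the zero functional, which will make maxima over initial
    segments nonnegative; \<open>Suc j\<close> decodes to a dense point and an accuracy.\<close>
  define n where "n = (\<lambda>j. case j of 0 \<Rightarrow> 0 | Suc j \<Rightarrow> case prod_decode j of (i, m) \<Rightarrow> n0 i m)"
  define y where "y = (\<lambda>j. case j of 0 \<Rightarrow> 0 | Suc j \<Rightarrow> case prod_decode j of (i, m) \<Rightarrow> y0 i m)"
  show thesis
  proof (rule that[of y n])
    show "y j \<in> kothe_dual" for j
      using y0(1) dual.zero_mem by (simp only: y_def split: nat.split prod.split) blast
    show "kothe_norm (y j) \<le> 1" for j
      using y0(2) dual.norm_zero zero_le_one by (simp only: y_def split: nat.split prod.split) simp
    show "y 0 = 0" by (simp only: y_def nat.case)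
    fix x c assume x: "x \<in> V" and c: "\<And>j. (\<Sum>k<n j. x k * y j k) \<le> c"
    have c0: "(\<Sum>k<n0 i m. x k * y0 i m k) \<le> c" for i m
      using c[of "Suc (prod_encode (i, m))"] by (simp add: n_def y_def)
    show "N x \<le> c"
    proof (rule field_le_epsilon)
      fix e :: real assume e: "0 < e"
      \<comment> \<open>The distance to \<open>z\<close> is spent twice, going from \<open>x\<close>
        to \<open>z\<close> and back; the last third is for the accuracy \<open>m\<close>.\<close>
      obtain z where z: "z \<in> D" "N (x - z) < e / 3" using D(3)[OF x, of "e/3"] e by auto
      obtain i where i: "z = d i" using z(1) from_nat_into_surj[OF D(1)] by (metis d_def)
      obtain m where m: "inverse (real (Suc m)) < e / 3"
        using reals_Archimedean[of "e/3"] e by auto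
      have mem: "d i \<in> V" "x - d i \<in> V" "d i - x \<in> V" using D(2) dD x diff_mem by blast+
      have "(\<Sum>k<n0 i m. (d i - x) k * y0 i m k) \<le> N (d i - x) * kothe_norm (y0 i m)"
        using kothe_upper[OF y0(1) mem(3), of i m "n0 i m"] by linarith
      also have "\<dots> \<le> N (d i - x) * 1" by (intro mult_left_mono y0(2) norm_nonneg mem)
      finally have "(\<Sum>k<n0 i m. d i k * y0 i m k) \<le> N (d i - x) + (\<Sum>k<n0 i m. x k * y0 i m k)"
        by (simp add: left_diff_distrib sum_subtractf)
      then have "N (d i) \<le> N (d i - x) + c + inverse (real (Suc m))"
        using y0(3)[of i m] c0[of i m] by linarith
      moreover have "N x \<le> N (x - d i) + N (d i)"
        using norm_add[OF mem(2,1)] by simp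
      ultimately show "N x \<le> c + e"
        using m z(2) norm_minus_commute[OF x mem(1)] unfolding i by linarith
    qed
  qed
qed

lemma functional_le_norm:
  assumes "y \<in> kothe_dual" "kothe_norm y \<le> 1" "x \<in> V"
  shows "(\<Sum>k<n. x k * y k) \<le> N x"
proof -
  have "(\<Sum>k<n. x k * y k) \<le> N x * kothe_norm y" using kothe_upper[OF assms(1,3), of n] by linarith
  also have "\<dots> \<le> N x * 1" using assms norm_nonneg by (intro mult_left_mono) auto
  finally show ?thesis by simp
qed

text \<open>That \<open>ennreal\<close> sends negative values to 0 is harmless, as norms are
  nonnegative. As a countable supremum the norm becomes measurable and accessible to monotone
  convergence.\<close>

lemma ennreal_norm_eq_SUP:
  assumes y: "\<And>j::nat. y j \<in> kothe_dual" "\<And>j. kothe_norm (y j) \<le> 1"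
    and norming: "\<And>x c. \<lbrakk>x \<in> V; \<And>j. (\<Sum>k<n j. x k * y j k) \<le> c\<rbrakk> \<Longrightarrow> N x \<le> c"
    and y_0: "y 0 = 0" and x: "x \<in> V"
  shows "ennreal (N x) = (SUP j. ennreal (\<Sum>k<n j. x k * y j k))"
proof (rule antisym)
  show "(SUP j. ennreal (\<Sum>k<n j. x k * y j k)) \<le> ennreal (N x)"
    by (intro SUP_least ennreal_leI functional_le_norm y x)
  show "ennreal (N x) \<le> (SUP j. ennreal (\<Sum>k<n j. x k * y j k))"
  proof (cases "SUP j. ennreal (\<Sum>k<n j. x k * y j k)")
    case (real r)
    have "(\<Sum>k<n j. x k * y j k) \<le> r" for j
    proof -
      have "ennreal (\<Sum>k<n j. x k * y j k) \<le> ennreal r"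
        unfolding real(2)[symmetric] by (rule SUP_upper) simp
      then show ?thesis using real(1) by (auto simp: ennreal_le_iff2)
    qed
    then have "N x \<le> r" by (rule norming[OF x])
    then show ?thesis unfolding real(2) by (rule ennreal_leI)
  next
    case top
    then show ?thesis by (simp only: top_greatest)
  qed
qed

lemma borel_measurable_norm:
  assumes h: "\<And>\<omega>. \<omega> \<in> space M \<Longrightarrow> h \<omega> \<in> V" and [measurable]: "\<And>k. (\<lambda>\<omega>. h \<omega> k) \<in> borel_measurable M"
  shows "(\<lambda>\<omega>. N (h \<omega>)) \<in> borel_measurable M"
proof -
  obtain n y where y: "\<And>j::nat. y j \<in> kothe_dual" "\<And>j. kothe_norm (y j) \<le> 1" "y 0 = 0"
    "\<And>x c. \<lbrakk>x \<in> V; \<And>j. (\<Sum>k<n j. x k * y j k) \<le> c\<rbrakk> \<Longrightarrow> N x \<le> c"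
    by (rule norming_sequence) blast
  have "(\<lambda>\<omega>. enn2real (SUP j. ennreal (\<Sum>k<n j. h \<omega> k * y j k))) \<in> borel_measurable M"
    by measurable
  also have "?this \<longleftrightarrow> ?thesis"
    by (intro measurable_cong) (simp add: ennreal_norm_eq_SUP[where n=n and y=y, OF y(1,2,4,3) h, symmetric] norm_nonneg h)
  finally show ?thesis .
qed

text \<open>Each of two errors gets \<open>e / 2\<close>. The tail tends to 0 pointwise and is
  dominated by the norm of \<open>f\<close>, so it is small in mean; the finitely many remaining
  coordinates are approximated in mean by scalar simple functions.\<close>

lemma simple_approximation:
  assumes M: "finite_measure M"
    and f: "\<And>\<omega>. \<omega> \<in> space M \<Longrightarrow> f \<omega> \<in> V" "\<And>k. integrable M (\<lambda>\<omega>. f \<omega> k)"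
    and fin: "(\<integral>\<^sup>+\<omega>. ennreal (N (f \<omega>)) \<partial>M) < \<infinity>" and e: "0 < e"
  shows "\<exists>s. simple_function_into M V s \<and> (\<integral>\<^sup>+\<omega>. ennreal (N (f \<omega> - s \<omega>)) \<partial>M) \<le> ennreal e"
proof -
  have f_meas[measurable]: "(\<lambda>\<omega>. f \<omega> k) \<in> borel_measurable M" for k using f(2) by simp
  have tail_meas: "(\<lambda>\<omega>. N (f \<omega> - trunc n (f \<omega>))) \<in> borel_measurable M" for n
  proof (rule borel_measurable_norm)
    show "(\<lambda>\<omega>. (f \<omega> - trunc n (f \<omega>)) k) \<in> borel_measurable M" for k
      by (cases "k < n") (simp_all add: trunc_def)
  qed (intro diff_mem f trunc_mem)
  have "(\<lambda>n. \<integral>\<^sup>+\<omega>. ennreal (N (f \<omega> - trunc n (f \<omega>))) \<partial>M) \<longlonglongrightarrow> (\<integral>\<^sup>+\<omega>. 0 \<partial>M)"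
  proof (rule nn_integral_dominated_convergence[OF _ _ _ _ fin])
    show "AE \<omega> in M. ennreal (N (f \<omega> - trunc n (f \<omega>))) \<le> ennreal (N (f \<omega>))" for n
      by (intro AE_I2 ennreal_leI norm_tail_le f)
    show "AE \<omega> in M. (\<lambda>n. ennreal (N (f \<omega> - trunc n (f \<omega>)))) \<longlonglongrightarrow> 0"
      unfolding ennreal_0[symmetric] by (intro AE_I2 tendsto_ennrealI regular f)
    show "(\<lambda>\<omega>. ennreal (N (f \<omega>))) \<in> borel_measurable M"
      using borel_measurable_norm[of M f] f by simp
  qed (use tail_meas in simp_all)
  then have "\<forall>\<^sub>F n in sequentially. (\<integral>\<^sup>+\<omega>. ennreal (N (f \<omega> - trunc n (f \<omega>))) \<partial>M) < ennreal (e / 2)"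
    by (rule order_tendstoD) (use e in simp)
  then obtain n where n: "(\<integral>\<^sup>+\<omega>. ennreal (N (f \<omega> - trunc n (f \<omega>))) \<partial>M) < ennreal (e / 2)"
    by (auto simp: eventually_sequentially)
  \<comment> \<open>Chosen so that \<open>N (unit_seq k) * d k\<close> does not depend on
    \<open>k\<close> and \<open>n\<close> of these terms add up to at most
    \<open>e / 2\<close>.\<close>
  define d where "d k = e / 2 / (real (Suc n) * N (unit_seq k))" for k
  have d: "0 < d k" for k using e norm_unit_pos[of k] by (simp add: d_def)
  have "\<exists>s. Bochner_Integration.simple_bochner_integrable M s
      \<and> (\<integral>\<^sup>+\<omega>. ennreal (norm (f \<omega> k - s \<omega>)) \<partial>M) < ennreal (d k)" for k
  proof -
    from f(2)[of k] obtain x where "has_bochner_integral M (\<lambda>\<omega>. f \<omega> k) x"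
      by (auto simp: integrable.simps)
    then obtain s where s: "\<And>i. Bochner_Integration.simple_bochner_integrable M (s i)"
      "(\<lambda>i. \<integral>\<^sup>+\<omega>. ennreal (norm (f \<omega> k - s i \<omega>)) \<partial>M) \<longlonglongrightarrow> 0"
      by (rule has_bochner_integral.cases) blast
    have "\<forall>\<^sub>F i in sequentially. (\<integral>\<^sup>+\<omega>. ennreal (norm (f \<omega> k - s i \<omega>)) \<partial>M) < ennreal (d k)"
      by (rule order_tendstoD(2)[OF s(2)]) (use d in simp)
    then show ?thesis using s(1) by (auto simp: eventually_sequentially)
  qed
  then obtain t where t: "\<And>k. Bochner_Integration.simple_bochner_integrable M (t k)"
    "\<And>k. (\<integral>\<^sup>+\<omega>. ennreal (norm (f \<omega> k - t k \<omega>)) \<partial>M) < ennreal (d k)" by metis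
  have simple_t: "simple_function M (t k)" for k
    using t(1)[of k] by (auto elim: simple_bochner_integrable.cases)
  have [measurable]: "t k \<in> borel_measurable M" for k
    using simple_t by (rule borel_measurable_simple_function)
  define s where "s \<omega> = trunc n (\<lambda>k. t k \<omega>)" for \<omega>
  \<comment> \<open>The sequence-valued function is assembled by adding one coordinate at a time,
    since simple functions are combined in pairs.\<close>
  have "simple_function M (\<lambda>\<omega>. trunc m (\<lambda>k. t k \<omega>))" for m
  proof (induction m)
    case 0
    have "trunc 0 x = (\<lambda>_. 0)" for x by (simp add: trunc_def)
    then show ?case by simp
  next
    case (Suc m)
    have eq: "trunc (Suc m) x = (trunc m x)(m := x m)" for x by (auto simp: trunc_def less_Suc_eq)
    show ?case unfolding eq by (rule simple_function_compose2[OF Suc simple_t])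
  qed
  then have "simple_function_into M V s"
    unfolding simple_function_into_def s_def
    using simple_bochner_integrable_finite_measure[OF M] trunc_mem by blast
  moreover have "(\<integral>\<^sup>+\<omega>. ennreal (N (f \<omega> - s \<omega>)) \<partial>M) \<le> ennreal e"
  proof -
    have pt: "N (f \<omega> - s \<omega>) \<le> N (f \<omega> - trunc n (f \<omega>)) + (\<Sum>k<n. N (unit_seq k) * norm (f \<omega> k - t k \<omega>))"
      if "\<omega> \<in> space M" for \<omega>
    proof -
      have "trunc n (f \<omega>) - s \<omega> = trunc n (\<lambda>k. f \<omega> k - t k \<omega>)"
        by (auto simp: s_def trunc_def)
      then have "N (trunc n (f \<omega>) - s \<omega>) \<le> (\<Sum>k<n. \<bar>f \<omega> k - t k \<omega>\<bar> * N (unit_seq k))"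
        using norm_trunc_sum_le[of n "\<lambda>k. f \<omega> k - t k \<omega>"] by simp
      moreover have "N (f \<omega> - s \<omega>) \<le> N (f \<omega> - trunc n (f \<omega>)) + N (trunc n (f \<omega>) - s \<omega>)"
        unfolding s_def by (intro norm_diff_triangle f that trunc_mem)
      ultimately show ?thesis by (simp add: mult.commute)
    qed
    have "(\<Sum>k<n. ennreal (N (unit_seq k)) * ennreal (d k)) = (\<Sum>k<n. ennreal (e / 2 / real (Suc n)))"
    proof (intro sum.cong refl)
      fix k
      have "N (unit_seq k) * d k = e / 2 / real (Suc n)" using norm_unit_pos[of k] by (simp add: d_def)
      then show "ennreal (N (unit_seq k)) * ennreal (d k) = ennreal (e / 2 / real (Suc n))"
        using norm_unit_pos[of k] d[of k] by (metis ennreal_mult less_imp_le)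
    qed
    also have "\<dots> = ennreal (\<Sum>k<n. e / 2 / real (Suc n))" using e by (intro sum_ennreal) simp
    also have "\<dots> \<le> ennreal (e / 2)" using e by (intro ennreal_leI) (simp add: field_simps)
    finally have d_sum: "(\<Sum>k<n. ennreal (N (unit_seq k)) * ennreal (d k)) \<le> ennreal (e / 2)" .
    have "(\<integral>\<^sup>+\<omega>. ennreal (N (f \<omega> - s \<omega>)) \<partial>M)
        \<le> (\<integral>\<^sup>+\<omega>. ennreal (N (f \<omega> - trunc n (f \<omega>)))
            + (\<Sum>k<n. ennreal (N (unit_seq k)) * ennreal (norm (f \<omega> k - t k \<omega>))) \<partial>M)"
    proof (rule nn_integral_mono)
      fix \<omega> assume \<omega>: "\<omega> \<in> space M"
      have "ennreal (N (f \<omega> - s \<omega>))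
          \<le> ennreal (N (f \<omega> - trunc n (f \<omega>)) + (\<Sum>k<n. N (unit_seq k) * norm (f \<omega> k - t k \<omega>)))"
        by (intro ennreal_leI pt \<omega>)
      also have "\<dots> = ennreal (N (f \<omega> - trunc n (f \<omega>)))
          + (\<Sum>k<n. ennreal (N (unit_seq k)) * ennreal (norm (f \<omega> k - t k \<omega>)))"
        using norm_nonneg[OF diff_mem[OF f(1)[OF \<omega>] trunc_mem], of n "f \<omega>"] norm_unit_pos
        by (subst ennreal_plus)
           (auto simp: sum_nonneg less_imp_le ennreal_mult simp flip: sum_ennreal)
      finally show "ennreal (N (f \<omega> - s \<omega>)) \<le> ennreal (N (f \<omega> - trunc n (f \<omega>)))
          + (\<Sum>k<n. ennreal (N (unit_seq k)) * ennreal (norm (f \<omega> k - t k \<omega>)))" .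
    qed
    also have "\<dots> = (\<integral>\<^sup>+\<omega>. ennreal (N (f \<omega> - trunc n (f \<omega>))) \<partial>M)
        + (\<Sum>k<n. ennreal (N (unit_seq k)) * (\<integral>\<^sup>+\<omega>. ennreal (norm (f \<omega> k - t k \<omega>)) \<partial>M))"
      using tail_meas by (simp add: nn_integral_add nn_integral_sum nn_integral_cmult)
    also have "\<dots> \<le> ennreal (e / 2) + (\<Sum>k<n. ennreal (N (unit_seq k)) * ennreal (d k))"
      by (intro add_mono sum_mono mult_left_mono less_imp_le[OF n] less_imp_le[OF t(2)]) simp
    also have "\<dots> \<le> ennreal (e / 2) + ennreal (e / 2)" by (intro add_left_mono d_sum)
    also have "ennreal (e / 2) + ennreal (e / 2) = ennreal e" using e by (simp flip: ennreal_plus)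
    finally show ?thesis .
  qed
  ultimately show ?thesis by blast
qed

end

section \<open>Bochner integrals from coordinatewise integrals\<close>

context regular_fatou_space
begin

text \<open>Tested against a functional of finitely many coordinates, the difference of the
  integrals is a scalar integral of something below \<open>N (f \<omega> - s \<omega>)\<close>;
  \<open>norming\<close> turns this into the norm bound and into membership.\<close>

lemma norm_integral_le:
  assumes s: "simple_function_into M V s" and M: "finite_measure M"
    and f: "\<And>\<omega>. \<omega> \<in> space M \<Longrightarrow> f \<omega> \<in> V" "\<And>k. integrable M (\<lambda>\<omega>. f \<omega> k)"
    and I: "I \<in> V" "\<And>k. (\<integral>\<omega>. f \<omega> k \<partial>M) = I k"
    and e: "0 \<le> e" and le: "(\<integral>\<^sup>+\<omega>. ennreal (N (f \<omega> - s \<omega>)) \<partial>M) \<le> ennreal e"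
  shows "Bochner_Integration.simple_bochner_integral M s \<in> V"
    "N (Bochner_Integration.simple_bochner_integral M s - I) \<le> e"
proof -
  let ?S = "Bochner_Integration.simple_bochner_integral M s"
  have sb: "Bochner_Integration.simple_bochner_integrable M s" and sV: "\<omega> \<in> space M \<Longrightarrow> s \<omega> \<in> V" for \<omega>
    using s by (auto simp: simple_function_into_def)
  note s_int = integrableI_simple_bochner_integrable[OF simple_bochner_integral_apply(1)[OF sb]]
  have [measurable]: "(\<lambda>\<omega>. f \<omega> k) \<in> borel_measurable M" "(\<lambda>\<omega>. s \<omega> k) \<in> borel_measurable M" for k
    using f(2) s_int by auto
  have meas: "(\<lambda>\<omega>. N (f \<omega> - s \<omega>)) \<in> borel_measurable M"
    by (rule borel_measurable_norm) (simp_all add: f sV diff_mem)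
  have nn: "0 \<le> N (f \<omega> - s \<omega>)" if "\<omega> \<in> space M" for \<omega>
    using that by (intro norm_nonneg diff_mem f sV)
  have int_N: "integrable M (\<lambda>\<omega>. N (f \<omega> - s \<omega>))"
  proof (rule integrableI_nonneg[OF meas])
    show "AE \<omega> in M. 0 \<le> N (f \<omega> - s \<omega>)" by (intro AE_I2 nn)
    show "(\<integral>\<^sup>+\<omega>. ennreal (N (f \<omega> - s \<omega>)) \<partial>M) < \<infinity>"
      using le by (rule le_less_trans) simp
  qed
  have "ennreal (\<integral>\<omega>. N (f \<omega> - s \<omega>) \<partial>M) \<le> ennreal e"
    using le nn_integral_eq_integral[OF int_N] nn by (simp add: AE_I2)
  then have int_le: "(\<integral>\<omega>. N (f \<omega> - s \<omega>) \<partial>M) \<le> e" using e by simp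
  have functional: "(\<Sum>k<n. (?S - I) k * y k) \<le> e" if y: "y \<in> kothe_dual" "kothe_norm y \<le> 1" for n y
  proof -
    have "(\<Sum>k<n. (?S - I) k * y k) = (\<Sum>k<n. (\<integral>\<omega>. (s \<omega> k - f \<omega> k) * y k \<partial>M))"
      using s_int f(2) by (intro sum.cong refl) (simp add: simple_bochner_integral_apply(2)[OF sb] I(2))
    also have "\<dots> = (\<integral>\<omega>. (\<Sum>k<n. (s \<omega> k - f \<omega> k) * y k) \<partial>M)"
      using s_int f(2) by (intro Bochner_Integration.integral_sum[symmetric]) auto
    also have "\<dots> \<le> (\<integral>\<omega>. N (f \<omega> - s \<omega>) \<partial>M)"
    proof (rule integral_mono[OF _ int_N])
      show "integrable M (\<lambda>\<omega>. \<Sum>k<n. (s \<omega> k - f \<omega> k) * y k)" using s_int f(2) by auto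
      fix \<omega> assume \<omega>: "\<omega> \<in> space M"
      have "(\<Sum>k<n. (s \<omega> - f \<omega>) k * y k) \<le> N (s \<omega> - f \<omega>)"
        by (intro functional_le_norm y diff_mem sV f \<omega>)
      then show "(\<Sum>k<n. (s \<omega> k - f \<omega> k) * y k) \<le> N (f \<omega> - s \<omega>)"
        using norm_minus_commute[OF sV[OF \<omega>] f(1)[OF \<omega>]] by (simp only: fun_diff_def)
    qed
    also note int_le
    finally show ?thesis .
  qed
  have "?S - I \<in> V" "N (?S - I) \<le> e"
    using norming[of "?S - I" e] functional by blast+
  then show "N (?S - I) \<le> e" "?S \<in> V" using add_mem[of "?S - I" I] I(1) by simp_all
qed

lemma has_bochner_integral_onI:
  assumes M: "finite_measure M"
    and f: "\<And>\<omega>. \<omega> \<in> space M \<Longrightarrow> f \<omega> \<in> V" "\<And>k. integrable M (\<lambda>\<omega>. f \<omega> k)"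
    and fin: "(\<integral>\<^sup>+\<omega>. ennreal (N (f \<omega>)) \<partial>M) < \<infinity>"
    and I: "I \<in> V" "\<And>k. (\<integral>\<omega>. f \<omega> k \<partial>M) = I k"
  shows "has_bochner_integral_on M V N f I"
proof -
  \<comment> \<open>Summable errors make the series of \<open>N (f \<omega> - s i \<omega>)\<close>
    integrable, so one sequence converges both in mean and almost everywhere.\<close>
  have "\<exists>s. simple_function_into M V s
      \<and> (\<integral>\<^sup>+\<omega>. ennreal (N (f \<omega> - s \<omega>)) \<partial>M) \<le> ennreal ((1 / 2) ^ i)" for i :: nat
    by (rule simple_approximation[OF M f fin]) simp_all
  then obtain s where s: "\<And>i::nat. simple_function_into M V (s i)"
    "\<And>i. (\<integral>\<^sup>+\<omega>. ennreal (N (f \<omega> - s i \<omega>)) \<partial>M) \<le> ennreal ((1 / 2) ^ i)" by metis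
  have sb: "Bochner_Integration.simple_bochner_integrable M (s i)"
    and sV: "\<omega> \<in> space M \<Longrightarrow> s i \<omega> \<in> V" for i \<omega>
    using s(1)[of i] by (auto simp: simple_function_into_def)
  have [measurable]: "(\<lambda>\<omega>. f \<omega> k) \<in> borel_measurable M" "(\<lambda>\<omega>. s i \<omega> k) \<in> borel_measurable M" for i k
    using f(2) integrableI_simple_bochner_integrable[OF simple_bochner_integral_apply(1)[OF sb]] by auto
  have meas[measurable]: "(\<lambda>\<omega>. N (f \<omega> - s i \<omega>)) \<in> borel_measurable M" for i
    by (rule borel_measurable_norm) (simp_all add: f sV diff_mem)
  have pow: "(\<lambda>i. (1 / 2) ^ i :: real) \<longlonglongrightarrow> 0" by (rule LIMSEQ_power_zero) simp
  have "(\<integral>\<^sup>+\<omega>. (\<Sum>i. ennreal (N (f \<omega> - s i \<omega>))) \<partial>M)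
      = (\<Sum>i. \<integral>\<^sup>+\<omega>. ennreal (N (f \<omega> - s i \<omega>)) \<partial>M)"
    by (rule nn_integral_suminf) simp
  also have "\<dots> \<le> (\<Sum>i. ennreal ((1 / 2) ^ i))" by (intro suminf_le s(2) summableI)
  also have "\<dots> = ennreal 2"
    using geometric_sums[of "1 / 2 :: real"] by (intro suminf_ennreal_eq) auto
  finally have "(\<integral>\<^sup>+\<omega>. (\<Sum>i. ennreal (N (f \<omega> - s i \<omega>))) \<partial>M) \<noteq> \<infinity>"
    by (auto simp: top_unique)
  then have "AE \<omega> in M. (\<Sum>i. ennreal (N (f \<omega> - s i \<omega>))) \<noteq> \<infinity>"
    by (intro nn_integral_PInf_AE) simp_all
  then have "AE \<omega> in M. (\<lambda>i. N (s i \<omega> - f \<omega>)) \<longlonglongrightarrow> 0"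
  proof (rule AE_mp, intro AE_I2 impI)
    fix \<omega> assume \<omega>: "\<omega> \<in> space M" and "(\<Sum>i. ennreal (N (f \<omega> - s i \<omega>))) \<noteq> \<infinity>"
    then have "summable (\<lambda>i. N (f \<omega> - s i \<omega>))"
      by (intro summable_suminf_not_top norm_nonneg diff_mem f sV) auto
    then have "(\<lambda>i. N (f \<omega> - s i \<omega>)) \<longlonglongrightarrow> 0" by (rule summable_LIMSEQ_zero)
    then show "(\<lambda>i. N (s i \<omega> - f \<omega>)) \<longlonglongrightarrow> 0"
      using norm_minus_commute[OF f(1)[OF \<omega>] sV[OF \<omega>]] by simp
  qed
  then have "strongly_measurable_on M V N f"
    unfolding strongly_measurable_on_def using f(1) s(1) by blast
  moreover have "(\<lambda>i. \<integral>\<^sup>+\<omega>. ennreal (N (f \<omega> - s i \<omega>)) \<partial>M) \<longlonglongrightarrow> 0"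
  proof (rule tendsto_sandwich[OF _ _ tendsto_const])
    show "(\<lambda>i. ennreal ((1 / 2) ^ i)) \<longlonglongrightarrow> 0"
      using tendsto_ennrealI[OF pow] by simp
    show "\<forall>\<^sub>F i in sequentially. (\<integral>\<^sup>+\<omega>. ennreal (N (f \<omega> - s i \<omega>)) \<partial>M) \<le> ennreal ((1 / 2) ^ i)"
      by (intro always_eventually allI s(2))
  qed simp
  moreover have "(\<lambda>i. N (Bochner_Integration.simple_bochner_integral M (s i) - I)) \<longlonglongrightarrow> 0"
  proof (rule tendsto_sandwich[OF _ _ tendsto_const pow])
    note * = norm_integral_le[OF s(1) M f I _ s(2)]
    show "\<forall>\<^sub>F i in sequentially. N (Bochner_Integration.simple_bochner_integral M (s i) - I) \<le> (1 / 2) ^ i"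
      by (intro always_eventually allI *(2)) simp_all
    show "\<forall>\<^sub>F i in sequentially. 0 \<le> N (Bochner_Integration.simple_bochner_integral M (s i) - I)"
      by (intro always_eventually allI norm_nonneg diff_mem *(1) I(1)) simp_all
  qed
  ultimately show ?thesis
    unfolding has_bochner_integral_on_def using I(1) s(1) by blast
qed

text \<open>Bounded variation speaks of partitions of the whole space into nonempty sets. So the
  complement is added and the empty set dropped; equal sets at different indices of a disjoint
  family are empty and contribute 0.\<close>

lemma variation_disjoint_le:
  assumes C: "\<And>P. finite P \<Longrightarrow> P \<subseteq> sets M \<Longrightarrow> partition_on (space M) P \<Longrightarrow> (\<Sum>A\<in>P. N (G A)) \<le> C"
    and G: "\<And>A. A \<in> sets M \<Longrightarrow> G A \<in> V" "G {} = 0"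
    and A: "finite J" "\<And>j. j \<in> J \<Longrightarrow> A j \<in> sets M" "disjoint_family_on A J"
  shows "(\<Sum>j\<in>J. N (G (A j))) \<le> C"
proof -
  define U where "U = (\<Union>j\<in>J. A j)"
  define P where "P = insert (space M - U) (A ` J) - {{}}"
  have U: "U \<in> sets M" "U \<subseteq> space M"
    using A sets.sets_into_space by (auto simp: U_def intro!: sets.finite_UN)
  have P: "finite P" "P \<subseteq> sets M" using A U by (auto simp: P_def)
  have "partition_on (space M) P"
    unfolding partition_on_def
  proof (intro conjI)
    have "\<Union>P = (space M - U) \<union> (\<Union>j\<in>J. A j)" unfolding P_def by blast
    then show "\<Union>P = space M" using U(2) unfolding U_def by blast
    have disj: "B = A' \<or> B \<inter> A' = {}" if "B \<in> A ` J" "A' \<in> A ` J" for B A'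
    proof -
      from that obtain i j where "i \<in> J" "j \<in> J" "B = A i" "A' = A j" by blast
      then show ?thesis using disjoint_family_onD[OF A(3), of i j] by (cases "i = j") simp_all
    qed
    have "B \<inter> (space M - U) = {}" if "B \<in> A ` J" for B using that by (auto simp: U_def)
    then have "B \<inter> A' = {}" if "B \<in> P" "A' \<in> P" "B \<noteq> A'" for B A'
      using that disj unfolding P_def by (metis DiffD1 Int_commute insertE)
    then show "disjoint P" by (auto intro: disjointI)
    show "{} \<notin> P" by (simp add: P_def)
  qed
  then have le: "(\<Sum>A\<in>P. N (G A)) \<le> C" using C P by blast
  have "(\<Sum>j\<in>J. N (G (A j))) = (\<Sum>B\<in>A ` J. N (G B))"
  proof (rule sum.reindex_nontrivial[OF A(1), symmetric, unfolded comp_def])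
    fix i j assume "i \<in> J" "j \<in> J" "i \<noteq> j" "A i = A j"
    then have "A i = {}" using A(3) by (auto simp: disjoint_family_on_def)
    then show "N (G (A i)) = 0" by (simp only: G(2) norm_zero)
  qed
  also have "\<dots> = (\<Sum>B\<in>A ` J - {{}}. N (G B))"
  proof (rule sum.mono_neutral_right)
    show "\<forall>B\<in>A ` J - (A ` J - {{}}). N (G B) = 0" using G(2) norm_zero by (metis DiffD2 DiffI DiffD1 singletonD)
  qed (use A(1) in auto)
  also have "\<dots> \<le> (\<Sum>B\<in>P. N (G B))"
    using P G by (intro sum_mono2) (auto simp: P_def intro!: norm_nonneg)
  finally show ?thesis using le by simp
qed

end

section \<open>The density of a vector measure\<close>

context regular_fatou_space
begin

text \<open>
  Partition the space according to which of the first \<open>m\<close> functionals is largest at the point: on each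
  cell the integral of the maximum is a functional applied to the value of \<open>G\<close> on the cell, so the
  variation of \<open>G\<close> bounds the integral of the norm of the coordinatewise density.
\<close>

lemma nn_integral_norm_density_le:
  assumes M: "finite_measure M" and G: "\<And>A. A \<in> sets M \<Longrightarrow> G A \<in> V" "G {} = 0"
    and C: "\<And>P. finite P \<Longrightarrow> P \<subseteq> sets M \<Longrightarrow> partition_on (space M) P \<Longrightarrow> (\<Sum>A\<in>P. N (G A)) \<le> C"
    and g: "\<And>k. integrable M (g k)"
      "\<And>k A. A \<in> sets M \<Longrightarrow> (\<integral>\<omega>. indicator A \<omega> * g k \<omega> \<partial>M) = G A k"
  shows "(\<integral>\<^sup>+\<omega>. ennreal (N (trunc l (\<lambda>k. g k \<omega>))) \<partial>M) \<le> ennreal C"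
proof -
  interpret finite_measure M by (rule M)
  obtain n y where y: "\<And>j::nat. y j \<in> kothe_dual" "\<And>j. kothe_norm (y j) \<le> 1" "y 0 = 0"
    "\<And>x c. \<lbrakk>x \<in> V; \<And>j. (\<Sum>k<n j. x k * y j k) \<le> c\<rbrakk> \<Longrightarrow> N x \<le> c"
    by (rule norming_sequence) blast
  \<comment> \<open>The sequence of densities is not yet known to lie in \<open>V\<close>; its
    truncations do.\<close>
  define u where "u = (\<lambda>j \<omega>. \<Sum>k<n j. trunc l (\<lambda>k. g k \<omega>) k * y j k)"
  have u0: "u 0 \<omega> = 0" for \<omega> by (simp add: u_def y(3))
  have trunc_int: "integrable M (\<lambda>\<omega>. trunc l (\<lambda>k. g k \<omega>) k)" for k
    by (cases "k < l") (simp_all add: trunc_def g)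
  then have u_int: "integrable M (u j)" for j unfolding u_def by auto
  then have [measurable]: "u j \<in> borel_measurable M" for j by auto
  have set_int: "integrable M (\<lambda>\<omega>. indicator A \<omega> * h \<omega>)" if "A \<in> sets M" "integrable M h" for A and h :: "_ \<Rightarrow> real"
    using integrable_mult_indicator[OF that] by simp
  have cell: "(\<integral>\<omega>. indicator A \<omega> * u j \<omega> \<partial>M) \<le> N (G A)" if A: "A \<in> sets M" for A j
  proof -
    have coord: "(\<integral>\<omega>. indicator A \<omega> * trunc l (\<lambda>k. g k \<omega>) k \<partial>M) = trunc l (G A) k" for k
      using g(2)[OF A] by (cases "k < l") (simp_all add: trunc_def)
    have "(\<integral>\<omega>. indicator A \<omega> * u j \<omega> \<partial>M)
        = (\<integral>\<omega>. (\<Sum>k<n j. (indicator A \<omega> * trunc l (\<lambda>k. g k \<omega>) k) * y j k) \<partial>M)"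
      by (simp add: u_def sum_distrib_left mult.assoc)
    also have "\<dots> = (\<Sum>k<n j. trunc l (G A) k * y j k)"
      using set_int[OF A trunc_int] by (simp add: coord)
    also have "\<dots> \<le> N (trunc l (G A))" by (rule functional_le_norm[OF y(1,2) trunc_mem])
    also have "\<dots> \<le> N (G A)" by (rule norm_trunc_le[OF G(1)[OF A]])
    finally show ?thesis .
  qed
  have max_le: "(\<integral>\<^sup>+\<omega>. (SUP j\<in>{..m}. ennreal (u j \<omega>)) \<partial>M) \<le> ennreal C" for m
  proof -
    \<comment> \<open>Ties go to the smallest index, which makes the cells up to \<open>m\<close>
      disjoint. Because index 0 carries the zero functional, \<open>u j\<close> is nonnegative on
      its cell.\<close>
    define A where "A j = {\<omega>\<in>space M. (\<forall>i\<in>{..m}. u i \<omega> \<le> u j \<omega>) \<and> (\<forall>i\<in>{..<j}. u i \<omega> < u j \<omega>)}" for j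
    have A_sets: "A j \<in> sets M" for j unfolding A_def by measurable
    have u_nonneg: "0 \<le> u j \<omega>" if "\<omega> \<in> A j" for j \<omega>
    proof -
      have "\<forall>i\<in>{..m}. u i \<omega> \<le> u j \<omega>" using that unfolding A_def by blast
      then have "u 0 \<omega> \<le> u j \<omega>" by simp
      then show ?thesis by (simp only: u0)
    qed
    have "(SUP j\<in>{..m}. ennreal (u j \<omega>)) \<le> (\<Sum>j\<le>m. ennreal (indicator (A j) \<omega> * u j \<omega>))"
      if \<omega>: "\<omega> \<in> space M" for \<omega>
    proof -
      define Q where "Q j \<longleftrightarrow> j \<le> m \<and> (\<forall>i\<in>{..m}. u i \<omega> \<le> u j \<omega>)" for j
      have "Max ((\<lambda>j. u j \<omega>) ` {..m}) \<in> (\<lambda>j. u j \<omega>) ` {..m}" by (rule Max_in) auto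
      then obtain j0 where "j0 \<in> {..m}" "Max ((\<lambda>j. u j \<omega>) ` {..m}) = u j0 \<omega>"
        unfolding image_iff by blast
      moreover have "u i \<omega> \<le> Max ((\<lambda>j. u j \<omega>) ` {..m})" if "i \<le> m" for i using that by (intro Max_ge) auto
      ultimately have "Q j0" by (auto simp: Q_def)
      define j where "j = (LEAST j. Q j)"
      have Qj: "Q j" unfolding j_def by (rule LeastI[of Q, OF \<open>Q j0\<close>])
      have "u i \<omega> < u j \<omega>" if "i < j" for i
      proof (rule ccontr)
        assume "\<not> u i \<omega> < u j \<omega>"
        then have "Q i" using Qj that unfolding Q_def by force
        then have "j \<le> i" unfolding j_def by (rule Least_le)
        then show False using that by simp
      qed
      then have "\<omega> \<in> A j" using \<omega> Qj by (auto simp: A_def Q_def)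
      have "(SUP j\<in>{..m}. ennreal (u j \<omega>)) \<le> ennreal (u j \<omega>)"
        using Qj by (intro SUP_least ennreal_leI) (auto simp: Q_def)
      also have "\<dots> = ennreal (indicator (A j) \<omega> * u j \<omega>)" using \<open>\<omega> \<in> A j\<close> by simp
      also have "\<dots> \<le> (\<Sum>j\<le>m. ennreal (indicator (A j) \<omega> * u j \<omega>))"
        using Qj by (intro member_le_sum) (auto simp: Q_def)
      finally show ?thesis .
    qed
    then have "(\<integral>\<^sup>+\<omega>. (SUP j\<in>{..m}. ennreal (u j \<omega>)) \<partial>M)
        \<le> (\<integral>\<^sup>+\<omega>. (\<Sum>j\<le>m. ennreal (indicator (A j) \<omega> * u j \<omega>)) \<partial>M)"
      by (rule nn_integral_mono)
    also have "\<dots> = (\<Sum>j\<le>m. \<integral>\<^sup>+\<omega>. ennreal (indicator (A j) \<omega> * u j \<omega>) \<partial>M)"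
      by (intro nn_integral_sum measurable_compose[OF borel_measurable_integrable measurable_ennreal]
          set_int A_sets u_int)
    also have "\<dots> = (\<Sum>j\<le>m. ennreal (\<integral>\<omega>. indicator (A j) \<omega> * u j \<omega> \<partial>M))"
    proof (intro sum.cong refl nn_integral_eq_integral AE_I2)
      show "0 \<le> indicator (A j) \<omega> * u j \<omega>" for j \<omega>
        using u_nonneg[of \<omega> j] by (simp add: indicator_def)
    qed (use set_int[OF A_sets u_int] in auto)
    also have "\<dots> \<le> (\<Sum>j\<le>m. ennreal (N (G (A j))))"
      by (intro sum_mono ennreal_leI cell A_sets)
    also have "\<dots> = ennreal (\<Sum>j\<le>m. N (G (A j)))"
      by (intro sum_ennreal norm_nonneg G A_sets)
    also have "\<dots> \<le> ennreal C"
    proof (intro ennreal_leI variation_disjoint_le[OF C G])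
      show "disjoint_family_on A {..m}"
        unfolding disjoint_family_on_def
      proof (intro ballI impI)
        have less: "A i \<inter> A j = {}" if "i < j" "j \<le> m" for i j
        proof -
          have "u j \<omega> \<le> u i \<omega>" if "\<omega> \<in> A i" for \<omega>
            using that \<open>j \<le> m\<close> unfolding A_def by simp
          moreover have "u i \<omega> < u j \<omega>" if "\<omega> \<in> A j" for \<omega>
            using that \<open>i < j\<close> unfolding A_def by simp
          ultimately show ?thesis by (meson disjoint_iff not_le)
        qed
        fix i j assume "i \<in> {..m}" "j \<in> {..m}" "i \<noteq> j"
        then show "A i \<inter> A j = {}"
          using less[of i j] less[of j i] by (cases "i < j") (simp_all add: Int_commute)
      qed
    qed (use A_sets in auto)
    finally show ?thesis .
  qed
  have "(\<integral>\<^sup>+\<omega>. ennreal (N (trunc l (\<lambda>k. g k \<omega>))) \<partial>M) = (\<integral>\<^sup>+\<omega>. (SUP m. SUP j\<in>{..m}. ennreal (u j \<omega>)) \<partial>M)"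
  proof (rule nn_integral_cong)
    fix \<omega>
    have "ennreal (N (trunc l (\<lambda>k. g k \<omega>))) = (SUP j. ennreal (u j \<omega>))"
      unfolding u_def by (rule ennreal_norm_eq_SUP[where n=n and y=y, OF y(1,2,4,3) trunc_mem])
    \<comment> \<open>Maxima over initial segments increase with \<open>m\<close>, as monotone
      convergence requires.\<close>
    also have "\<dots> = (SUP m. SUP j\<in>{..m}. ennreal (u j \<omega>))"
    proof (rule antisym)
      show "(SUP j. ennreal (u j \<omega>)) \<le> (SUP m. SUP j\<in>{..m}. ennreal (u j \<omega>))"
        by (intro SUP_least) (metis SUP_upper SUP_upper2 UNIV_I atMost_iff order_refl)
      show "(SUP m. SUP j\<in>{..m}. ennreal (u j \<omega>)) \<le> (SUP j. ennreal (u j \<omega>))"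
        by (intro SUP_least SUP_upper UNIV_I)
    qed
    finally show "ennreal (N (trunc l (\<lambda>k. g k \<omega>))) = (SUP m. SUP j\<in>{..m}. ennreal (u j \<omega>))" .
  qed
  also have "\<dots> = (SUP m. \<integral>\<^sup>+\<omega>. (SUP j\<in>{..m}. ennreal (u j \<omega>)) \<partial>M)"
  proof (rule nn_integral_monotone_convergence_SUP)
    show "incseq (\<lambda>m \<omega>. SUP j\<in>{..m}. ennreal (u j \<omega>))"
      by (auto simp: incseq_def le_fun_def intro!: SUP_subset_mono)
    show "(\<lambda>\<omega>. SUP j\<in>{..m}. ennreal (u j \<omega>)) \<in> borel_measurable M" for m
      by (rule borel_measurable_SUP) auto
  qed
  also have "\<dots> \<le> ennreal C" by (intro SUP_least max_le)
  finally show ?thesis .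
qed

text \<open>Each coordinate of \<open>G\<close> is a bounded charge with a scalar density. The
  supremum of the norms of the truncated densities is integrable, so at almost every point
  \<open>trunc_bounded\<close> places the sequence of densities in \<open>V\<close>.\<close>

lemma vector_measure_density:
  assumes M: "finite_measure (M :: 'a measure)" and G: "vector_measure_on M V N G"
    and C: "\<And>P. finite P \<Longrightarrow> P \<subseteq> sets M \<Longrightarrow> partition_on (space M) P \<Longrightarrow> (\<Sum>A\<in>P. N (G A)) \<le> C"
    and null: "\<And>A. A \<in> null_sets M \<Longrightarrow> G A = 0"
  shows "\<exists>g. \<forall>A\<in>sets M. has_bochner_integral_on M V N (\<lambda>\<omega>. indicator A \<omega> *\<^sub>R g \<omega>) (G A)"
proof -
  interpret finite_measure M by (rule M)
  have GV: "A \<in> sets M \<Longrightarrow> G A \<in> V" for A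
    using G by (simp add: vector_measure_on_def)
  have G_sums: "(\<lambda>n. N ((\<Sum>i<n. G (A i)) - G (\<Union>i. A i))) \<longlonglongrightarrow> 0"
    if "range A \<subseteq> sets M" "disjoint_family A" for A :: "nat \<Rightarrow> 'a set"
    using G that by (simp add: vector_measure_on_def)
  have G_empty: "G {} = 0" by (rule null) simp
  have G_le: "N (G A) \<le> C" if A: "A \<in> sets M" for A
    using variation_disjoint_le[where J="{0::nat}" and A="\<lambda>_. A", OF C GV G_empty] A
    by (simp add: disjoint_family_on_def)
  have "\<exists>f. integrable M f \<and> (\<forall>A\<in>sets M. (\<integral>\<omega>. indicator A \<omega> * f \<omega> \<partial>M) = G A k)" for k
  proof -
    interpret bounded_charge M "\<lambda>A. G A k" "C / N (unit_seq k)"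
    proof
      fix A :: "nat \<Rightarrow> 'a set" assume A: "range A \<subseteq> sets M" "disjoint_family A"
      have GA: "G (A i) \<in> V" for i using A(1) GV by auto
      have "(\<lambda>n. (\<Sum>i<n. G (A i)) k) \<longlonglongrightarrow> G (\<Union>i. A i) k"
      proof (rule tendsto_coordinate)
        show "(\<Sum>i<n. G (A i)) \<in> V" for n using norm_sum[of "{..<n}" "\<lambda>i. G (A i)"] GA by blast
        show "G (\<Union>i. A i) \<in> V" using A(1) by (intro GV sets.countable_UN) auto
        show "(\<lambda>n. N ((\<Sum>i<n. G (A i)) - G (\<Union>i. A i))) \<longlonglongrightarrow> 0" by (rule G_sums[OF A])
      qed
      then show "(\<lambda>n. \<Sum>i<n. G (A i) k) \<longlonglongrightarrow> G (\<Union>i. A i) k" unfolding sum_fun_apply .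
    next
      fix A assume A: "A \<in> sets M"
      show "\<bar>G A k\<bar> \<le> C / N (unit_seq k)"
        using coordinate_le[OF GV[OF A], of k] G_le[OF A] norm_unit_pos[of k] by (simp add: field_simps)
    next
      fix A assume "A \<in> null_sets M"
      then show "G A k = 0" by (simp add: null)
    qed
    show ?thesis by (rule charge_density) blast
  qed
  then obtain g where g: "\<And>k. integrable M (g k)"
    "\<And>k A. A \<in> sets M \<Longrightarrow> (\<integral>\<omega>. indicator A \<omega> * g k \<omega> \<partial>M) = G A k" by metis
  have g_meas[measurable]: "g k \<in> borel_measurable M" for k using g(1) by auto
  define H where "H \<omega> = (SUP l. ennreal (N (trunc l (\<lambda>k. g k \<omega>))))" for \<omega>
  have trunc_meas[measurable]: "(\<lambda>\<omega>. N (trunc l (\<lambda>k. g k \<omega>))) \<in> borel_measurable M" for l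
  proof (rule borel_measurable_norm)
    show "(\<lambda>\<omega>. trunc l (\<lambda>k. g k \<omega>) k) \<in> borel_measurable M" for k
      by (cases "k < l") (simp_all add: trunc_def)
  qed (rule trunc_mem)
  have H_meas[measurable]: "H \<in> borel_measurable M" unfolding H_def by measurable
  have "(\<integral>\<^sup>+\<omega>. H \<omega> \<partial>M) = (SUP l. \<integral>\<^sup>+\<omega>. ennreal (N (trunc l (\<lambda>k. g k \<omega>))) \<partial>M)"
    unfolding H_def
    by (rule nn_integral_monotone_convergence_SUP)
       (auto simp: incseq_def le_fun_def intro!: ennreal_leI norm_trunc_mono)
  also have "\<dots> \<le> ennreal C"
    by (intro SUP_least nn_integral_norm_density_le[OF M GV G_empty C g])
  finally have H_int: "(\<integral>\<^sup>+\<omega>. H \<omega> \<partial>M) < \<infinity>" by (rule le_less_trans) simp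
  then have H_fin: "AE \<omega> in M. H \<omega> \<noteq> \<infinity>" by (intro nn_integral_PInf_AE H_meas) simp
  \<comment> \<open>The points where the norms of the truncations are unbounded form a null set; the
    value 0 there keeps all of \<open>f\<close> in \<open>V\<close>.\<close>
  define f where "f \<omega> = (if H \<omega> = \<infinity> then (\<lambda>_. 0) else (\<lambda>k. g k \<omega>))" for \<omega>
  have f: "f \<omega> \<in> V \<and> ennreal (N (f \<omega>)) \<le> H \<omega>" for \<omega>
  proof (cases "H \<omega> = \<infinity>")
    case True
    then show ?thesis using zero_mem by (simp add: f_def zero_fun_def)
  next
    case False
    then have H: "H \<omega> = ennreal (enn2real (H \<omega>))" by (simp add: less_top)
    have "N (trunc l (\<lambda>k. g k \<omega>)) \<le> enn2real (H \<omega>)" for l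
    proof -
      have "ennreal (N (trunc l (\<lambda>k. g k \<omega>))) \<le> H \<omega>" unfolding H_def by (rule SUP_upper) simp
      then show ?thesis using H by (metis enn2real_nonneg ennreal_le_iff)
    qed
    then have "(\<lambda>k. g k \<omega>) \<in> V \<and> N (\<lambda>k. g k \<omega>) \<le> enn2real (H \<omega>)" by (rule trunc_bounded)
    then show ?thesis using False H ennreal_leI[of "N (\<lambda>k. g k \<omega>)" "enn2real (H \<omega>)"] by (simp add: f_def)
  qed
  have f_AE: "AE \<omega> in M. f \<omega> k = g k \<omega>" for k using H_fin by eventually_elim (simp add: f_def)
  have f_meas[measurable]: "(\<lambda>\<omega>. f \<omega> k) \<in> borel_measurable M" for k
  proof -
    have "(\<lambda>\<omega>. f \<omega> k) = (\<lambda>\<omega>. if H \<omega> = \<infinity> then 0 else g k \<omega>)" by (auto simp: f_def)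
    then show ?thesis by simp
  qed
  have "has_bochner_integral_on M V N (\<lambda>\<omega>. indicator A \<omega> *\<^sub>R f \<omega>) (G A)" if A[measurable]: "A \<in> sets M" for A
  proof (rule has_bochner_integral_onI[OF M])
    have ind_eq: "(indicator A \<omega> *\<^sub>R f \<omega>) k = indicator A \<omega> * f \<omega> k" for \<omega> k by (simp add: scaleR_fun_def)
    show "indicator A \<omega> *\<^sub>R f \<omega> \<in> V" for \<omega> using f by (intro scale_mem) blast
    have ae: "AE \<omega> in M. indicator A \<omega> * f \<omega> k = indicator A \<omega> * g k \<omega>" for k
      using f_AE[of k] by eventually_elim simp
    have g_int: "integrable M (\<lambda>\<omega>. indicator A \<omega> * g k \<omega>)" for k
      using integrable_mult_indicator[OF A g(1)] by simp
    show "integrable M (\<lambda>\<omega>. (indicator A \<omega> *\<^sub>R f \<omega>) k)" for k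
      unfolding ind_eq using g_int integrable_cong_AE[OF _ _ ae] by simp
    show "(\<integral>\<omega>. (indicator A \<omega> *\<^sub>R f \<omega>) k \<partial>M) = G A k" for k
      unfolding ind_eq g(2)[OF A, symmetric] by (rule integral_cong_AE[OF _ _ ae]) simp_all
    have "N (indicator A \<omega> *\<^sub>R f \<omega>) \<le> N (f \<omega>)" for \<omega>
      using f[of \<omega>] norm_nonneg[of "f \<omega>"] by (simp add: norm_scale indicator_def)
    then have "ennreal (N (indicator A \<omega> *\<^sub>R f \<omega>)) \<le> H \<omega>" for \<omega>
      using f[of \<omega>] by (meson ennreal_leI order_trans)
    then have "(\<integral>\<^sup>+\<omega>. ennreal (N (indicator A \<omega> *\<^sub>R f \<omega>)) \<partial>M) \<le> (\<integral>\<^sup>+\<omega>. H \<omega> \<partial>M)"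
      by (rule nn_integral_mono)
    then show "(\<integral>\<^sup>+\<omega>. ennreal (N (indicator A \<omega> *\<^sub>R f \<omega>)) \<partial>M) < \<infinity>" using H_int by (rule le_less_trans)
    show "G A \<in> V" by (rule GV[OF A])
  qed
  then show ?thesis by blast
qed

theorem radon_nikodym: "radon_nikodym_property TYPE('m) V N"
  unfolding radon_nikodym_property_def
proof (intro allI impI)
  fix M :: "'m measure" and G
  assume M: "finite_measure M" and G: "vector_measure_on M V N G"
    and bv: "bounded_variation_on M N G" and null: "\<forall>A\<in>null_sets M. G A = 0"
  obtain C where "\<forall>P. finite P \<and> P \<subseteq> sets M \<and> partition_on (space M) P \<longrightarrow> (\<Sum>A\<in>P. N (G A)) \<le> C"
    using bv unfolding bounded_variation_on_def by (elim exE)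
  then show "\<exists>g. \<forall>A\<in>sets M. has_bochner_integral_on M V N (\<lambda>\<omega>. indicator A \<omega> *\<^sub>R g \<omega>) (G A)"
    by (intro vector_measure_density[OF M G, of C]) (simp_all only: null)
qed

end

section \<open>The modular of an Orlicz-Lorentz space\<close>

text \<open>Finite witness sets take the place of the counting measure and cover infinitely many
  large coordinates in the same way.\<close>

lemma of_nat_le_distr_fun_iff:
  "of_nat n \<le> distr_fun x l \<longleftrightarrow> (\<exists>K. finite K \<and> card K = n \<and> (\<forall>k\<in>K. l < \<bar>x k\<bar>))"
proof (cases "finite {k. l < \<bar>x k\<bar>}")
  case True
  then have *: "of_nat n \<le> distr_fun x l \<longleftrightarrow> n \<le> card {k. l < \<bar>x k\<bar>}"
    by (simp add: distr_fun_def)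
  show ?thesis unfolding *
  proof
    assume "n \<le> card {k. l < \<bar>x k\<bar>}"
    from obtain_subset_with_card_n[OF this]
    show "\<exists>K. finite K \<and> card K = n \<and> (\<forall>k\<in>K. l < \<bar>x k\<bar>)"
      using True finite_subset by (metis mem_Collect_eq subset_eq)
  next
    assume "\<exists>K. finite K \<and> card K = n \<and> (\<forall>k\<in>K. l < \<bar>x k\<bar>)"
    then show "n \<le> card {k. l < \<bar>x k\<bar>}" using True by (auto intro!: card_mono)
  qed
next
  case False
  then have "distr_fun x l = \<infinity>" by (simp add: distr_fun_def)
  moreover obtain K where "finite K" "card K = n" "K \<subseteq> {k. l < \<bar>x k\<bar>}"
    using infinite_arbitrarily_large[OF False] by blast
  ultimately show ?thesis by (auto intro!: exI[of _ K])
qed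

lemma le_rearrangement:
  assumes "finite K" "card K = Suc m" "\<And>k. k \<in> K \<Longrightarrow> a \<le> \<bar>x k\<bar>"
  shows "ennreal a \<le> rearrangement x m"
  unfolding rearrangement_def
proof (rule INF_greatest)
  fix l assume l: "l \<in> {l. 0 < l \<and> distr_fun x l < of_nat (Suc m)}"
  then have "\<not> of_nat (Suc m) \<le> distr_fun x l" by (simp add: not_le)
  then have "\<not> (\<forall>k\<in>K. l < \<bar>x k\<bar>)"
    unfolding of_nat_le_distr_fun_iff using assms(1,2) by blast
  then show "ennreal a \<le> ennreal l" using assms(3) by (intro ennreal_leI) force
qed

text \<open>The value \<open>rearrangement x m\<close> need not be reached by any coordinate, for
  instance if \<open>\<bar>x k\<bar>\<close> increases strictly to a limit; hence the threshold
  strictly below it.\<close>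

lemma less_rearrangement:
  assumes "ennreal t < rearrangement x m" "0 < t"
  shows "\<exists>K. finite K \<and> card K = Suc m \<and> (\<forall>k\<in>K. t < \<bar>x k\<bar>)"
proof (rule ccontr)
  assume "\<not> ?thesis"
  then have "\<not> of_nat (Suc m) \<le> distr_fun x t" unfolding of_nat_le_distr_fun_iff .
  then have "t \<in> {l. 0 < l \<and> distr_fun x l < of_nat (Suc m)}"
    using assms(2) by (simp only: not_le mem_Collect_eq simp_thms)
  then have "rearrangement x m \<le> ennreal t" unfolding rearrangement_def by (rule INF_lower)
  then show False using assms(1) by simp
qed

text \<open>Abel summation: with decreasing nonnegative weights a weighted sum is a nonnegative
  combination of unweighted partial sums.\<close>

lemma sum_mult_decseq_mono:
  fixes a b w :: "nat \<Rightarrow> real"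
  assumes w: "decseq w" "\<And>k. 0 \<le> w k"
    and le: "\<And>m. m \<le> n \<Longrightarrow> (\<Sum>i<m. a i) \<le> (\<Sum>i<m. b i)"
  shows "(\<Sum>i<n. a i * w i) \<le> (\<Sum>i<n. b i * w i)"
proof -
  have abel: "(\<Sum>i<m. c i * w i) = (\<Sum>j<m. (w j - w (Suc j)) * (\<Sum>i<Suc j. c i)) + w m * (\<Sum>i<m. c i)"
    for m and c :: "nat \<Rightarrow> real"
    by (induction m) (simp_all add: algebra_simps)
  show ?thesis unfolding abel
    using w by (intro add_mono sum_mono mult_left_mono le) (auto simp: decseq_Suc_iff)
qed

text \<open>For \<open>c \<ge> 0\<close> this says that the modular is at most \<open>c\<close>, see
  \<open>OL_modular_le_iff\<close>: with decreasing weights the rearranged sum is the supremum over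
  injective placements of coordinates. Arbitrary finite \<open>I\<close> lets index maps be
  restricted and joined.\<close>

definition OL_bound :: "(real \<Rightarrow> real) \<Rightarrow> (nat \<Rightarrow> real) \<Rightarrow> real \<Rightarrow> (nat \<Rightarrow> real) \<Rightarrow> bool" where
  "OL_bound \<phi> w c x \<longleftrightarrow>
    (\<forall>I k. finite I \<longrightarrow> inj_on k I \<longrightarrow> (\<Sum>i\<in>I. \<phi> \<bar>x (k i)\<bar> * w i) \<le> c)"

lemma OL_boundD: "OL_bound \<phi> w c x \<Longrightarrow> finite I \<Longrightarrow> inj_on k I \<Longrightarrow> (\<Sum>i\<in>I. \<phi> \<bar>x (k i)\<bar> * w i) \<le> c"
  by (simp add: OL_bound_def)

section \<open>The modular as a supremum over index maps\<close>

locale orlicz_lorentz =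
  fixes \<phi> :: "real \<Rightarrow> real" and w :: "nat \<Rightarrow> real"
  assumes orlicz: "orlicz_function \<phi>" and weight: "weight_sequence w"
begin

lemma w_pos: "0 < w k"
  using weight by (simp add: weight_sequence_def)

lemma w_decseq: "decseq w"
  using weight by (simp add: weight_sequence_def)

lemma w_le: "w k \<le> w 0"
  using w_decseq by (simp add: decseqD)

lemma phi_0: "\<phi> 0 = 0"
  using orlicz by (simp add: orlicz_function_def)

lemma phi_pos: "0 < u \<Longrightarrow> 0 < \<phi> u"
  using orlicz by (simp add: orlicz_function_def)

lemma phi_nonneg: "0 \<le> u \<Longrightarrow> 0 \<le> \<phi> u"
  using phi_0 phi_pos[of u] by (cases "u = 0") auto

lemma phi_convex: "convex_on {0..} \<phi>"
  using orlicz by (simp add: orlicz_function_def)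

lemma phi_scale: "0 \<le> t \<Longrightarrow> t \<le> 1 \<Longrightarrow> 0 \<le> u \<Longrightarrow> \<phi> (t * u) \<le> t * \<phi> u"
  using convex_onD[OF phi_convex, of t 0 u] phi_0 by simp

lemma phi_mono:
  assumes "0 \<le> u" "u \<le> v"
  shows "\<phi> u \<le> \<phi> v"
proof (cases "v = 0")
  case False
  then have "\<phi> (u / v * v) \<le> u / v * \<phi> v" using assms False by (intro phi_scale) auto
  also have "\<dots> \<le> 1 * \<phi> v" using assms False by (intro mult_right_mono phi_nonneg) auto
  finally show ?thesis using False by simp
qed (use assms in simp)

lemma phi_abs_convex:
  assumes "0 \<le> t" "t \<le> 1"
  shows "\<phi> \<bar>(1 - t) * x + t * y\<bar> \<le> (1 - t) * \<phi> \<bar>x\<bar> + t * \<phi> \<bar>y\<bar>"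
proof -
  have "\<bar>(1 - t) * x + t * y\<bar> \<le> (1 - t) * \<bar>x\<bar> + t * \<bar>y\<bar>"
    using assms abs_triangle_ineq[of "(1 - t) * x" "t * y"] by (simp add: abs_mult)
  then have "\<phi> \<bar>(1 - t) * x + t * y\<bar> \<le> \<phi> ((1 - t) * \<bar>x\<bar> + t * \<bar>y\<bar>)" by (intro phi_mono) auto
  also have "\<dots> \<le> (1 - t) * \<phi> \<bar>x\<bar> + t * \<phi> \<bar>y\<bar>"
    using convex_onD[OF phi_convex, of t "\<bar>x\<bar>" "\<bar>y\<bar>"] assms by simp
  finally show ?thesis .
qed

text \<open>Composition with the absolute value is convex on the whole line, so convexity on an open
  set gives continuity also at 0.\<close>

lemma continuous_phi_abs: "continuous_on UNIV (\<lambda>u. \<phi> \<bar>u\<bar>)"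
proof (rule convex_on_continuous)
  show "convex_on UNIV (\<lambda>u. \<phi> \<bar>u\<bar>)"
    by (rule convex_onI) (use phi_abs_convex in auto)
qed simp

lemma tendsto_phi_abs: "f \<longlonglongrightarrow> l \<Longrightarrow> (\<lambda>n. \<phi> \<bar>f n\<bar>) \<longlonglongrightarrow> \<phi> \<bar>l\<bar>"
  using continuous_on_tendsto_compose[OF continuous_phi_abs, of f l sequentially] by simp

text \<open>The sum of \<open>\<phi>\<close> over any \<open>m\<close> coordinates is at most that
  over the first \<open>m\<close> rearranged values; Abel summation transports this to the weighted
  sums.\<close>

lemma OL_modular_le_imp_bound:
  assumes c: "0 \<le> c" and le: "OL_modular \<phi> w x \<le> ennreal c"
  shows "OL_bound \<phi> w c x"
proof -
  define t where "t = (\<lambda>k. extend_infinity \<phi> (rearrangement x k) * ennreal (w k))"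
  define r where "r = (\<lambda>k. enn2real (rearrangement x k))"
  have sum_t: "(\<Sum>k<m. t k) \<le> ennreal c" for m
    using sum_le_suminf[of t "{..<m}"] le by (simp add: t_def OL_modular_def)
  have fin: "rearrangement x k < top" for k
  proof (rule ccontr)
    assume "\<not> ?thesis"
    then have "t k = top" using w_pos[of k]
      by (simp add: t_def extend_infinity_def top_unique ennreal_top_mult not_less)
    moreover have "t k \<le> (\<Sum>k<Suc k. t k)" by simp
    ultimately have "(\<Sum>k<Suc k. t k) = top" by (simp add: top_unique)
    then show False using sum_t[of "Suc k"] by (metis ennreal_neq_top top_unique)
  qed
  have "t k = ennreal (\<phi> (r k) * w k)" for k
    using fin[of k] w_pos[of k] by (simp add: t_def r_def extend_infinity_def ennreal_mult'' less_imp_le less_top[symmetric])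
  then have sum_r: "(\<Sum>k<m. \<phi> (r k) * w k) \<le> c" for m
    using sum_t[of m] c w_pos
    by (auto simp: sum_ennreal r_def phi_nonneg less_imp_le ennreal_le_iff2)
  \<comment> \<open>The induction splits off the smallest of \<open>m + 1\<close> chosen values. All
    \<open>m + 1\<close> are at least as large, so it is at most \<open>r m\<close>.\<close>
  have card_le: "(\<Sum>k\<in>K. \<phi> \<bar>x k\<bar>) \<le> (\<Sum>j<m. \<phi> (r j))" if "finite K" "card K \<le> m" for K m
    using that
  proof (induction m arbitrary: K)
    case 0
    then show ?case by simp
  next
    case (Suc m)
    show ?case
    proof (cases "card K \<le> m")
      case True
      then have "(\<Sum>k\<in>K. \<phi> \<bar>x k\<bar>) \<le> (\<Sum>j<m. \<phi> (r j))" using Suc by blast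
      also have "\<dots> \<le> (\<Sum>j<Suc m. \<phi> (r j))" by (simp add: phi_nonneg r_def)
      finally show ?thesis .
    next
      case False
      then have card: "card K = Suc m" using Suc by simp
      then have "K \<noteq> {}" by auto
      then obtain k0 where k0: "k0 \<in> K" "\<And>k. k \<in> K \<Longrightarrow> \<bar>x k0\<bar> \<le> \<bar>x k\<bar>"
        using arg_min_if_finite[OF \<open>finite K\<close>, of "\<lambda>k. \<bar>x k\<bar>"] by (metis not_le)
      have "ennreal \<bar>x k0\<bar> \<le> rearrangement x m"
        by (rule le_rearrangement[OF \<open>finite K\<close> card k0(2)])
      then have "\<bar>x k0\<bar> \<le> r m"
        using fin[of m] unfolding r_def by (metis abs_ge_zero enn2real_ennreal enn2real_mono)
      then have "\<phi> \<bar>x k0\<bar> \<le> \<phi> (r m)" by (intro phi_mono) auto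
      moreover have "(\<Sum>k\<in>K - {k0}. \<phi> \<bar>x k\<bar>) \<le> (\<Sum>j<m. \<phi> (r j))"
        using Suc.IH[of "K - {k0}"] \<open>finite K\<close> card k0(1) by simp
      ultimately show ?thesis
        using sum.remove[OF \<open>finite K\<close> k0(1), of "\<lambda>k. \<phi> \<bar>x k\<bar>"] by simp
    qed
  qed
  show ?thesis
    unfolding OL_bound_def
  proof (intro allI impI)
    fix I :: "nat set" and k :: "nat \<Rightarrow> nat" assume I: "finite I" "inj_on k I"
    obtain n where n: "I \<subseteq> {..<n}" using I(1) finite_nat_iff_bounded by blast
    \<comment> \<open>Gaps in \<open>I\<close> are filled with zeros, since Abel summation works on
      initial segments.\<close>
    have "(\<Sum>i\<in>I. \<phi> \<bar>x (k i)\<bar> * w i) = (\<Sum>i<n. (if i \<in> I then \<phi> \<bar>x (k i)\<bar> else 0) * w i)"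
      using n by (intro sum.mono_neutral_cong_left) auto
    also have "\<dots> \<le> (\<Sum>i<n. \<phi> (r i) * w i)"
    proof (rule sum_mult_decseq_mono[OF w_decseq])
      fix m
      have inj: "inj_on k (I \<inter> {..<m})" using I(2) by (rule inj_on_subset) auto
      have "(\<Sum>i<m. if i \<in> I then \<phi> \<bar>x (k i)\<bar> else 0) = (\<Sum>i\<in>I \<inter> {..<m}. \<phi> \<bar>x (k i)\<bar>)"
        by (intro sum.mono_neutral_cong_right) auto
      also have "\<dots> = (\<Sum>j\<in>k ` (I \<inter> {..<m}). \<phi> \<bar>x j\<bar>)" by (simp add: sum.reindex[OF inj])
      also have "\<dots> \<le> (\<Sum>i<m. \<phi> (r i))"
        using card_mono[of "{..<m}" "I \<inter> {..<m}"] by (intro card_le) (auto simp: card_image[OF inj])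
      finally show "(\<Sum>i<m. if i \<in> I then \<phi> \<bar>x (k i)\<bar> else 0) \<le> (\<Sum>i<m. \<phi> (r i))" .
    qed (simp add: less_imp_le w_pos)
    also have "\<dots> \<le> c" by (rule sum_r)
    finally show "(\<Sum>i\<in>I. \<phi> \<bar>x (k i)\<bar> * w i) \<le> c" .
  qed
qed

text \<open>For \<open>s < 1\<close> distinct indices with
  \<open>\<bar>x (k i)\<bar> > s * r i\<close> can be chosen greedily, and continuity of
  \<open>\<phi>\<close> carries the resulting bound to \<open>s = 1\<close>.\<close>

lemma bound_imp_OL_modular_le:
  assumes b: "OL_bound \<phi> w c x"
  shows "OL_modular \<phi> w x \<le> ennreal c"
proof -
  define r where "r = (\<lambda>k. enn2real (rearrangement x k))"
  have fin: "rearrangement x m < top" for m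
  proof (rule ccontr)
    assume "\<not> ?thesis"
    then have top: "rearrangement x m = top" by (simp add: not_less top_unique)
    \<comment> \<open>Convexity gives \<open>\<phi> l \<ge> l * \<phi> 1\<close>, and
      \<open>l\<close> makes \<open>l * \<phi> 1 * w 0\<close> equal to
      \<open>\<phi> 1 * w 0 + \<bar>c\<bar>\<close>, which exceeds \<open>c\<close>.\<close>
    define l where "l = 1 + \<bar>c\<bar> / (\<phi> 1 * w 0)"
    have p: "0 < \<phi> 1 * w 0" using phi_pos[of 1] w_pos[of 0] by simp
    then have l: "1 \<le> l" by (simp add: l_def)
    then obtain K where "card K = Suc m" "\<forall>k\<in>K. l < \<bar>x k\<bar>"
      using less_rearrangement[of l x m] top by auto
    then obtain k where k: "l < \<bar>x k\<bar>" by fastforce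
    have "\<phi> (1 / l * l) \<le> 1 / l * \<phi> l" using l by (intro phi_scale) auto
    then have "l * \<phi> 1 \<le> \<phi> l" using l by (simp add: field_simps)
    also have "\<dots> \<le> \<phi> \<bar>x k\<bar>" using k l by (intro phi_mono) auto
    finally have "l * \<phi> 1 * w 0 \<le> \<phi> \<bar>x k\<bar> * w 0" using w_pos[of 0] by simp
    also have "\<dots> \<le> c" using OL_boundD[OF b, of "{0}" "\<lambda>_. k"] by simp
    finally have "l * (\<phi> 1 * w 0) \<le> c" by (simp add: mult.assoc)
    moreover have "l * (\<phi> 1 * w 0) = \<phi> 1 * w 0 + \<bar>c\<bar>"
      unfolding l_def distrib_right by (subst nonzero_divide_eq_eq[THEN iffD1, OF _ refl]) (use p in auto)
    ultimately show False using p by linarith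
  qed
  have r_nonneg: "0 \<le> r k" for k by (simp add: r_def)
  have er: "rearrangement x k = ennreal (r k)" for k using fin[of k] by (simp add: r_def)
  have le: "(\<Sum>i<m. \<phi> (r i) * w i) \<le> c" for m
  proof -
    \<comment> \<open>\<open>less_rearrangement\<close> wants positive thresholds; positions with
      \<open>r i = 0\<close> add 0 to the sum.\<close>
    define I where "I = {i. 0 < r i}"
    have scaled: "(\<Sum>i\<in>I \<inter> {..<m}. \<phi> \<bar>s * r i\<bar> * w i) \<le> c" if s: "0 < s" "s < 1" for s
    proof -
      have "\<exists>k. inj_on k (I \<inter> {..<m}) \<and> (\<forall>i\<in>I \<inter> {..<m}. s * r i < \<bar>x (k i)\<bar>)"
      proof (induction m)
        case (Suc m)
        then obtain k where k: "inj_on k (I \<inter> {..<m})" "\<forall>i\<in>I \<inter> {..<m}. s * r i < \<bar>x (k i)\<bar>"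
          by blast
        show ?case
        proof (cases "m \<in> I")
          case True
          then have r: "0 < r m" by (simp add: I_def)
          then have "ennreal (s * r m) < rearrangement x m"
            unfolding er using s by (intro ennreal_lessI) auto
          then obtain K where K: "finite K" "card K = Suc m" "\<forall>k\<in>K. s * r m < \<bar>x k\<bar>"
            using less_rearrangement s r by (metis mult_pos_pos)
          \<comment> \<open>\<open>K\<close> has \<open>m + 1\<close> elements and at most
            \<open>m\<close> indices are taken, so a free one remains.\<close>
          have "card (k ` (I \<inter> {..<m})) \<le> m"
            using card_image_le[of "I \<inter> {..<m}" k] card_mono[of "{..<m}" "I \<inter> {..<m}"] by simp
          then have "\<not> K \<subseteq> k ` (I \<inter> {..<m})"
            using card_mono[of "k ` (I \<inter> {..<m})" K] K(2) by auto
          then obtain j where j: "j \<in> K" "j \<notin> k ` (I \<inter> {..<m})" by blast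
          have eq: "I \<inter> {..<Suc m} = insert m (I \<inter> {..<m})" using True by auto
          have "inj_on (k(m := j)) (insert m (I \<inter> {..<m}))"
            using k(1) j(2) by (auto simp: inj_on_def)
          moreover have "\<forall>i\<in>insert m (I \<inter> {..<m}). s * r i < \<bar>x ((k(m := j)) i)\<bar>"
            using k(2) K(3) j(1) by auto
          ultimately show ?thesis unfolding eq by blast
        next
          case False
          then have "I \<inter> {..<Suc m} = I \<inter> {..<m}" by (auto simp: less_Suc_eq)
          then show ?thesis using k by auto
        qed
      qed simp
      then obtain k where k: "inj_on k (I \<inter> {..<m})" "\<forall>i\<in>I \<inter> {..<m}. s * r i < \<bar>x (k i)\<bar>" by blast
      have "(\<Sum>i\<in>I \<inter> {..<m}. \<phi> \<bar>s * r i\<bar> * w i) \<le> (\<Sum>i\<in>I \<inter> {..<m}. \<phi> \<bar>x (k i)\<bar> * w i)"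
      proof (intro sum_mono mult_right_mono phi_mono)
        fix i assume "i \<in> I \<inter> {..<m}"
        then show "\<bar>s * r i\<bar> \<le> \<bar>x (k i)\<bar>" using k(2) s r_nonneg[of i] by (auto simp: abs_mult less_imp_le)
      qed (simp_all add: less_imp_le w_pos)
      also have "\<dots> \<le> c" by (rule OL_boundD[OF b _ k(1)]) simp
      finally show ?thesis .
    qed
    \<comment> \<open>The double successor keeps every factor strictly between 0 and 1.\<close>
    have s_lim: "(\<lambda>n. 1 - inverse (real (Suc (Suc n)))) \<longlonglongrightarrow> 1"
      using tendsto_diff[OF tendsto_const LIMSEQ_Suc[OF LIMSEQ_inverse_real_of_nat], of 1] by simp
    have lim: "(\<lambda>n. \<Sum>i\<in>I \<inter> {..<m}. \<phi> \<bar>(1 - inverse (real (Suc (Suc n)))) * r i\<bar> * w i)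
        \<longlonglongrightarrow> (\<Sum>i\<in>I \<inter> {..<m}. \<phi> \<bar>1 * r i\<bar> * w i)"
      by (intro tendsto_intros tendsto_phi_abs s_lim)
    have le_c: "(\<Sum>i\<in>I \<inter> {..<m}. \<phi> \<bar>(1 - inverse (real (Suc (Suc n)))) * r i\<bar> * w i) \<le> c" for n
      by (rule scaled) (simp_all add: field_simps)
    have "(\<Sum>i\<in>I \<inter> {..<m}. \<phi> \<bar>1 * r i\<bar> * w i) \<le> c"
      by (rule LIMSEQ_le_const2[OF lim]) (intro exI[of _ 0] allI impI le_c)
    moreover have "(\<Sum>i<m. \<phi> (r i) * w i) = (\<Sum>i\<in>I \<inter> {..<m}. \<phi> \<bar>1 * r i\<bar> * w i)"
    proof (intro sum.mono_neutral_cong_right ballI)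
      fix i assume "i \<in> {..<m} - I \<inter> {..<m}"
      then have "r i = 0" using r_nonneg[of i] by (auto simp: I_def)
      then show "\<phi> (r i) * w i = 0" by (simp add: phi_0)
    qed (use r_nonneg in auto)
    ultimately show ?thesis by simp
  qed
  show ?thesis unfolding OL_modular_def
  proof (rule suminf_le_const[OF summableI])
    fix m
    have "(\<Sum>k<m. extend_infinity \<phi> (rearrangement x k) * ennreal (w k)) = (\<Sum>k<m. ennreal (\<phi> (r k) * w k))"
      using r_nonneg w_pos by (intro sum.cong refl) (simp add: er extend_infinity_def ennreal_mult'' less_imp_le)
    also have "\<dots> = ennreal (\<Sum>k<m. \<phi> (r k) * w k)"
      using r_nonneg w_pos by (intro sum_ennreal) (simp add: phi_nonneg less_imp_le)
    also have "\<dots> \<le> ennreal c" by (intro ennreal_leI le)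
    finally show "(\<Sum>k<m. extend_infinity \<phi> (rearrangement x k) * ennreal (w k)) \<le> ennreal c" .
  qed
qed

lemma OL_modular_le_iff: "0 \<le> c \<Longrightarrow> OL_modular \<phi> w x \<le> ennreal c \<longleftrightarrow> OL_bound \<phi> w c x"
  using OL_modular_le_imp_bound bound_imp_OL_modular_le by blast

end

section \<open>The Luxemburg norm\<close>

context orlicz_lorentz
begin

lemma OL_bound_nonneg: "OL_bound \<phi> w c x \<Longrightarrow> 0 \<le> c"
  using OL_boundD[of \<phi> w c x "{}" id] by simp

lemma OL_bound_solid:
  assumes "OL_bound \<phi> w c x" "\<And>k. \<bar>y k\<bar> \<le> \<bar>x k\<bar>"
  shows "OL_bound \<phi> w c y"
  unfolding OL_bound_def
proof (intro allI impI)
  fix I :: "nat set" and k :: "nat \<Rightarrow> nat" assume I: "finite I" "inj_on k I"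
  have "(\<Sum>i\<in>I. \<phi> \<bar>y (k i)\<bar> * w i) \<le> (\<Sum>i\<in>I. \<phi> \<bar>x (k i)\<bar> * w i)"
    using assms(2) by (intro sum_mono mult_right_mono phi_mono) (auto simp: less_imp_le w_pos)
  also have "\<dots> \<le> c" by (rule OL_boundD[OF assms(1) I])
  finally show "(\<Sum>i\<in>I. \<phi> \<bar>y (k i)\<bar> * w i) \<le> c" .
qed

lemma OL_bound_convex:
  assumes x: "OL_bound \<phi> w a x" and y: "OL_bound \<phi> w b y" and t: "0 \<le> t" "t \<le> 1"
  shows "OL_bound \<phi> w ((1 - t) * a + t * b) ((1 - t) *\<^sub>R x + t *\<^sub>R y)"
  unfolding OL_bound_def
proof (intro allI impI)
  fix I :: "nat set" and k :: "nat \<Rightarrow> nat" assume I: "finite I" "inj_on k I"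
  have "(\<Sum>i\<in>I. \<phi> \<bar>((1 - t) *\<^sub>R x + t *\<^sub>R y) (k i)\<bar> * w i)
      \<le> (\<Sum>i\<in>I. ((1 - t) * \<phi> \<bar>x (k i)\<bar> + t * \<phi> \<bar>y (k i)\<bar>) * w i)"
    using phi_abs_convex[OF t] w_pos
    by (intro sum_mono mult_right_mono) (auto simp: scaleR_fun_def less_imp_le)
  also have "\<dots> = (1 - t) * (\<Sum>i\<in>I. \<phi> \<bar>x (k i)\<bar> * w i) + t * (\<Sum>i\<in>I. \<phi> \<bar>y (k i)\<bar> * w i)"
    unfolding sum_distrib_left sum.distrib[symmetric]
    by (intro sum.cong refl) (simp add: algebra_simps)
  also have "\<dots> \<le> (1 - t) * a + t * b"
    using t by (intro add_mono mult_left_mono OL_boundD[OF x I] OL_boundD[OF y I]) auto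
  finally show "(\<Sum>i\<in>I. \<phi> \<bar>((1 - t) *\<^sub>R x + t *\<^sub>R y) (k i)\<bar> * w i) \<le> (1 - t) * a + t * b" .
qed

lemma OL_bound_zero: "OL_bound \<phi> w 0 0"
  by (simp add: OL_bound_def phi_0)

lemma OL_bound_scale:
  assumes "OL_bound \<phi> w c x" "0 \<le> t" "t \<le> 1"
  shows "OL_bound \<phi> w (t * c) (t *\<^sub>R x)"
  using OL_bound_convex[OF OL_bound_zero assms] by simp

lemma OL_bound_limit:
  assumes X: "\<And>n. OL_bound \<phi> w c (X n)" and lim: "\<And>k. (\<lambda>n. X n k) \<longlonglongrightarrow> x k"
  shows "OL_bound \<phi> w c x"
  unfolding OL_bound_def
proof (intro allI impI)
  fix I :: "nat set" and k :: "nat \<Rightarrow> nat" assume I: "finite I" "inj_on k I"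
  have "(\<lambda>n. \<Sum>i\<in>I. \<phi> \<bar>X n (k i)\<bar> * w i) \<longlonglongrightarrow> (\<Sum>i\<in>I. \<phi> \<bar>x (k i)\<bar> * w i)"
    by (intro tendsto_intros tendsto_phi_abs lim)
  then show "(\<Sum>i\<in>I. \<phi> \<bar>x (k i)\<bar> * w i) \<le> c"
    by (rule LIMSEQ_le_const2) (use OL_boundD[OF X I] in blast)
qed

lemma OL_bound_finite_support:
  assumes "finite F" "\<And>k. k \<notin> F \<Longrightarrow> x k = 0"
  shows "OL_bound \<phi> w (w 0 * (\<Sum>k\<in>F. \<phi> \<bar>x k\<bar>)) x"
  unfolding OL_bound_def
proof (intro allI impI)
  fix I :: "nat set" and k :: "nat \<Rightarrow> nat" assume I: "finite I" "inj_on k I"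
  have "(\<Sum>i\<in>I. \<phi> \<bar>x (k i)\<bar> * w i) \<le> (\<Sum>i\<in>I. w 0 * \<phi> \<bar>x (k i)\<bar>)"
    using w_le phi_nonneg mult_right_mono[of "w _" "w 0"]
    by (intro sum_mono) (simp add: mult.commute[of "\<phi> _"])
  also have "\<dots> = w 0 * (\<Sum>j\<in>k ` I. \<phi> \<bar>x j\<bar>)"
    by (simp add: sum.reindex[OF I(2)] sum_distrib_left)
  also have "(\<Sum>j\<in>k ` I. \<phi> \<bar>x j\<bar>) \<le> (\<Sum>j\<in>k ` I \<union> F. \<phi> \<bar>x j\<bar>)"
    using I(1) assms(1) by (intro sum_mono2) (auto simp: phi_nonneg)
  also have "(\<Sum>j\<in>k ` I \<union> F. \<phi> \<bar>x j\<bar>) = (\<Sum>k\<in>F. \<phi> \<bar>x k\<bar>)"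
    using I(1) assms by (intro sum.mono_neutral_right) (auto simp: phi_0)
  finally show "(\<Sum>i\<in>I. \<phi> \<bar>x (k i)\<bar> * w i) \<le> w 0 * (\<Sum>k\<in>F. \<phi> \<bar>x k\<bar>)"
    using w_pos[of 0] by (simp add: mult_left_mono)
qed

lemma OL_modular_le_1_iff: "OL_modular \<phi> w x \<le> 1 \<longleftrightarrow> OL_bound \<phi> w 1 x"
  using OL_modular_le_iff[of 1 x] by simp

lemma OL_norm_eq: "OL_norm \<phi> w x = Inf {e. 0 < e \<and> OL_bound \<phi> w 1 (inverse e *\<^sub>R x)}"
  unfolding OL_norm_def OL_modular_le_1_iff ..

lemma OL_bound_imp_mem:
  assumes "0 < l" "OL_bound \<phi> w c (l *\<^sub>R x)"
  shows "\<exists>e>0. OL_bound \<phi> w 1 (inverse e *\<^sub>R x)"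
proof -
  have c: "0 \<le> c" using assms(2) by (rule OL_bound_nonneg)
  \<comment> \<open>By convexity, scaling the sequence by \<open>1 / (c + 1)\<close> scales its
    bound \<open>c\<close> to a value below 1.\<close>
  have "OL_bound \<phi> w (inverse (c + 1) * c) (inverse (c + 1) *\<^sub>R (l *\<^sub>R x))"
    using c by (intro OL_bound_scale assms) (auto simp: field_simps)
  then have "OL_bound \<phi> w (inverse (c + 1) * c) (inverse ((c + 1) / l) *\<^sub>R x)"
    by (simp add: field_simps)
  moreover have "inverse (c + 1) * c \<le> 1" using c by (simp add: field_simps)
  ultimately have "OL_bound \<phi> w 1 (inverse ((c + 1) / l) *\<^sub>R x)"
    unfolding OL_bound_def using order_trans by blast
  then show ?thesis using assms(1) c by (intro exI[of _ "(c + 1) / l"]) simp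
qed

lemma OL_space_eq: "OL_space \<phi> w = {x. \<exists>e>0. OL_bound \<phi> w 1 (inverse e *\<^sub>R x)}"
proof (intro set_eqI iffI)
  fix x assume "x \<in> OL_space \<phi> w"
  then obtain l where l: "0 < l" "OL_modular \<phi> w (l *\<^sub>R x) < \<infinity>" by (auto simp: OL_space_def)
  then have "OL_modular \<phi> w (l *\<^sub>R x) = ennreal (enn2real (OL_modular \<phi> w (l *\<^sub>R x)))" by simp
  then have "OL_bound \<phi> w (enn2real (OL_modular \<phi> w (l *\<^sub>R x))) (l *\<^sub>R x)"
    by (intro OL_modular_le_imp_bound) auto
  then show "x \<in> {x. \<exists>e>0. OL_bound \<phi> w 1 (inverse e *\<^sub>R x)}"
    using OL_bound_imp_mem[OF l(1)] by simp
next
  fix x assume "x \<in> {x. \<exists>e>0. OL_bound \<phi> w 1 (inverse e *\<^sub>R x)}"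
  then obtain e where "0 < e" "OL_bound \<phi> w 1 (inverse e *\<^sub>R x)" by auto
  then show "x \<in> OL_space \<phi> w"
    unfolding OL_space_def OL_modular_le_1_iff[symmetric]
    by (auto intro!: exI[of _ "inverse e"] elim: le_less_trans)
qed

lemma OL_bound_inverse_mono:
  assumes "0 < e" "e \<le> d" "OL_bound \<phi> w c (inverse e *\<^sub>R x)"
  shows "OL_bound \<phi> w c (inverse d *\<^sub>R x)"
proof (rule OL_bound_solid[OF assms(3)])
  fix k
  show "\<bar>(inverse d *\<^sub>R x) k\<bar> \<le> \<bar>(inverse e *\<^sub>R x) k\<bar>"
    using assms(1,2) by (simp add: scaleR_fun_def abs_mult mult_right_mono le_imp_inverse_le)
qed

lemma OL_norm_le:
  assumes "0 < e" "OL_bound \<phi> w 1 (inverse e *\<^sub>R x)"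
  shows "OL_norm \<phi> w x \<le> e"
  unfolding OL_norm_eq using assms by (intro cInf_lower bdd_belowI[of _ 0]) auto

text \<open>The infimum in the norm is attained if it is positive: the bound holds at all scales
  above \<open>e\<close>, and coordinatewise limits preserve it.\<close>

lemma OL_bound_OL_norm:
  assumes x: "x \<in> OL_space \<phi> w" and e: "0 < e" "OL_norm \<phi> w x \<le> e"
  shows "OL_bound \<phi> w 1 (inverse e *\<^sub>R x)"
proof (rule OL_bound_limit)
  have ne: "{e. 0 < e \<and> OL_bound \<phi> w 1 (inverse e *\<^sub>R x)} \<noteq> {}"
    using x by (auto simp: OL_space_eq)
  show "OL_bound \<phi> w 1 (inverse (e + inverse (real (Suc n))) *\<^sub>R x)" for n
  proof -
    have "OL_norm \<phi> w x < e + inverse (real (Suc n))"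
      using e(2) by (rule le_less_trans) simp
    from cInf_lessD[OF ne this[unfolded OL_norm_eq]]
    obtain d where "0 < d" "OL_bound \<phi> w 1 (inverse d *\<^sub>R x)" "d < e + inverse (real (Suc n))" by auto
    then show ?thesis using OL_bound_inverse_mono[of d "e + inverse (real (Suc n))"] by simp
  qed
  fix k
  have "(\<lambda>n. inverse (e + inverse (real (Suc n))) * x k) \<longlonglongrightarrow> inverse (e + 0) * x k"
    using e(1) by (intro tendsto_intros LIMSEQ_inverse_real_of_nat) auto
  then show "(\<lambda>n. (inverse (e + inverse (real (Suc n))) *\<^sub>R x) k) \<longlonglongrightarrow> (inverse e *\<^sub>R x) k"
    by (simp add: scaleR_fun_def)
qed

lemma OL_norm_nonneg: "x \<in> OL_space \<phi> w \<Longrightarrow> 0 \<le> OL_norm \<phi> w x"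
  unfolding OL_norm_eq by (rule cInf_greatest) (auto simp: OL_space_eq)

lemma OL_norm_zero: "OL_norm \<phi> w 0 = 0"
proof -
  have b: "OL_bound \<phi> w 1 (inverse e *\<^sub>R 0)" for e
    by (simp add: OL_bound_def phi_0 scaleR_fun_def)
  then have "0 \<in> OL_space \<phi> w" unfolding OL_space_eq using zero_less_one by blast
  moreover have "OL_norm \<phi> w 0 \<le> 0 + e" if "0 < e" for e using OL_norm_le[OF that b] by simp
  then have "OL_norm \<phi> w 0 \<le> 0" by (rule field_le_epsilon)
  ultimately show ?thesis using OL_norm_nonneg[of 0] by simp
qed

lemma OL_add:
  assumes a: "0 < a" "OL_bound \<phi> w 1 (inverse a *\<^sub>R x)" and b: "0 < b" "OL_bound \<phi> w 1 (inverse b *\<^sub>R y)"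
  shows "OL_bound \<phi> w 1 (inverse (a + b) *\<^sub>R (x + y))"
proof -
  \<comment> \<open>With this weight \<open>(x + y) / (a + b)\<close> is a convex combination of
    \<open>x / a\<close> and \<open>y / b\<close>.\<close>
  define t where "t = b / (a + b)"
  have t: "0 \<le> t" "t \<le> 1" "(1 - t) * inverse a = inverse (a + b)" "t * inverse b = inverse (a + b)"
    using a(1) b(1) by (auto simp: t_def field_simps)
  have "OL_bound \<phi> w ((1 - t) * 1 + t * 1) ((1 - t) *\<^sub>R (inverse a *\<^sub>R x) + t *\<^sub>R (inverse b *\<^sub>R y))"
    by (rule OL_bound_convex[OF a(2) b(2) t(1,2)])
  then show ?thesis by (simp add: t(3,4) scaleR_add_right)
qed

lemma OL_scale:
  assumes "0 < e" "OL_bound \<phi> w 1 (inverse e *\<^sub>R x)" "c \<noteq> 0"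
  shows "OL_bound \<phi> w 1 (inverse (\<bar>c\<bar> * e) *\<^sub>R (c *\<^sub>R x))"
  using assms(2)
  by (rule OL_bound_solid) (use assms(1,3) in \<open>simp add: scaleR_fun_def abs_mult field_simps\<close>)

lemma OL_norm_eq_0:
  assumes x: "x \<in> OL_space \<phi> w" and "OL_norm \<phi> w x = 0"
  shows "x = 0"
proof
  fix k
  show "x k = 0 k"
  proof (rule ccontr)
    assume "x k \<noteq> 0 k"
    then have p: "0 < \<phi> \<bar>x k\<bar> * w 0" using phi_pos[of "\<bar>x k\<bar>"] w_pos[of 0] by simp
    \<comment> \<open>At norm 0 the bound holds at every scale \<open>e\<close>. For coordinate
      \<open>k\<close> alone, convexity turns it into
      \<open>\<phi> \<bar>x k\<bar> * w 0 \<le> e\<close> when \<open>e \<le> 1\<close>, which fails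
      for half of the left side.\<close>
    define e where "e = min 1 (\<phi> \<bar>x k\<bar> * w 0 / 2)"
    have e: "0 < e" "e \<le> 1" "e \<le> \<phi> \<bar>x k\<bar> * w 0 / 2" using p by (auto simp: e_def)
    then have "OL_bound \<phi> w 1 (inverse e *\<^sub>R x)" using assms by (intro OL_bound_OL_norm) auto
    from OL_boundD[OF this, of "{0}" "\<lambda>_. k"]
    have le1: "\<phi> (\<bar>x k\<bar> / e) * w 0 \<le> 1" using e(1) by (simp add: scaleR_fun_def abs_mult divide_inverse mult.commute)
    have "\<phi> (e * (\<bar>x k\<bar> / e)) \<le> e * \<phi> (\<bar>x k\<bar> / e)" using e by (intro phi_scale) auto
    then have "\<phi> \<bar>x k\<bar> * w 0 \<le> e * \<phi> (\<bar>x k\<bar> / e) * w 0"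
      using e w_pos[of 0] by (intro mult_right_mono) auto
    also have "\<dots> = e * (\<phi> (\<bar>x k\<bar> / e) * w 0)" by (simp only: mult.assoc)
    also have "\<dots> \<le> e * 1" using le1 e(1) by (intro mult_left_mono) auto
    finally have "\<phi> \<bar>x k\<bar> * w 0 \<le> e * 1" .
    then show False using e(3) p by simp
  qed
qed

text \<open>\<open>OL_bound_OL_norm\<close> wants a positive scale, so norm inequalities are proved
  slightly above the norm, which includes norm 0. The Fatou property is
  \<open>OL_bound_limit\<close> at a fixed scale.\<close>

lemma fatou_space_OL: "fatou_space (OL_space \<phi> w) (OL_norm \<phi> w)"
proof
  let ?V = "OL_space \<phi> w" and ?N = "OL_norm \<phi> w"
  have add: "x + y \<in> ?V \<and> ?N (x + y) \<le> ?N x + ?N y" if x: "x \<in> ?V" and y: "y \<in> ?V" for x y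
  proof
    have b: "OL_bound \<phi> w 1 (inverse (a + b) *\<^sub>R (x + y))"
      if "0 < a" "?N x \<le> a" "0 < b" "?N y \<le> b" for a b
      using that by (intro OL_add OL_bound_OL_norm x y)
    show "x + y \<in> ?V"
      unfolding OL_space_eq using b[of "?N x + 1" "?N y + 1"] OL_norm_nonneg[OF x] OL_norm_nonneg[OF y]
      by (intro CollectI exI[of _ "?N x + 1 + (?N y + 1)"]) auto
    show "?N (x + y) \<le> ?N x + ?N y"
    proof (rule field_le_epsilon)
      fix e :: real assume e: "0 < e"
      then have pos: "0 < ?N x + e / 2" "0 < ?N y + e / 2"
        using OL_norm_nonneg[OF x] OL_norm_nonneg[OF y] by auto
      then have "?N (x + y) \<le> (?N x + e / 2) + (?N y + e / 2)"
        using e by (intro OL_norm_le[OF add_pos_pos b]) auto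
      then show "?N (x + y) \<le> ?N x + ?N y + e" by simp
    qed
  qed
  have zero: "0 \<in> ?V"
    unfolding OL_space_eq by (auto simp: OL_bound_def phi_0 scaleR_fun_def intro!: exI[of _ 1])
  have scale: "c *\<^sub>R x \<in> ?V \<and> ?N (c *\<^sub>R x) \<le> \<bar>c\<bar> * ?N x" if x: "x \<in> ?V" and c: "c \<noteq> 0" for c x
  proof
    have b: "OL_bound \<phi> w 1 (inverse (\<bar>c\<bar> * e) *\<^sub>R (c *\<^sub>R x))" if "0 < e" "?N x \<le> e" for e
      using that c by (intro OL_scale OL_bound_OL_norm x)
    show "c *\<^sub>R x \<in> ?V"
      unfolding OL_space_eq using b[of "?N x + 1"] OL_norm_nonneg[OF x] c
      by (intro CollectI exI[of _ "\<bar>c\<bar> * (?N x + 1)"]) auto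
    show "?N (c *\<^sub>R x) \<le> \<bar>c\<bar> * ?N x"
    proof (rule field_le_epsilon)
      fix e :: real assume e: "0 < e"
      then have pos: "0 < ?N x + e / \<bar>c\<bar>" using OL_norm_nonneg[OF x] c by (simp add: add_nonneg_pos)
      then have "?N (c *\<^sub>R x) \<le> \<bar>c\<bar> * (?N x + e / \<bar>c\<bar>)"
        using e c by (intro OL_norm_le[OF _ b]) auto
      then show "?N (c *\<^sub>R x) \<le> \<bar>c\<bar> * ?N x + e" using c by (simp add: distrib_left)
    qed
  qed
  show "normed_space_on ?V ?N"
    unfolding normed_space_on_def
  proof (intro conjI ballI allI)
    show "subspace ?V"
    proof (rule subspaceI)
      show "c *\<^sub>R x \<in> ?V" if "x \<in> ?V" for c x
        using scale[OF that, of c] zero by (cases "c = 0") (simp_all only: scaleR_zero_left not_False_eq_True simp_thms)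
    qed (use zero add in auto)
    show "?N x = 0 \<longleftrightarrow> x = 0" if "x \<in> ?V" for x using OL_norm_eq_0[OF that] OL_norm_zero by auto
    show "?N (c *\<^sub>R x) = \<bar>c\<bar> * ?N x" if x: "x \<in> ?V" for c x
    proof (cases "c = 0")
      case True
      then show ?thesis by (simp only: scaleR_zero_left OL_norm_zero abs_zero mult_zero_left)
    next
      case False
      then have "inverse c *\<^sub>R (c *\<^sub>R x) = x" by simp
      then have "?N x \<le> \<bar>inverse c\<bar> * ?N (c *\<^sub>R x)"
        using scale[of "c *\<^sub>R x" "inverse c"] scale[OF x False] False by (metis inverse_nonzero_iff_nonzero)
      then have "\<bar>c\<bar> * ?N x \<le> ?N (c *\<^sub>R x)" using False by (simp add: field_simps abs_inverse)
      then show ?thesis using scale[OF x False] by simp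
    qed
  qed (use add OL_norm_nonneg in auto)
  show "unit_seq k \<in> ?V" for k
  proof -
    have "OL_bound \<phi> w (w 0 * (\<Sum>j\<in>{k}. \<phi> \<bar>unit_seq k j\<bar>)) (unit_seq k)"
      by (rule OL_bound_finite_support) (auto simp: unit_seq_def)
    then show ?thesis
      unfolding OL_space_eq using OL_bound_imp_mem[of 1 _ "unit_seq k"] by simp
  qed
  show "y \<in> ?V \<and> ?N y \<le> ?N x" if x: "x \<in> ?V" and le: "\<And>k. \<bar>y k\<bar> \<le> \<bar>x k\<bar>" for x y
  proof
    have b: "OL_bound \<phi> w 1 (inverse e *\<^sub>R y)" if "0 < e" "?N x \<le> e" for e
      by (rule OL_bound_solid[OF OL_bound_OL_norm[OF x that]])
         (use le that in \<open>simp add: scaleR_fun_def abs_mult mult_left_mono\<close>)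
    show "y \<in> ?V"
      unfolding OL_space_eq using b[of "?N x + 1"] OL_norm_nonneg[OF x]
      by (intro CollectI exI[of _ "?N x + 1"]) auto
    show "?N y \<le> ?N x"
    proof (rule field_le_epsilon)
      fix e :: real assume "0 < e"
      then show "?N y \<le> ?N x + e" using OL_norm_nonneg[OF x] by (intro OL_norm_le[OF _ b]) auto
    qed
  qed
  show "x \<in> ?V \<and> ?N x \<le> C"
    if X: "\<And>n. X n \<in> ?V" "\<And>n. ?N (X n) \<le> C" and lim: "\<And>k. (\<lambda>n. X n k) \<longlonglongrightarrow> x k" for X x C
  proof
    have C: "0 \<le> C" using OL_norm_nonneg[OF X(1)] X(2) order_trans by blast
    have b: "OL_bound \<phi> w 1 (inverse e *\<^sub>R x)" if "0 < e" "C \<le> e" for e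
    proof (rule OL_bound_limit)
      show "OL_bound \<phi> w 1 (inverse e *\<^sub>R X n)" for n
        using X(2)[of n] that by (intro OL_bound_OL_norm X) auto
      show "(\<lambda>n. (inverse e *\<^sub>R X n) k) \<longlonglongrightarrow> (inverse e *\<^sub>R x) k" for k
        using tendsto_mult_left[OF lim[of k], of "inverse e"] by (simp add: scaleR_fun_def)
    qed
    show "x \<in> ?V"
      unfolding OL_space_eq using b[of "C + 1"] C by (intro CollectI exI[of _ "C + 1"]) auto
    show "?N x \<le> C"
    proof (rule field_le_epsilon)
      fix e :: real assume "0 < e"
      then show "?N x \<le> C + e" using C by (intro OL_norm_le[OF _ b]) auto
    qed
  qed
qed

section \<open>Order continuity under the doubling condition\<close>

lemma finite_large_coordinates:
  assumes W: "W_infinity w = \<infinity>" and x: "OL_bound \<phi> w c x" and u: "0 < u"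
  shows "finite {k. u < \<bar>x k\<bar>}"
proof (rule ccontr)
  assume inf: "infinite {k. u < \<bar>x k\<bar>}"
  \<comment> \<open>Pairing infinitely many large coordinates with the weights would bound
    \<open>\<phi> u\<close> times every partial sum of \<open>w\<close> by \<open>c\<close>.\<close>
  define k where "k = enumerate {k. u < \<bar>x k\<bar>}"
  have inj: "inj_on k I" for I
    unfolding k_def using strict_mono_enumerate[OF inf] strict_mono_imp_inj_on inj_on_subset by blast
  have large: "u < \<bar>x (k i)\<bar>" for i using enumerate_in_set[OF inf, of i] by (simp add: k_def)
  have "(\<Sum>i<n. w i) \<le> c / \<phi> u" for n
  proof -
    have "\<phi> u * (\<Sum>i<n. w i) \<le> (\<Sum>i<n. \<phi> \<bar>x (k i)\<bar> * w i)"
      unfolding sum_distrib_left using large u w_pos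
      by (intro sum_mono mult_right_mono phi_mono) (auto simp: less_imp_le)
    also have "\<dots> \<le> c" by (rule OL_boundD[OF x _ inj]) simp
    finally show ?thesis using phi_pos[OF u] by (simp add: field_simps)
  qed
  then have "(\<Sum>i<n. ennreal (w i)) \<le> ennreal (c / \<phi> u)" for n
    using w_pos by (simp add: sum_ennreal less_imp_le ennreal_leI)
  then have "W_infinity w \<le> ennreal (c / \<phi> u)"
    unfolding W_infinity_def by (intro suminf_le_const summableI)
  then show False using W by (simp add: top_unique)
qed

text \<open>
  If an index map \<open>k\<close> on \<open>{..<m}\<close> nearly attains the modular of \<open>x\<close>, then prolonging it by an index map
  of a tail of \<open>x\<close> shows that the terms of the tail with weights beyond \<open>m\<close> contribute little; the
  other \<open>m\<close> terms are small because \<open>x\<close> tends to 0.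
\<close>

lemma OL_bound_tail:
  assumes W: "W_infinity w = \<infinity>" and x: "OL_bound \<phi> w c x" and e: "0 < e"
  shows "\<forall>\<^sub>F n in sequentially. OL_bound \<phi> w e (x - trunc n x)"
proof -
  define S where "S = {s. \<exists>I k. finite I \<and> inj_on k I \<and> s = (\<Sum>i\<in>I. \<phi> \<bar>x (k i)\<bar> * w i)}"
  have S_upper: "s \<le> c" if "s \<in> S" for s using that OL_boundD[OF x] by (auto simp: S_def)
  then have bdd: "bdd_above S" by (auto simp: bdd_above_def)
  have "0 \<in> S" by (auto simp: S_def intro!: exI[of _ "{}"])
  then obtain s where s: "s \<in> S" "Sup S - e / 2 < s"
    using less_cSup_iff[of S "Sup S - e / 2"] bdd e by fastforce
  then obtain I k where I: "finite I" "inj_on k I" and s_eq: "s = (\<Sum>i\<in>I. \<phi> \<bar>x (k i)\<bar> * w i)"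
    by (auto simp: S_def)
  obtain m where m: "I \<subseteq> {..<m}" using I(1) finite_nat_iff_bounded by blast
  \<comment> \<open>At most \<open>m\<close> terms of size \<open>d * w 0\<close> add up to at most
    \<open>e / 2\<close>; \<open>Suc m\<close> guards against \<open>m = 0\<close>.\<close>
  define d where "d = e / 2 / (real (Suc m) * w 0)"
  have d: "0 < d" using e w_pos[of 0] by (simp add: d_def)
  have "((\<lambda>n. \<phi> \<bar>inverse (real (Suc n))\<bar>) \<longlonglongrightarrow> \<phi> \<bar>0\<bar>)"
    by (rule tendsto_phi_abs[OF LIMSEQ_inverse_real_of_nat])
  then obtain j where "\<phi> \<bar>inverse (real (Suc j))\<bar> < d"
    using order_tendstoD(2)[of _ "\<phi> \<bar>0\<bar>" sequentially d] d phi_0 by (auto simp: eventually_sequentially)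
  then obtain u where u: "0 < u" "\<phi> u < d" by (intro that[of "inverse (real (Suc j))"]) auto
  have "finite ({k. u < \<bar>x k\<bar>} \<union> k ` I)"
    using finite_large_coordinates[OF W x u(1)] I(1) by simp
  then obtain n0 where n0: "{k. u < \<bar>x k\<bar>} \<union> k ` I \<subseteq> {..<n0}" using finite_nat_iff_bounded by blast
  have "OL_bound \<phi> w e (x - trunc n x)" if n: "n0 \<le> n" for n
    unfolding OL_bound_def
  proof (intro allI impI)
    fix J :: "nat set" and l :: "nat \<Rightarrow> nat" assume J: "finite J" "inj_on l J"
    define z where "z = x - trunc n x"
    have z: "z k = (if k < n then 0 else x k)" for k by (simp add: z_def trunc_def)
    have z_small: "\<phi> \<bar>z k\<bar> \<le> d" for k
    proof -
      have "\<bar>z k\<bar> \<le> u" using n0 n u(1) by (fastforce simp: z not_less)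
      then show ?thesis using phi_mono[of "\<bar>z k\<bar>" u] u(2) by simp
    qed
    have "(\<Sum>i\<in>J \<inter> {..<m}. \<phi> \<bar>z (l i)\<bar> * w i) \<le> (\<Sum>i\<in>J \<inter> {..<m}. d * w 0)"
      using z_small w_le w_pos d by (intro sum_mono mult_mono) (auto simp: less_imp_le)
    also have "\<dots> \<le> real m * (d * w 0)"
      using card_mono[of "{..<m}" "J \<inter> {..<m}"] d w_pos[of 0] by (simp add: mult_right_mono)
    also have "\<dots> = e / 2 * (real m / real (Suc m))" using w_pos[of 0] by (simp add: d_def)
    also have "\<dots> \<le> e / 2 * 1" using e by (intro mult_left_mono) auto
    also have "\<dots> = e / 2" by simp
    finally have head: "(\<Sum>i\<in>J \<inter> {..<m}. \<phi> \<bar>z (l i)\<bar> * w i) \<le> e / 2" .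
    \<comment> \<open>Coordinates below \<open>n\<close> vanish in \<open>z\<close>, so
      \<open>T\<close> and the positions below \<open>m\<close> account for all nonzero
      terms.\<close>
    define T where "T = {i\<in>J. m \<le> i \<and> n \<le> l i}"
    define p where "p = (\<lambda>i. if i \<in> I then k i else l i)"
    have disj: "I \<inter> T = {}" using m by (auto simp: T_def)
    have fin: "finite (I \<union> T)" using I(1) J(1) by (simp add: T_def)
    have "k i \<noteq> l j" if "i \<in> I" "j \<in> T" for i j
      using that n0 n by (fastforce simp: T_def)
    moreover have "inj_on l T" using J(2) by (rule inj_on_subset) (auto simp: T_def)
    ultimately have "inj_on p (I \<union> T)"
      using I(2) disj by (auto simp: inj_on_def p_def) metis+
    then have "(\<Sum>i\<in>I \<union> T. \<phi> \<bar>x (p i)\<bar> * w i) \<in> S" using fin unfolding S_def by blast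
    then have "(\<Sum>i\<in>I \<union> T. \<phi> \<bar>x (p i)\<bar> * w i) \<le> Sup S" using bdd by (rule cSup_upper)
    also have "(\<Sum>i\<in>I \<union> T. \<phi> \<bar>x (p i)\<bar> * w i)
        = (\<Sum>i\<in>I. \<phi> \<bar>x (p i)\<bar> * w i) + (\<Sum>i\<in>T. \<phi> \<bar>x (p i)\<bar> * w i)"
      using I(1) fin disj by (intro sum.union_disjoint) auto
    also have "(\<Sum>i\<in>I. \<phi> \<bar>x (p i)\<bar> * w i) = s" unfolding s_eq by (simp add: p_def)
    also have "(\<Sum>i\<in>T. \<phi> \<bar>x (p i)\<bar> * w i) = (\<Sum>i\<in>T. \<phi> \<bar>z (l i)\<bar> * w i)"
      using disj by (intro sum.cong refl) (auto simp: p_def z T_def)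
    \<comment> \<open>The joined map contributes \<open>s\<close> plus the tail sum, at most
      \<open>Sup S\<close>, and \<open>Sup S < s + e / 2\<close>.\<close>
    finally have tail: "(\<Sum>i\<in>T. \<phi> \<bar>z (l i)\<bar> * w i) \<le> e / 2" using s(2) by simp
    have "(\<Sum>i\<in>J. \<phi> \<bar>z (l i)\<bar> * w i) = (\<Sum>i\<in>(J \<inter> {..<m}) \<union> T. \<phi> \<bar>z (l i)\<bar> * w i)"
      using J(1) by (intro sum.mono_neutral_right) (auto simp: T_def z phi_0)
    also have "\<dots> = (\<Sum>i\<in>J \<inter> {..<m}. \<phi> \<bar>z (l i)\<bar> * w i) + (\<Sum>i\<in>T. \<phi> \<bar>z (l i)\<bar> * w i)"
      using J(1) by (intro sum.union_disjoint) (auto simp: T_def)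
    finally show "(\<Sum>i\<in>J. \<phi> \<bar>(x - trunc n x) (l i)\<bar> * w i) \<le> e"
      using head tail by (simp only: z_def)
  qed
  then show ?thesis by (auto simp: eventually_sequentially)
qed

text \<open>The doubling condition covers arguments up to \<open>u0\<close>. The finitely many
  coordinates above \<open>u0\<close> form a finitely supported sequence with a bound of its
  own.\<close>

lemma Delta2_bound:
  assumes W: "W_infinity w = \<infinity>" and D: "Delta2_0 \<phi>" and x: "OL_bound \<phi> w c x"
  shows "\<exists>c'. OL_bound \<phi> w c' (2 *\<^sub>R x)"
proof -
  obtain K u0 where K: "0 < K" "0 < u0" "\<And>u. 0 \<le> u \<Longrightarrow> u \<le> u0 \<Longrightarrow> \<phi> (2 * u) \<le> K * \<phi> u"
    using D by (auto simp: Delta2_0_def)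
  define F where "F = {k. u0 < \<bar>x k\<bar>}"
  have fin: "finite F" unfolding F_def by (rule finite_large_coordinates[OF W x K(2)])
  have "OL_bound \<phi> w (w 0 * (\<Sum>k\<in>F. \<phi> \<bar>2 * x k\<bar>) + K * c) (2 *\<^sub>R x)"
    unfolding OL_bound_def
  proof (intro allI impI)
    fix I :: "nat set" and k :: "nat \<Rightarrow> nat" assume I: "finite I" "inj_on k I"
    define y where "y = (\<lambda>k. if k \<in> F then 2 * x k else 0)"
    have "(\<Sum>i\<in>I. \<phi> \<bar>(2 *\<^sub>R x) (k i)\<bar> * w i) \<le> (\<Sum>i\<in>I. \<phi> \<bar>y (k i)\<bar> * w i + K * (\<phi> \<bar>x (k i)\<bar> * w i))"
    proof (rule sum_mono)
      fix i
      have "\<phi> \<bar>2 * x (k i)\<bar> \<le> \<phi> \<bar>y (k i)\<bar> + K * \<phi> \<bar>x (k i)\<bar>"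
        using K(1) K(3)[of "\<bar>x (k i)\<bar>"] phi_nonneg[of "\<bar>x (k i)\<bar>"]
        by (auto simp: y_def F_def phi_0 abs_mult)
      from mult_right_mono[OF this less_imp_le[OF w_pos[of i]]]
      show "\<phi> \<bar>(2 *\<^sub>R x) (k i)\<bar> * w i \<le> \<phi> \<bar>y (k i)\<bar> * w i + K * (\<phi> \<bar>x (k i)\<bar> * w i)"
        by (simp add: scaleR_fun_def algebra_simps)
    qed
    also have "\<dots> = (\<Sum>i\<in>I. \<phi> \<bar>y (k i)\<bar> * w i) + K * (\<Sum>i\<in>I. \<phi> \<bar>x (k i)\<bar> * w i)"
      by (simp add: sum.distrib sum_distrib_left)
    also have "\<dots> \<le> w 0 * (\<Sum>k\<in>F. \<phi> \<bar>y k\<bar>) + K * c"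
      using K(1) by (intro add_mono mult_left_mono OL_boundD[OF x I]
          OL_boundD[OF OL_bound_finite_support[OF fin] I]) (auto simp: y_def)
    also have "(\<Sum>k\<in>F. \<phi> \<bar>y k\<bar>) = (\<Sum>k\<in>F. \<phi> \<bar>2 * x k\<bar>)" by (simp add: y_def)
    finally show "(\<Sum>i\<in>I. \<phi> \<bar>(2 *\<^sub>R x) (k i)\<bar> * w i) \<le> w 0 * (\<Sum>k\<in>F. \<phi> \<bar>2 * x k\<bar>) + K * c" .
  qed
  then show ?thesis by blast
qed

text \<open>A small modular of the tails does not by itself give a small norm. Repeated doubling
  gives every multiple of \<open>x\<close> a finite modular bound; the tail estimate for the
  multiple by \<open>2 / e\<close> then makes the norm of a tail at most
  \<open>e / 2\<close>.\<close>

lemma regular_fatou_space_OL: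
  assumes W: "W_infinity w = \<infinity>" and D: "Delta2_0 \<phi>"
  shows "regular_fatou_space (OL_space \<phi> w) (OL_norm \<phi> w)"
proof -
  interpret fatou_space "OL_space \<phi> w" "OL_norm \<phi> w" by (rule fatou_space_OL)
  show ?thesis
  proof
    fix x assume x: "x \<in> OL_space \<phi> w"
    then obtain l where l: "0 < l" "OL_bound \<phi> w 1 (inverse l *\<^sub>R x)" by (auto simp: OL_space_eq)
    have double: "\<exists>c. OL_bound \<phi> w c (2 ^ j *\<^sub>R inverse l *\<^sub>R x)" for j :: nat
    proof (induction j)
      case (Suc j)
      then obtain c where "OL_bound \<phi> w c (2 ^ j *\<^sub>R inverse l *\<^sub>R x)" by blast
      from Delta2_bound[OF W D this] show ?case by (simp add: mult.assoc)
    qed (use l(2) in auto)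
    show "(\<lambda>n. OL_norm \<phi> w (x - trunc n x)) \<longlonglongrightarrow> 0"
    proof (rule tendstoI)
      fix e :: real assume e: "0 < e"
      obtain j :: nat where "2 * l / e < 2 ^ j" using real_arch_pow[of 2 "2 * l / e"] by auto
      then have j: "inverse (e / 2) \<le> 2 ^ j * inverse l" using e l(1) by (simp add: field_simps)
      obtain c where c: "OL_bound \<phi> w c (2 ^ j *\<^sub>R inverse l *\<^sub>R x)" using double by blast
      have "OL_bound \<phi> w c (inverse (e / 2) *\<^sub>R x)"
      proof (rule OL_bound_solid[OF c])
        fix k
        have "\<bar>inverse (e / 2) * x k\<bar> = inverse (e / 2) * \<bar>x k\<bar>" using e by (simp add: abs_mult)
        also have "\<dots> \<le> 2 ^ j * inverse l * \<bar>x k\<bar>" by (intro mult_right_mono j) simp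
        also have "\<dots> = \<bar>2 ^ j * (inverse l * x k)\<bar>" using l(1) by (simp add: abs_mult)
        finally show "\<bar>(inverse (e / 2) *\<^sub>R x) k\<bar> \<le> \<bar>(2 ^ j *\<^sub>R inverse l *\<^sub>R x) k\<bar>"
          by (simp only: scaleR_fun_def real_scaleR_def)
      qed
      from OL_bound_tail[OF W this zero_less_one]
      show "\<forall>\<^sub>F n in sequentially. dist (OL_norm \<phi> w (x - trunc n x)) 0 < e"
      proof eventually_elim
        case (elim n)
        then have "OL_bound \<phi> w 1 (inverse (e / 2) *\<^sub>R (x - trunc n x))"
          by (simp only: trunc_scaleR scaleR_diff_right)
        then have "OL_norm \<phi> w (x - trunc n x) \<le> e / 2" using e by (intro OL_norm_le) auto
        then show ?case
          using e OL_norm_nonneg[OF diff_mem[OF x trunc_mem], of n x]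
          unfolding dist_real_def by linarith
      qed
    qed
  qed
qed

end

theorem theorem3p2:
  fixes \<phi> :: "real \<Rightarrow> real" and w :: "nat \<Rightarrow> real"
  assumes "orlicz_N_function \<phi>"
    and "weight_sequence w"
    and "W_infinity w = \<infinity>"
    and "Delta2_0 \<phi>"
  shows "separable_on (OL_space \<phi> w) (OL_norm \<phi> w)
    \<and> dual_space (OL_space \<phi> w) (OL_norm \<phi> w)
    \<and> radon_nikodym_property TYPE('m) (OL_space \<phi> w) (OL_norm \<phi> w)
    \<and> (\<forall>\<epsilon>>0. \<exists>U. openin (subtopology (weak_topology_on (OL_space \<phi> w) (OL_norm \<phi> w))
                              (unit_ball (OL_space \<phi> w) (OL_norm \<phi> w))) U
              \<and> U \<noteq> {} \<and> norm_diameter (OL_norm \<phi> w) U < \<epsilon>)"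
proof -
  interpret orlicz_lorentz \<phi> w
    using assms by unfold_locales (simp_all add: orlicz_N_function_def)
  interpret regular_fatou_space "OL_space \<phi> w" "OL_norm \<phi> w"
    using assms by (intro regular_fatou_space_OL)
  show ?thesis
    using separable dual_space radon_nikodym small_weakly_open_set by blast
qed


end
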